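(* For even $n$, let $G_n$ be a graph chosen uniformly at random from all cubic graphs on the vertex set $\{1,\dots,n\}$. Then the probability that $G_n$ contains an independent set of size at least $0.4352\,n$ tends to $1$ as $n\to\infty$ (over even $n$).
   Context: Graphs are simple. A graph is cubic if every vertex has degree three. An independent set is a set of pairwise non-adjacent vertices. *)

theory Defs
  imports "HOL-Probability.Probability_Mass_Function"
begin

text \<open>A simple graph is given by its vertex set \<open>V\<close> and its set \<open>E\<close> of edges, which are
  two-element subsets of \<open>V\<close>; distinct edge sets are distinct labelled graphs.\<close>

definition simple_graph :: "'a set \<Rightarrow> 'a set set \<Rightarrow> bool" where
  "simple_graph V E \<longleftrightarrow> (\<forall>e\<in>E. e \<subseteq> V \<and> card e = 2)"

definition vertex_degree :: "'a set set \<Rightarrow> 'a \<Rightarrow> nat" where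
  "vertex_degree E v = card {e \<in> E. v \<in> e}"

definition cubic_graph :: "'a set \<Rightarrow> 'a set set \<Rightarrow> bool" where
  "cubic_graph V E \<longleftrightarrow> simple_graph V E \<and> (\<forall>v\<in>V. vertex_degree E v = 3)"

definition independent_set :: "'a set \<Rightarrow> 'a set set \<Rightarrow> 'a set \<Rightarrow> bool" where
  "independent_set V E S \<longleftrightarrow> S \<subseteq> V \<and> pairwise (\<lambda>u v. {u, v} \<notin> E) S"

definition cubic_graphs :: "nat \<Rightarrow> nat set set set" where
  "cubic_graphs n = {E. cubic_graph {1..n} E}"

text \<open>\<open>pmf_of_set\<close> is uniform only on a finite nonempty set. The set \<open>cubic_graphs n\<close> is always
  finite, and among even \<open>n\<close> it is empty only for \<open>n = 2\<close>, which does not affect limits.\<close>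

definition random_cubic_graph :: "nat \<Rightarrow> nat set set pmf" where
  "random_cubic_graph n = pmf_of_set (cubic_graphs n)"

end

(* Give every vertex three half-edges and match all half-edges uniformly at random. Suppose some edges
   carry a flag, which stands for a subdividing vertex of degree two, and some vertices have been
   declared to lie outside the independent set, so that their half-edges are stubs. Given the number u of
   remaining vertices, the number s of flags and the number y of stubs, the matching is uniform, and this
   persists under a greedy procedure. If there is a stub, its partner is exposed. A plain edge to a
   vertex z leaves z with degree two, so z is suppressed and its other two edges are merged; two adjacent
   vertices of degree two can be contracted at the price of one independent vertex, so only the parity
   of the flags is kept. A flagged edge at a stub contributes its subdividing vertex to the independent
   set, and its other end is deleted. If there is no stub, the subdividing vertex of a flagged edge is
   taken and both ends of that edge are deleted.

   With m = (3u + y)/2 edges left, the potential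
     0.4353 u + 0.55 s + 0.1057 y - 0.1 y^2/m + 0.05 min(s + y, 3)
   plus the number of vertices taken has positive drift in every step as long as m is large. Hence
   exp(- l alpha) has mean at most a constant times exp(- 0.4353 l n) for small l, and a configuration has
   no independent set of size 0.4352 n with exponentially small probability only. A greedy construction
   with three final switchings shows that simple configurations make up at least an inverse polynomial
   fraction of all configurations, and every cubic graph comes from exactly 6^n of them. *)

theory Submission
  imports Defs "HOL-Real_Asymp.Real_Asymp"
begin

subsection \<open>Matchings with flagged edges\<close>

text \<open>The induction bounds the exponential moment for every state at once, so no trajectory is
  followed: instead of a differential equation and a concentration argument there is one inequality
  per move. The price is that the drift must be positive for all proportions of flags and stubs,
  also for those with many stubs that a run of the procedure hardly reaches; this is what forces the
  quadratic term of the potential.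

  Probabilities are kept as unnormalised sums over pairs (M, T). Exposing an edge then is a
  bijection, and the uniformity of the state after two edges are merged is a double count: two outer
  ends together with a configuration of the rest amount to a configuration together with one of its
  edges, oriented.

  Loops and multiple edges are allowed throughout the moment estimate. Simplicity enters only at the
  end, where an exponentially small set of bad configurations absorbs any polynomial loss, so a
  crude lower bound for the number of simple configurations suffices.\<close>

definition matchings :: "'a set \<Rightarrow> 'a set set set" where
  "matchings H = {M. (\<forall>e\<in>M. card e = 2) \<and> (\<forall>e\<in>M. \<forall>e'\<in>M. e \<noteq> e' \<longrightarrow> e \<inter> e' = {}) \<and> \<Union>M = H}"

definition flagged :: "'a set \<Rightarrow> nat \<Rightarrow> ('a set set \<times> 'a set set) set" where
  "flagged H s = {(M, T). M \<in> matchings H \<and> T \<subseteq> M \<and> card T = s}"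

definition fsum :: "'a set \<Rightarrow> nat \<Rightarrow> ('a set set \<Rightarrow> 'a set set \<Rightarrow> real) \<Rightarrow> real" where
  "fsum H s f = (\<Sum>(M, T)\<in>flagged H s. f M T)"

lemma matchingsD:
  assumes "M \<in> matchings H"
  shows "\<And>e. e \<in> M \<Longrightarrow> card e = 2" "\<And>e e' x. e \<in> M \<Longrightarrow> e' \<in> M \<Longrightarrow> x \<in> e \<Longrightarrow> x \<in> e' \<Longrightarrow> e = e'" "\<Union>M = H"
  using assms unfolding matchings_def by blast+

lemma matchings_subset: "M \<in> matchings H \<Longrightarrow> M \<subseteq> Pow H"
  by (auto simp: matchings_def)

lemma finite_matchings: "finite H \<Longrightarrow> finite (matchings H)"
  by (rule finite_subset[of _ "Pow (Pow H)"]) (auto simp: matchings_def)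

lemma finite_matching: "finite H \<Longrightarrow> M \<in> matchings H \<Longrightarrow> finite M"
  by (meson finite_Pow_iff finite_subset matchings_subset)

lemma finite_flagged: assumes "finite H" shows "finite (flagged H s)"
proof (rule finite_subset)
  show "flagged H s \<subseteq> Pow (Pow H) \<times> Pow (Pow H)"
    unfolding flagged_def using matchings_subset by fastforce
qed (use assms in auto)

section \<open>Removing, restoring and averaging over one edge\<close>

lemma matchings_insert:
  assumes "M \<in> matchings (H - {h, g})" "h \<in> H" "g \<in> H" "g \<noteq> h"
  shows "insert {h, g} M \<in> matchings H" "{h, g} \<notin> M"
proof -
  have U: "\<Union>M = H - {h, g}" using assms by (auto simp: matchings_def)
  show "{h, g} \<notin> M" using U by blast
  show "insert {h, g} M \<in> matchings H"
    unfolding matchings_def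
  proof (intro CollectI conjI)
    show "\<forall>e\<in>insert {h, g} M. card e = 2" using assms by (auto simp: matchings_def)
    show "\<Union> (insert {h, g} M) = H" using U assms by auto
    have D: "e \<inter> {h, g} = {}" "{h, g} \<inter> e = {}" if "e \<in> M" for e
      using U that by blast+
    have D': "e \<inter> e' = {}" if "e \<in> M" "e' \<in> M" "e \<noteq> e'" for e e'
      using assms(1) that unfolding matchings_def by simp
    show "\<forall>e\<in>insert {h, g} M. \<forall>e'\<in>insert {h, g} M. e \<noteq> e' \<longrightarrow> e \<inter> e' = {}"
      by (metis D D' insert_iff)
  qed
qed

lemma matchings_remove:
  assumes "M \<in> matchings H" "{h, g} \<in> M"
  shows "M - {{h, g}} \<in> matchings (H - {h, g})"
proof -
  have U: "\<Union>M = H" and D: "\<And>e e'. e \<in> M \<Longrightarrow> e' \<in> M \<Longrightarrow> e \<noteq> e' \<Longrightarrow> e \<inter> e' = {}"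
    using assms by (auto simp: matchings_def)
  have D2: "x \<notin> {h, g}" if "e \<in> M" "e \<noteq> {h, g}" "x \<in> e" for e x
    using D[OF that(1) assms(2) that(2)] that(3) by blast
  have "\<Union>(M - {{h, g}}) = H - {h, g}"
  proof (intro equalityI subsetI)
    fix x assume "x \<in> \<Union>(M - {{h, g}})"
    then obtain e where "e \<in> M" "e \<noteq> {h, g}" "x \<in> e" by blast
    then show "x \<in> H - {h, g}" using D2[of e x] U by blast
  next
    fix x assume "x \<in> H - {h, g}"
    then show "x \<in> \<Union>(M - {{h, g}})" using U by blast
  qed
  moreover have "\<forall>e\<in>M - {{h, g}}. card e = 2" using assms(1) by (simp add: matchings_def)
  moreover have "\<forall>e\<in>M - {{h, g}}. \<forall>e'\<in>M - {{h, g}}. e \<noteq> e' \<longrightarrow> e \<inter> e' = {}" using D by simp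
  ultimately show ?thesis unfolding matchings_def by simp
qed

lemma matching_partner:
  assumes "M \<in> matchings H" "e \<in> M" "h \<in> e"
  obtains g where "g \<in> H - {h}" "e = {h, g}"
proof -
  have "card e = 2" "e \<subseteq> H" using assms by (auto simp: matchings_def)
  then obtain a b where "e = {a, b}" "a \<noteq> b" by (meson card_2_iff)
  with assms \<open>e \<subseteq> H\<close> that show ?thesis by (cases "h = a") (auto simp: insert_commute)
qed

lemma pair_eq_cancel: "{h, g} = {h, g'} \<Longrightarrow> g = g'"
  by (auto simp: doubleton_eq_iff)

text \<open>Deferred decisions as a bijection: a pair (M, T) whose edge at \<open>h\<close> is
  flagged is the same as the partner \<open>g\<close> of \<open>h\<close> and a pair on the
  remaining half-edges. The exposed edge takes one flag with it.\<close>

lemma fsum_expose_flagged: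
  assumes "finite H" "h \<in> H"
  shows "(\<Sum>(M, T)\<in>{(M, T)\<in>flagged H (Suc s). h \<in> \<Union>T}. f M T) =
         (\<Sum>g\<in>H - {h}. fsum (H - {h, g}) s (\<lambda>M T. f (insert {h, g} M) (insert {h, g} T)))"
proof -
  let ?A = "SIGMA g:H - {h}. flagged (H - {h, g}) s"
  let ?F = "\<lambda>(g, M, T). (insert {h, g} M, insert {h, g} T)"
  let ?B = "{(M, T)\<in>flagged H (Suc s). h \<in> \<Union>T}"
  have new: "{h, g} \<notin> M" if "g \<in> H - {h}" "(M, T) \<in> flagged (H - {h, g}) s" for g M T
    using that assms matchings_insert(2)[of M H h g] by (auto simp: flagged_def)
  have nh: "h \<notin> \<Union>M" if "g \<in> H - {h}" "(M, T) \<in> flagged (H - {h, g}) s" for g M T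
    using that by (auto simp: flagged_def matchings_def)
  have inj: "inj_on ?F ?A"
  proof (rule inj_onI)
    fix p q assume pq: "p \<in> ?A" "q \<in> ?A" "?F p = ?F q"
    obtain g M T g' M' T' where e: "p = (g, M, T)" "q = (g', M', T')" by (metis prod.exhaust)
    have a: "g \<in> H" "g' \<in> H" "g \<noteq> h" "g' \<noteq> h" "(M, T) \<in> flagged (H - {h, g}) s" "(M', T') \<in> flagged (H - {h, g'}) s"
      "insert {h, g} M = insert {h, g'} M'" "insert {h, g} T = insert {h, g'} T'"
      using pq e by auto
    \<comment> \<open>\<open>M'\<close> does not cover \<open>h\<close>, so the only edge at
      \<open>h\<close> determines the partner.\<close>
    have "{h, g} \<in> insert {h, g'} M'" using a(7) by blast
    moreover have "h \<notin> \<Union>M'" using nh[of g' M' T'] a by simp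
    then have "{h, g} \<notin> M'" by blast
    ultimately have "{h, g} = {h, g'}" by simp
    then have gg: "g = g'" by (rule pair_eq_cancel)
    have sub: "T \<subseteq> M" "T' \<subseteq> M'" using a(5,6) by (simp_all add: flagged_def)
    have n: "{h, g} \<notin> M" "{h, g} \<notin> M'" using new[of g M T] new[of g' M' T'] a(1-6) gg by simp_all
    then have "{h, g} \<notin> T" "{h, g} \<notin> T'" using sub by auto
    with n a(7,8) gg show "p = q" by (simp add: insert_ident e)
  qed
  have img: "?F ` ?A = ?B"
  proof (intro equalityI subsetI)
    fix p assume "p \<in> ?F ` ?A"
    then obtain g M T where p: "p = (insert {h, g} M, insert {h, g} T)" "g \<in> H - {h}" "(M, T) \<in> flagged (H - {h, g}) s" by auto
    have "{h, g} \<notin> T" using new[of g M T] p by (auto simp: flagged_def)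
    moreover have "finite T" using p assms finite_matching[of "H - {h,g}" M] by (auto simp: flagged_def intro: finite_subset)
    ultimately show "p \<in> ?B" using p assms matchings_insert(1)[of M H h g] by (auto simp: flagged_def)
  next
    fix p assume "p \<in> ?B"
    then obtain M T where p: "p = (M, T)" "M \<in> matchings H" "T \<subseteq> M" "card T = Suc s" "h \<in> \<Union>T"
      by (auto simp: flagged_def)
    then obtain e where e: "e \<in> T" "h \<in> e" by blast
    obtain g where g: "g \<in> H - {h}" "e = {h, g}" using matching_partner[OF p(2), of e h] e p by blast
    have "(M - {{h, g}}, T - {{h, g}}) \<in> flagged (H - {h, g}) s"
      using p e g matchings_remove[of M H h g] card_Suc_Diff1[of T e] finite_matching[OF assms(1) p(2)]
      by (auto simp: flagged_def intro: card_ge_0_finite)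
    then show "p \<in> ?F ` ?A" using p e g
      by (intro image_eqI[of _ _ "(g, M - {{h, g}}, T - {{h, g}})"]) auto
  qed
  have "(\<Sum>(M, T)\<in>?B. f M T) = (\<Sum>x\<in>?A. (\<lambda>(M, T). f M T) (?F x))"
    unfolding img[symmetric] by (subst sum.reindex[OF inj]) (simp add: o_def case_prod_unfold)
  also have "\<dots> = (\<Sum>g\<in>H - {h}. \<Sum>(M, T)\<in>flagged (H - {h, g}) s. f (insert {h, g} M) (insert {h, g} T))"
    using assms by (subst sum.Sigma) (auto simp: finite_flagged case_prod_unfold)
  finally show ?thesis unfolding fsum_def .
qed

lemma fsum_expose_plain:
  assumes "finite H" "h \<in> H"
  shows "(\<Sum>(M, T)\<in>{(M, T)\<in>flagged H s. h \<notin> \<Union>T}. f M T) =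
         (\<Sum>g\<in>H - {h}. fsum (H - {h, g}) s (\<lambda>M T. f (insert {h, g} M) T))"
proof -
  let ?A = "SIGMA g:H - {h}. flagged (H - {h, g}) s"
  let ?F = "\<lambda>(g, M, T). (insert {h, g} M, T)"
  let ?B = "{(M, T)\<in>flagged H s. h \<notin> \<Union>T}"
  have new: "{h, g} \<notin> M" if "g \<in> H - {h}" "(M, T) \<in> flagged (H - {h, g}) s" for g M T
    using that assms matchings_insert(2)[of M H h g] by (auto simp: flagged_def)
  have nh: "h \<notin> \<Union>M" if "g \<in> H - {h}" "(M, T) \<in> flagged (H - {h, g}) s" for g M T
    using that by (auto simp: flagged_def matchings_def)
  have inj: "inj_on ?F ?A"
  proof (rule inj_onI)
    fix p q assume pq: "p \<in> ?A" "q \<in> ?A" "?F p = ?F q"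
    obtain g M T g' M' where e: "p = (g, M, T)" "q = (g', M', T)" using pq by (cases p, cases q) auto
    have a: "g \<in> H" "g' \<in> H" "g \<noteq> h" "g' \<noteq> h" "(M, T) \<in> flagged (H - {h, g}) s" "(M', T) \<in> flagged (H - {h, g'}) s"
      "insert {h, g} M = insert {h, g'} M'"
      using pq e by auto
    have "{h, g} \<in> insert {h, g'} M'" using a(7) by blast
    moreover have "h \<notin> \<Union>M'" using nh[of g' M' T] a by simp
    then have "{h, g} \<notin> M'" by blast
    ultimately have "{h, g} = {h, g'}" by simp
    then have gg: "g = g'" by (rule pair_eq_cancel)
    have "{h, g} \<notin> M" "{h, g} \<notin> M'" using new[of g M T] new[of g' M' T] a(1-6) gg by simp_all
    with a(7) gg show "p = q" by (simp add: insert_ident e)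
  qed
  have img: "?F ` ?A = ?B"
  proof (intro equalityI subsetI)
    fix p assume "p \<in> ?F ` ?A"
    then obtain g M T where p: "p = (insert {h, g} M, T)" "g \<in> H - {h}" "(M, T) \<in> flagged (H - {h, g}) s" by auto
    then show "p \<in> ?B" using assms matchings_insert(1)[of M H h g] nh[of g M T] by (auto simp: flagged_def)
  next
    fix p assume "p \<in> ?B"
    then obtain M T where p: "p = (M, T)" "M \<in> matchings H" "T \<subseteq> M" "card T = s" "h \<notin> \<Union>T"
      by (auto simp: flagged_def)
    have "\<Union>M = H" using p by (auto simp: matchings_def)
    then obtain e where e: "e \<in> M" "h \<in> e" using assms by blast
    obtain g where g: "g \<in> H - {h}" "e = {h, g}" using matching_partner[OF p(2), of e h] e p by blast
    have "(M - {{h, g}}, T) \<in> flagged (H - {h, g}) s"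
      using p e g matchings_remove[of M H h g] by (auto simp: flagged_def)
    then show "p \<in> ?F ` ?A" using p e g
      by (intro image_eqI[of _ _ "(g, M - {{h, g}}, T)"]) auto
  qed
  have "(\<Sum>(M, T)\<in>?B. f M T) = (\<Sum>x\<in>?A. (\<lambda>(M, T). f M T) (?F x))"
    unfolding img[symmetric] by (subst sum.reindex[OF inj]) (simp add: o_def case_prod_unfold)
  also have "\<dots> = (\<Sum>g\<in>H - {h}. \<Sum>(M, T)\<in>flagged (H - {h, g}) s. f (insert {h, g} M) T)"
    using assms by (subst sum.Sigma) (auto simp: finite_flagged case_prod_unfold)
  finally show ?thesis unfolding fsum_def .
qed

text \<open>The guard at s = 0 matters because \<open>s - 1\<close> would be 0 again, although the
  edge at \<open>h\<close> cannot be flagged then.\<close>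

lemma fsum_expose:
  assumes "finite H" "h \<in> H"
  shows "fsum H s f = (\<Sum>g\<in>H - {h}. fsum (H - {h, g}) s (\<lambda>M T. f (insert {h, g} M) T)) +
    (if s = 0 then 0 else \<Sum>g\<in>H - {h}. fsum (H - {h, g}) (s - 1) (\<lambda>M T. f (insert {h, g} M) (insert {h, g} T)))"
proof -
  have fin: "finite (flagged H s)" using finite_flagged assms by blast
  let ?P = "{(M, T)\<in>flagged H s. h \<notin> \<Union>T}" and ?Q = "{(M, T)\<in>flagged H s. h \<in> \<Union>T}"
  have "?P \<union> ?Q = flagged H s" by blast
  moreover have "?P \<inter> ?Q = {}" by blast
  moreover have "finite ?P" "finite ?Q" by (rule finite_subset[OF _ fin]; simp add: subset_iff)+
  ultimately have "fsum H s f = (\<Sum>(M, T)\<in>?P. f M T) + (\<Sum>(M, T)\<in>?Q. f M T)"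
    unfolding fsum_def using sum.union_disjoint[of ?P ?Q "\<lambda>(M, T). f M T"] by simp
  also have "(\<Sum>(M, T)\<in>?Q. f M T) = (if s = 0 then 0 else \<Sum>g\<in>H - {h}. fsum (H - {h, g}) (s - 1) (\<lambda>M T. f (insert {h, g} M) (insert {h, g} T)))"
  proof (cases s)
    case 0
    have "T = {}" if "(M, T) \<in> flagged H s" for M T
    proof -
      have "finite T" "card T = 0" using that finite_matching[OF assms(1)] 0
        by (auto simp: flagged_def intro: finite_subset)
      then show ?thesis by simp
    qed
    then have Q: "?Q = {}" by auto
    show ?thesis unfolding Q using 0 by simp
  next
    case (Suc k)
    then show ?thesis using fsum_expose_flagged[OF assms, where s = k and f = f] by simp
  qed
  finally show ?thesis using fsum_expose_plain[OF assms, where s = s and f = f] by simp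
qed

lemma card_Union_matching:
  assumes "finite H" "M \<in> matchings H" "T \<subseteq> M"
  shows "card (\<Union>T) = 2 * card T"
proof -
  have "finite T" using assms finite_matching finite_subset by blast
  have "card (\<Union>T) = sum card T"
  proof (rule card_Union_disjoint)
    have D: "\<And>e e'. e \<in> M \<Longrightarrow> e' \<in> M \<Longrightarrow> e \<noteq> e' \<Longrightarrow> e \<inter> e' = {}"
      using assms(2) by (simp add: matchings_def)
    show "pairwise disjnt T" unfolding pairwise_def disjnt_def using assms(3) D by (meson subsetD)
    show "\<And>A. A \<in> T \<Longrightarrow> finite A"
      using assms by (metis card.infinite matchingsD(1) subsetD zero_neq_numeral)
  qed
  also have "\<dots> = 2 * card T"
    using assms by (simp add: matchings_def subset_iff)
  finally show ?thesis .
qed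

lemma sum_filter_snd:
  assumes "finite A"
  shows "(\<Sum>(M, T)\<in>{(M, T)\<in>A. P T}. f M T) = (\<Sum>p\<in>A. if P (snd p) then f (fst p) (snd p) else (0::real))"
proof -
  have "{(M, T)\<in>A. P T} = {p\<in>A. P (snd p)}" by auto
  then show ?thesis using sum.inter_filter[OF assms, of "\<lambda>p. f (fst p) (snd p)" "\<lambda>p. P (snd p)"]
    by (simp add: case_prod_unfold)
qed

text \<open>A configuration is hit once for each orientation of each of its flagged edges. Read from
  left to right, the identity says that adding a new flagged edge with arbitrary ends to a
  configuration of the rest gives the uniform measure again; this is how merged edges are treated
  later.\<close>

lemma fsum_pick_flagged:
  assumes "finite H"
  shows "(\<Sum>h\<in>H. \<Sum>g\<in>H - {h}. fsum (H - {h, g}) s (\<lambda>M T. f (insert {h, g} M) (insert {h, g} T))) =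
         2 * real (Suc s) * fsum H (Suc s) f"
proof -
  have fin: "finite (flagged H (Suc s))" using finite_flagged assms by blast
  have "(\<Sum>h\<in>H. \<Sum>g\<in>H - {h}. fsum (H - {h, g}) s (\<lambda>M T. f (insert {h, g} M) (insert {h, g} T))) =
     (\<Sum>h\<in>H. \<Sum>(M, T)\<in>{(M, T)\<in>flagged H (Suc s). h \<in> \<Union>T}. f M T)"
    using fsum_expose_flagged[OF assms] by (intro sum.cong) auto
  also have "\<dots> = (\<Sum>h\<in>H. \<Sum>p\<in>flagged H (Suc s). if h \<in> \<Union>(snd p) then f (fst p) (snd p) else 0)"
    by (intro sum.cong refl sum_filter_snd fin)
  also have "\<dots> = (\<Sum>p\<in>flagged H (Suc s). \<Sum>h\<in>H. if h \<in> \<Union>(snd p) then f (fst p) (snd p) else 0)"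
    by (rule sum.swap)
  also have "\<dots> = (\<Sum>p\<in>flagged H (Suc s). 2 * real (Suc s) * f (fst p) (snd p))"
  proof (rule sum.cong[OF refl])
    fix p assume p: "p \<in> flagged H (Suc s)"
    have "(\<Sum>h\<in>H. if h \<in> \<Union>(snd p) then f (fst p) (snd p) else 0) = (\<Sum>h\<in>{h\<in>H. h \<in> \<Union>(snd p)}. f (fst p) (snd p))"
      using assms by (rule sum.inter_filter[symmetric])
    also have "{h\<in>H. h \<in> \<Union>(snd p)} = \<Union>(snd p)" using p by (auto simp: flagged_def matchings_def)
    also have "(\<Sum>h\<in>\<Union>(snd p). f (fst p) (snd p)) = real (card (\<Union>(snd p))) * f (fst p) (snd p)" by simp
    also have "card (\<Union>(snd p)) = 2 * Suc s" using card_Union_matching[OF assms, of "fst p" "snd p"] p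
      by (auto simp: flagged_def)
    finally show "(\<Sum>h\<in>H. if h \<in> \<Union>(snd p) then f (fst p) (snd p) else 0) = 2 * real (Suc s) * f (fst p) (snd p)" by simp
  qed
  finally show ?thesis by (simp add: fsum_def sum_distrib_left case_prod_unfold)
qed

text \<open>The same double count over the m - s plain edges; it serves merged edges without a
  flag.\<close>

lemma fsum_pick_plain:
  assumes "finite H" "card H = 2 * m"
  shows "(\<Sum>h\<in>H. \<Sum>g\<in>H - {h}. fsum (H - {h, g}) s (\<lambda>M T. f (insert {h, g} M) T)) =
         2 * (real m - real s) * fsum H s f"
proof -
  have fin: "finite (flagged H s)" using finite_flagged assms by blast
  have "(\<Sum>h\<in>H. \<Sum>g\<in>H - {h}. fsum (H - {h, g}) s (\<lambda>M T. f (insert {h, g} M) T)) =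
     (\<Sum>h\<in>H. \<Sum>(M, T)\<in>{(M, T)\<in>flagged H s. h \<notin> \<Union>T}. f M T)"
    using fsum_expose_plain[OF assms(1)] by (intro sum.cong) auto
  also have "\<dots> = (\<Sum>h\<in>H. \<Sum>p\<in>flagged H s. if h \<notin> \<Union>(snd p) then f (fst p) (snd p) else 0)"
    by (intro sum.cong refl sum_filter_snd fin)
  also have "\<dots> = (\<Sum>p\<in>flagged H s. \<Sum>h\<in>H. if h \<notin> \<Union>(snd p) then f (fst p) (snd p) else 0)"
    by (rule sum.swap)
  also have "\<dots> = (\<Sum>p\<in>flagged H s. 2 * (real m - real s) * f (fst p) (snd p))"
  proof (rule sum.cong[OF refl])
    fix p assume p: "p \<in> flagged H s"
    have sub: "\<Union>(snd p) \<subseteq> H" using p by (force simp: flagged_def matchings_def)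
    have c: "card (\<Union>(snd p)) = 2 * s" using card_Union_matching[OF assms(1), of "fst p" "snd p"] p
      by (auto simp: flagged_def)
    have "(\<Sum>h\<in>H. if h \<notin> \<Union>(snd p) then f (fst p) (snd p) else 0) = (\<Sum>h\<in>{h\<in>H. h \<notin> \<Union>(snd p)}. f (fst p) (snd p))"
      using assms(1) by (rule sum.inter_filter[symmetric])
    also have "{h\<in>H. h \<notin> \<Union>(snd p)} = H - \<Union>(snd p)" by auto
    also have "(\<Sum>h\<in>H - \<Union>(snd p). f (fst p) (snd p)) = real (card (H - \<Union>(snd p))) * f (fst p) (snd p)" by simp
    also have "card (H - \<Union>(snd p)) = card H - card (\<Union>(snd p))"
      using card_Diff_subset[OF finite_subset[OF sub assms(1)] sub] .
    also have "real (card H - card (\<Union>(snd p))) = 2 * (real m - real s)"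
      using card_mono[OF assms(1) sub] c assms(2) by (simp add: of_nat_diff)
    finally show "(\<Sum>h\<in>H. if h \<notin> \<Union>(snd p) then f (fst p) (snd p) else 0) = 2 * (real m - real s) * f (fst p) (snd p)" by simp
  qed
  finally show ?thesis by (simp add: fsum_def sum_distrib_left case_prod_unfold)
qed

lemma even_card_matchings:
  assumes "finite H" "M \<in> matchings H" shows "card H = 2 * card M"
  using card_Union_matching[OF assms subset_refl] matchingsD(3)[OF assms(2)] by simp

subsection \<open>Independent sets in flagged configurations\<close>

text \<open>A half-edge is a pair whose first component is its vertex. The vertices in \<open>W\<close> are still undecided;
  half-edges at other vertices are stubs, because those vertices are not in the independent set.
  The edges in \<open>T \<subseteq> M\<close> are flagged: the second summand of \<open>weight\<close> counts the subdividing vertices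
  that can be added to \<open>S\<close>.\<close>

definition feasible :: "'v set \<Rightarrow> ('v \<times> 'k) set set \<Rightarrow> ('v \<times> 'k) set set \<Rightarrow> 'v set \<Rightarrow> bool" where
  "feasible W M T S \<longleftrightarrow> S \<subseteq> W \<and> (\<forall>e\<in>M - T. \<not> fst ` e \<subseteq> S)"

definition weight :: "('v \<times> 'k) set set \<Rightarrow> 'v set \<Rightarrow> nat" where
  "weight T S = card S + card {e\<in>T. fst ` e \<inter> S = {}}"

definition alpha :: "'v set \<Rightarrow> ('v \<times> 'k) set set \<Rightarrow> ('v \<times> 'k) set set \<Rightarrow> nat" where
  "alpha W M T = Max (weight T ` {S. feasible W M T S})"

lemma finite_feasible: "finite W \<Longrightarrow> finite {S. feasible W M T S}"
  by (rule finite_subset[of _ "Pow W"]) (auto simp: feasible_def)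

lemma weight_le_alpha: "finite W \<Longrightarrow> feasible W M T S \<Longrightarrow> weight T S \<le> alpha W M T"
  unfolding alpha_def by (intro Max_ge) (auto simp: finite_feasible)

text \<open>A plain empty edge would be contained in every \<open>S\<close> and leave nothing
  feasible, so \<open>alpha\<close> would be the maximum of an empty set; hence
  \<open>{} \<notin> M\<close>.\<close>

lemma alpha_attained:
  assumes "finite W" "{} \<notin> M"
  obtains S where "feasible W M T S" "weight T S = alpha W M T"
proof -
  have "feasible W M T {}" using assms by (auto simp: feasible_def)
  then have "alpha W M T \<in> weight T ` {S. feasible W M T S}"
    unfolding alpha_def using assms by (intro Max_in) (auto simp: finite_feasible)
  with that show ?thesis by auto
qed

text \<open>Only lower bounds on \<open>alpha\<close> are wanted, so every reduction is justified by
  lifting a solution of the reduced instance back to the original one.\<close>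

lemma alpha_reduce:
  assumes "finite W" "finite W'" "{} \<notin> M'"
    and "\<And>S'. feasible W' M' T' S' \<Longrightarrow> \<exists>S. feasible W M T S \<and> weight T' S' + k \<le> weight T S"
  shows "alpha W' M' T' + k \<le> alpha W M T"
proof -
  obtain S' where S': "feasible W' M' T' S'" "weight T' S' = alpha W' M' T'"
    using alpha_attained[OF assms(2,3)] .
  obtain S where "feasible W M T S" "weight T' S' + k \<le> weight T S" using assms(4)[OF S'(1)] by blast
  then show ?thesis using weight_le_alpha[OF assms(1), of M T S] S'(2) by simp
qed

lemma alpha_mono:
  assumes "finite W" "W' \<subseteq> W" "{} \<notin> M"
  shows "alpha W' M T \<le> alpha W M T"
proof -
  have "alpha W' M T + 0 \<le> alpha W M T"
  proof (rule alpha_reduce)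
    fix S assume "feasible W' M T S"
    then show "\<exists>S'. feasible W M T S' \<and> weight T S + 0 \<le> weight T S'"
      using assms(2) by (intro exI[of _ S]) (auto simp: feasible_def)
  qed (use assms finite_subset in auto)
  then show ?thesis by simp
qed

lemma weight_insert:
  assumes "finite T" "e \<notin> T"
  shows "weight (insert e T) S = weight T S + (if fst ` e \<inter> S = {} then 1 else 0)"
proof -
  have "{x\<in>insert e T. fst ` x \<inter> S = {}} = (if fst ` e \<inter> S = {} then insert e {x\<in>T. fst ` x \<inter> S = {}} else {x\<in>T. fst ` x \<inter> S = {}})"
    by auto
  then show ?thesis using assms by (simp add: weight_def)
qed

lemma weight_insert_vertex:
  assumes "finite S" "z \<notin> S" "\<And>e. e \<in> T \<Longrightarrow> z \<notin> fst ` e"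
  shows "weight T (insert z S) = weight T S + 1"
proof -
  have "{e\<in>T. fst ` e \<inter> insert z S = {}} = {e\<in>T. fst ` e \<inter> S = {}}" using assms by blast
  then show ?thesis using assms by (simp add: weight_def)
qed

lemma feasible_subset:
  "feasible W M T S \<Longrightarrow> W \<subseteq> W' \<Longrightarrow> M' - T' \<subseteq> M - T \<Longrightarrow> feasible W' M' T' S"
  unfolding feasible_def by (meson subset_iff)

text \<open>With both ends of \<open>e\<close> excluded from \<open>W'\<close>, the subdividing
  vertex of \<open>e\<close> can be added to every solution.\<close>

lemma alpha_take_flagged:
  assumes "finite W" "W' \<subseteq> W" "{} \<notin> M" "finite T" "fst ` e \<inter> W' = {}" "e \<notin> T"
  shows "alpha W' M T + 1 \<le> alpha W (insert e M) (insert e T)"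
proof (rule alpha_reduce)
  fix S assume S: "feasible W' M T S"
  then have "fst ` e \<inter> S = {}" using assms(5) by (auto simp: feasible_def)
  then show "\<exists>S'. feasible W (insert e M) (insert e T) S' \<and> weight T S + 1 \<le> weight (insert e T) S'"
    using assms S by (intro exI[of _ S] conjI feasible_subset[OF S]) (auto simp: weight_insert)
qed (use assms finite_subset in auto)

text \<open>A stub never belongs to \<open>S\<close>, so a plain edge at a stub forbids
  nothing.\<close>

lemma alpha_drop_plain:
  assumes "finite W" "{} \<notin> M" "fst h \<notin> W"
  shows "alpha W M T \<le> alpha W (insert {h, g} M) T"
proof -
  have "alpha W M T + 0 \<le> alpha W (insert {h, g} M) T"
  proof (rule alpha_reduce)
    fix S assume "feasible W M T S"
    then show "\<exists>S'. feasible W (insert {h, g} M) T S' \<and> weight T S + 0 \<le> weight T S'"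
      using assms by (intro exI[of _ S]) (auto simp: feasible_def)
  qed (use assms in auto)
  then show ?thesis by simp
qed

text \<open>The vertex \<open>z\<close> has only the two half-edges \<open>h\<^sub>1\<close>, \<open>h\<^sub>2\<close> left, so it and the flags on its
  edges form a path of \<open>1 + t\<^sub>1 + t\<^sub>2\<close> vertices of degree two joining \<open>g\<^sub>1\<close> and \<open>g\<^sub>2\<close>. Two adjacent
  vertices of degree two can be contracted at the price of one independent vertex.\<close>

locale suppress =
  fixes W :: "'v set" and M T :: "('v \<times> 'k) set set" and h\<^sub>1 h\<^sub>2 g\<^sub>1 g\<^sub>2 :: "'v \<times> 'k" and z :: 'v
  assumes fin: "finite W" "finite T" and TM: "T \<subseteq> M" and ne: "{} \<notin> M"
    and z: "z \<in> W" "fst h\<^sub>1 = z" "fst h\<^sub>2 = z" "fst g\<^sub>1 \<noteq> z" "fst g\<^sub>2 \<noteq> z"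
    and dist: "h\<^sub>1 \<noteq> h\<^sub>2" "g\<^sub>1 \<noteq> g\<^sub>2"
    and fresh: "\<And>e. e \<in> M \<Longrightarrow> h\<^sub>1 \<notin> e \<and> h\<^sub>2 \<notin> e \<and> g\<^sub>1 \<notin> e \<and> g\<^sub>2 \<notin> e \<and> z \<notin> fst ` e"
begin

lemma fresh_edges: "{h\<^sub>1, g\<^sub>1} \<notin> M" "{h\<^sub>2, g\<^sub>2} \<notin> M" "{g\<^sub>1, g\<^sub>2} \<notin> M"
  "{h\<^sub>1, g\<^sub>1} \<notin> T" "{h\<^sub>2, g\<^sub>2} \<notin> T" "{g\<^sub>1, g\<^sub>2} \<notin> T" "{h\<^sub>1, g\<^sub>1} \<noteq> {h\<^sub>2, g\<^sub>2}"
  using fresh TM z dist by (auto simp: doubleton_eq_iff)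

lemma feasibleD:
  assumes "feasible (W - {z}) M' T' S"
  shows "S \<subseteq> W" "z \<notin> S" "finite S" "\<And>e. e \<in> M' \<Longrightarrow> e \<notin> T' \<Longrightarrow> \<not> fst ` e \<subseteq> S"
  using assms fin finite_subset[of S W] by (auto simp: feasible_def)

lemma feasible_insert_z: "e \<in> M \<Longrightarrow> \<not> fst ` e \<subseteq> S \<Longrightarrow> \<not> fst ` e \<subseteq> insert z S"
  using fresh by blast

lemma weight_insert_z: "finite S \<Longrightarrow> z \<notin> S \<Longrightarrow> weight T (insert z S) = weight T S + 1"
  using fresh TM by (intro weight_insert_vertex) auto

text \<open>The flag on the merged edge is \<open>z\<close> itself: \<open>z\<close> can be taken
  exactly when neither outer end is in \<open>S\<close>, and this is when the flag counts.\<close>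

lemma suppress_plain_plain:
  "alpha (W - {z}) (insert {g\<^sub>1, g\<^sub>2} M) (insert {g\<^sub>1, g\<^sub>2} T) \<le> alpha W (insert {h\<^sub>1, g\<^sub>1} (insert {h\<^sub>2, g\<^sub>2} M)) T"
proof -
  have "alpha (W - {z}) (insert {g\<^sub>1, g\<^sub>2} M) (insert {g\<^sub>1, g\<^sub>2} T) + 0 \<le> alpha W (insert {h\<^sub>1, g\<^sub>1} (insert {h\<^sub>2, g\<^sub>2} M)) T"
  proof (rule alpha_reduce)
    fix S assume S: "feasible (W - {z}) (insert {g\<^sub>1, g\<^sub>2} M) (insert {g\<^sub>1, g\<^sub>2} T) S"
    note D = feasibleD[OF S]
    have w: "weight (insert {g\<^sub>1, g\<^sub>2} T) S = weight T S + (if fst g\<^sub>1 \<notin> S \<and> fst g\<^sub>2 \<notin> S then 1 else 0)"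
      using weight_insert[OF fin(2) fresh_edges(6)] by simp
    have P: "\<not> fst ` e \<subseteq> S" if "e \<in> M" "e \<notin> T" for e using D(4)[of e] that fresh_edges by auto
    show "\<exists>S'. feasible W (insert {h\<^sub>1, g\<^sub>1} (insert {h\<^sub>2, g\<^sub>2} M)) T S' \<and> weight (insert {g\<^sub>1, g\<^sub>2} T) S + 0 \<le> weight T S'"
    proof (cases "fst g\<^sub>1 \<notin> S \<and> fst g\<^sub>2 \<notin> S")
      case True
      have "feasible W (insert {h\<^sub>1, g\<^sub>1} (insert {h\<^sub>2, g\<^sub>2} M)) T (insert z S)"
        using True D z P feasible_insert_z by (auto simp: feasible_def)
      then show ?thesis using w True weight_insert_z[of S] D by (intro exI[of _ "insert z S"]) auto
    next
      case False
      have "feasible W (insert {h\<^sub>1, g\<^sub>1} (insert {h\<^sub>2, g\<^sub>2} M)) T S"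
        using D z P by (auto simp: feasible_def)
      then show ?thesis using w False by (intro exI[of _ S]) auto
    qed
  qed (use fin ne in auto)
  then show ?thesis by simp
qed

text \<open>Of the two inner vertices one can always be used: \<open>z\<close> if the end at
  \<open>g\<^sub>2\<close> is absent from \<open>S\<close>, and otherwise the flag next to
  \<open>g\<^sub>1\<close>, whose end is then absent because the merged edge is plain.\<close>

lemma suppress_flagged_plain:
  "alpha (W - {z}) (insert {g\<^sub>1, g\<^sub>2} M) T + 1 \<le> alpha W (insert {h\<^sub>1, g\<^sub>1} (insert {h\<^sub>2, g\<^sub>2} M)) (insert {h\<^sub>1, g\<^sub>1} T)"
proof (rule alpha_reduce)
  fix S assume S: "feasible (W - {z}) (insert {g\<^sub>1, g\<^sub>2} M) T S"
  note D = feasibleD[OF S]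
  have P: "\<not> fst ` e \<subseteq> S" if "e \<in> M" "e \<notin> T" for e using D(4)[of e] that by auto
  have n: "\<not> (fst g\<^sub>1 \<in> S \<and> fst g\<^sub>2 \<in> S)" using D(4)[of "{g\<^sub>1, g\<^sub>2}"] fresh_edges by auto
  show "\<exists>S'. feasible W (insert {h\<^sub>1, g\<^sub>1} (insert {h\<^sub>2, g\<^sub>2} M)) (insert {h\<^sub>1, g\<^sub>1} T) S' \<and> weight T S + 1 \<le> weight (insert {h\<^sub>1, g\<^sub>1} T) S'"
  proof (cases "fst g\<^sub>2 \<in> S")
    case False
    have "feasible W (insert {h\<^sub>1, g\<^sub>1} (insert {h\<^sub>2, g\<^sub>2} M)) (insert {h\<^sub>1, g\<^sub>1} T) (insert z S)"
      using False D z P feasible_insert_z by (auto simp: feasible_def)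
    then show ?thesis using weight_insert_z[of S] D weight_insert[OF fin(2) fresh_edges(4)]
      by (intro exI[of _ "insert z S"]) auto
  next
    case True
    have "feasible W (insert {h\<^sub>1, g\<^sub>1} (insert {h\<^sub>2, g\<^sub>2} M)) (insert {h\<^sub>1, g\<^sub>1} T) S"
      using D z P by (auto simp: feasible_def)
    then show ?thesis using n True D z weight_insert[OF fin(2) fresh_edges(4)] by (intro exI[of _ S]) auto
  qed
qed (use fin ne in auto)

text \<open>Of the three inner vertices the two flags are used if both outer ends are absent, and
  \<open>z\<close> alone otherwise. This is one more than the flag on the merged edge
  contributes.\<close>

lemma suppress_flagged_flagged:
  "alpha (W - {z}) (insert {g\<^sub>1, g\<^sub>2} M) (insert {g\<^sub>1, g\<^sub>2} T) + 1 \<le>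
   alpha W (insert {h\<^sub>1, g\<^sub>1} (insert {h\<^sub>2, g\<^sub>2} M)) (insert {h\<^sub>1, g\<^sub>1} (insert {h\<^sub>2, g\<^sub>2} T))"
proof (rule alpha_reduce)
  let ?T = "insert {h\<^sub>1, g\<^sub>1} (insert {h\<^sub>2, g\<^sub>2} T)"
  fix S assume S: "feasible (W - {z}) (insert {g\<^sub>1, g\<^sub>2} M) (insert {g\<^sub>1, g\<^sub>2} T) S"
  note D = feasibleD[OF S]
  have w: "weight (insert {g\<^sub>1, g\<^sub>2} T) S = weight T S + (if fst g\<^sub>1 \<notin> S \<and> fst g\<^sub>2 \<notin> S then 1 else 0)"
    using weight_insert[OF fin(2) fresh_edges(6)] by simp
  have w': "weight ?T S' = weight T S' + (if fst ` {h\<^sub>2, g\<^sub>2} \<inter> S' = {} then 1 else 0) + (if fst ` {h\<^sub>1, g\<^sub>1} \<inter> S' = {} then 1 else 0)" for S'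
    using weight_insert[of "insert {h\<^sub>2, g\<^sub>2} T" "{h\<^sub>1, g\<^sub>1}" S'] weight_insert[OF fin(2) fresh_edges(5), of S'] fin(2) fresh_edges(4,7)
    by simp
  have P: "\<not> fst ` e \<subseteq> S" if "e \<in> M" "e \<notin> T" for e using D(4)[of e] that fresh_edges by auto
  show "\<exists>S'. feasible W (insert {h\<^sub>1, g\<^sub>1} (insert {h\<^sub>2, g\<^sub>2} M)) ?T S' \<and> weight (insert {g\<^sub>1, g\<^sub>2} T) S + 1 \<le> weight ?T S'"
  proof (cases "fst g\<^sub>1 \<notin> S \<and> fst g\<^sub>2 \<notin> S")
    case True
    have "feasible W (insert {h\<^sub>1, g\<^sub>1} (insert {h\<^sub>2, g\<^sub>2} M)) ?T S"
      using D z P by (auto simp: feasible_def)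
    then show ?thesis using w w'[of S] True D z by (intro exI[of _ S]) auto
  next
    case False
    have "feasible W (insert {h\<^sub>1, g\<^sub>1} (insert {h\<^sub>2, g\<^sub>2} M)) ?T (insert z S)"
      using D z P feasible_insert_z by (auto simp: feasible_def)
    then show ?thesis using w w'[of "insert z S"] False weight_insert_z[of S] D
      by (intro exI[of _ "insert z S"]) auto
  qed
qed (use fin ne in auto)

end

text \<open>Here \<open>z\<close> is simply given up, and so is the subdividing vertex of a flagged
  loop. A loop has probability O(1/m) in a step, so this loss disappears in the error terms.\<close>

lemma alpha_loop:
  assumes "finite W" "finite T" "{} \<notin> M" "fst h\<^sub>1 = z" "fst h\<^sub>2 = z" "{h\<^sub>1, h\<^sub>2} \<notin> T"
  shows "alpha (W - {z}) M T \<le> alpha W (insert {h\<^sub>1, h\<^sub>2} M) T"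
    "alpha (W - {z}) M T \<le> alpha W (insert {h\<^sub>1, h\<^sub>2} M) (insert {h\<^sub>1, h\<^sub>2} T)"
proof -
  have "alpha (W - {z}) M T + 0 \<le> alpha W (insert {h\<^sub>1, h\<^sub>2} M) T"
  proof (rule alpha_reduce)
    fix S assume "feasible (W - {z}) M T S"
    then show "\<exists>S'. feasible W (insert {h\<^sub>1, h\<^sub>2} M) T S' \<and> weight T S + 0 \<le> weight T S'"
      using assms by (intro exI[of _ S]) (auto simp: feasible_def)
  qed (use assms in auto)
  then show "alpha (W - {z}) M T \<le> alpha W (insert {h\<^sub>1, h\<^sub>2} M) T" by simp
  show "alpha (W - {z}) M T \<le> alpha W (insert {h\<^sub>1, h\<^sub>2} M) (insert {h\<^sub>1, h\<^sub>2} T)"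
    using alpha_take_flagged[of W "W - {z}" M T "{h\<^sub>1, h\<^sub>2}"] assms by auto
qed

subsection \<open>Exposing edges of a random configuration\<close>

lemma fsum_mono:
  "(\<And>M T. (M, T) \<in> flagged H s \<Longrightarrow> f M T \<le> g M T) \<Longrightarrow> fsum H s f \<le> fsum H s g"
  unfolding fsum_def by (intro sum_mono) auto

lemma fsum_cmult: "fsum H s (\<lambda>M T. c * f M T) = c * fsum H s f"
  unfolding fsum_def by (simp add: sum_distrib_left case_prod_unfold)

lemma flaggedD:
  assumes "(M, T) \<in> flagged H s" "finite H"
  shows "T \<subseteq> M" "finite T" "finite M" "{} \<notin> M" "\<Union>M = H" "card T = s" "\<And>e x. e \<in> M \<Longrightarrow> x \<in> e \<Longrightarrow> x \<in> H"
  using assms finite_matching[of H M] finite_subset[of T M] by (auto simp: flagged_def matchings_def)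

text \<open>With t = exp(-l) this is the unnormalised exponential moment of \<open>alpha\<close>
  over all configurations on \<open>H\<close> with \<open>s\<close> flags.\<close>

definition Zsum :: "real \<Rightarrow> ('v \<times> 'k) set \<Rightarrow> 'v set \<Rightarrow> nat \<Rightarrow> real" where
  "Zsum t H W s = fsum H s (\<lambda>M T. t ^ alpha W M T)"

section \<open>One-step recurrences for the exponential moment\<close>

context
  fixes t :: real and H :: "('v \<times> 'k) set" and W :: "'v set"
  assumes t: "0 < t" "t \<le> 1" and fin: "finite H" "finite W"
begin

lemma Zsum_mono:
  assumes "W' \<subseteq> W" shows "Zsum t H W s \<le> Zsum t H W' s"
  unfolding Zsum_def
  by (intro fsum_mono power_decreasing alpha_mono) (use t fin assms flaggedD(4)[OF _ fin(1)] in auto)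

lemma Zsum_take_flagged:
  assumes "W' \<subseteq> W" "fst g \<notin> W'" "fst h \<notin> W'" "h \<in> H" "g \<in> H"
  shows "fsum (H - {h, g}) s (\<lambda>M T. t ^ alpha W (insert {h, g} M) (insert {h, g} T)) \<le> t * Zsum t (H - {h, g}) W' s"
  unfolding Zsum_def fsum_cmult[symmetric]
proof (rule fsum_mono)
  fix M T assume MT: "(M, T) \<in> flagged (H - {h, g}) s"
  note D = flaggedD[OF MT finite_Diff[OF fin(1)]]
  have "{h, g} \<notin> T" using D(1,5) by blast
  then have "alpha W' M T + 1 \<le> alpha W (insert {h, g} M) (insert {h, g} T)"
    using D fin assms by (intro alpha_take_flagged) auto
  then have "t ^ alpha W (insert {h, g} M) (insert {h, g} T) \<le> t ^ (alpha W' M T + 1)"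
    using t by (intro power_decreasing) auto
  then show "t ^ alpha W (insert {h, g} M) (insert {h, g} T) \<le> t * t ^ alpha W' M T" by simp
qed

text \<open>Without stubs no half-edge is known to lie on a flagged edge, so a flagged edge is drawn
  uniformly instead of exposing a chosen half-edge; the factor 2(s + 1) counts the oriented
  choices.\<close>

lemma Zsum_start:
  "2 * real (Suc s) * Zsum t H W (Suc s) \<le>
   (\<Sum>h\<in>H. \<Sum>g\<in>H - {h}. t * Zsum t (H - {h, g}) (W - {fst h, fst g}) s)"
  unfolding Zsum_def[of t H] fsum_pick_flagged[OF fin(1), symmetric]
  by (intro sum_mono Zsum_take_flagged) auto

lemma Zsum_drop_plain:
  assumes "fst h \<notin> W"
  shows "fsum (H - {h, g}) s (\<lambda>M T. t ^ alpha W (insert {h, g} M) T) \<le> Zsum t (H - {h, g}) W s"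
  unfolding Zsum_def
proof (rule fsum_mono)
  fix M T assume MT: "(M, T) \<in> flagged (H - {h, g}) s"
  note D = flaggedD[OF MT finite_Diff[OF fin(1)]]
  show "t ^ alpha W (insert {h, g} M) T \<le> t ^ alpha W M T"
    using t D fin assms by (intro power_decreasing alpha_drop_plain) auto
qed

text \<open>In the plain case \<open>W\<close> is kept, so the vertex of \<open>g\<close> may be
  left undecided with two half-edges only. \<open>Zsum_suppress\<close> handles that state.\<close>

lemma Zsum_stub:
  assumes "h \<in> H" "fst h \<notin> W"
  shows "Zsum t H W s \<le> (\<Sum>g\<in>H - {h}. Zsum t (H - {h, g}) W s) +
     (if s = 0 then 0 else \<Sum>g\<in>H - {h}. t * Zsum t (H - {h, g}) (W - {fst g}) (s - 1))"
proof -
  have "(\<Sum>g\<in>H - {h}. fsum (H - {h, g}) s (\<lambda>M T. t ^ alpha W (insert {h, g} M) T)) \<le> (\<Sum>g\<in>H - {h}. Zsum t (H - {h, g}) W s)"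
    using assms by (intro sum_mono Zsum_drop_plain) auto
  moreover have "(\<Sum>g\<in>H - {h}. fsum (H - {h, g}) (s - 1) (\<lambda>M T. t ^ alpha W (insert {h, g} M) (insert {h, g} T))) \<le>
     (\<Sum>g\<in>H - {h}. t * Zsum t (H - {h, g}) (W - {fst g}) (s - 1))"
    using assms by (intro sum_mono Zsum_take_flagged) auto
  ultimately show ?thesis
    unfolding Zsum_def[of t H] fsum_expose[OF fin(1) assms(1), where f = "\<lambda>M T. t ^ alpha W M T"]
    by (cases s) auto
qed

text \<open>The five groups are: \<open>h1\<close> and \<open>h2\<close> joined by a plain or by a
  flagged edge, and otherwise two distinct edges with no, one or two flags.\<close>

lemma fsum_expose_two:
  assumes "h1 \<in> H" "h2 \<in> H" "h1 \<noteq> h2" and H': "H' = H - {h1, h2}"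
  shows "fsum H s f = fsum H' s (\<lambda>M T. f (insert {h1, h2} M) T) +
      (if s = 0 then 0 else fsum H' (s - 1) (\<lambda>M T. f (insert {h1, h2} M) (insert {h1, h2} T))) +
      (\<Sum>g1\<in>H'. \<Sum>g2\<in>H' - {g1}. fsum (H' - {g1, g2}) s (\<lambda>M T. f (insert {h1, g1} (insert {h2, g2} M)) T)) +
      (if s = 0 then 0 else
        (\<Sum>g1\<in>H'. \<Sum>g2\<in>H' - {g1}. fsum (H' - {g1, g2}) (s - 1) (\<lambda>M T. f (insert {h1, g1} (insert {h2, g2} M)) (insert {h2, g2} T))) +
        (\<Sum>g1\<in>H'. \<Sum>g2\<in>H' - {g1}. fsum (H' - {g1, g2}) (s - 1) (\<lambda>M T. f (insert {h1, g1} (insert {h2, g2} M)) (insert {h1, g1} T)))) +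
      (if s < 2 then 0 else
        \<Sum>g1\<in>H'. \<Sum>g2\<in>H' - {g1}. fsum (H' - {g1, g2}) (s - 2) (\<lambda>M T. f (insert {h1, g1} (insert {h2, g2} M)) (insert {h1, g1} (insert {h2, g2} T))))"
proof -
  have H1: "H - {h1} = insert h2 H'" "h2 \<notin> H'" "finite H'" using assms fin by auto
  have set: "H - {h1, g1} - {h2} = H' - {g1}" "H - {h1, g1} - {h2, g2} = H' - {g1, g2}" for g1 g2 using H' by auto
  have ex: "fsum (H - {h1, g1}) r F = (\<Sum>g2\<in>H' - {g1}. fsum (H' - {g1, g2}) r (\<lambda>M T. F (insert {h2, g2} M) T)) +
    (if r = 0 then 0 else \<Sum>g2\<in>H' - {g1}. fsum (H' - {g1, g2}) (r - 1) (\<lambda>M T. F (insert {h2, g2} M) (insert {h2, g2} T)))"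
    if "g1 \<in> H'" for g1 r F
  proof -
    have "finite (H - {h1, g1})" "h2 \<in> H - {h1, g1}" using that assms fin by auto
    from fsum_expose[OF this, where s = r and f = F] show ?thesis unfolding set .
  qed
  have A: "(\<Sum>g\<in>H - {h1}. fsum (H - {h1, g}) r (F g)) = fsum H' r (F h2) + (\<Sum>g1\<in>H'. fsum (H - {h1, g1}) r (F g1))" for r F
    unfolding H1(1) using H1(2,3) H' by simp
  have B: "(\<Sum>g1\<in>H'. fsum (H - {h1, g1}) r (F g1)) =
     (\<Sum>g1\<in>H'. \<Sum>g2\<in>H' - {g1}. fsum (H' - {g1, g2}) r (\<lambda>M T. F g1 (insert {h2, g2} M) T)) +
     (if r = 0 then 0 else \<Sum>g1\<in>H'. \<Sum>g2\<in>H' - {g1}. fsum (H' - {g1, g2}) (r - 1) (\<lambda>M T. F g1 (insert {h2, g2} M) (insert {h2, g2} T)))" for r F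
  proof (cases "r = 0")
    case True
    then show ?thesis using ex[where r = 0] by simp
  next
    case False
    then show ?thesis using ex[where r = r] by (simp add: sum.distrib)
  qed
  consider "s = 0" | "s = 1" | k where "s = Suc (Suc k)" by (metis One_nat_def not0_implies_Suc)
  then show ?thesis
    by cases (simp_all add: fsum_expose[OF fin(1) assms(1), where f = f] A B)
qed

text \<open>Each double sum over \<open>g1\<close> and \<open>g2\<close> is a pick identity on
  \<open>H'\<close> with the merged edge as the picked one. The merged edge is flagged if the two
  old edges carry zero or two flags and plain if they carry one, which leaves s + 1, s - 1 and s - 1
  flags respectively.\<close>

lemma Zsum_suppress:
  assumes z: "z \<in> W" "{x\<in>H. fst x = z} = {h1, h2}" "h1 \<noteq> h2"
    and H': "H' = H - {h1, h2}" "card H' = 2 * m" and W': "W' = W - {z}"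
  shows "Zsum t H W s \<le> Zsum t H' W' s + (if s = 0 then 0 else Zsum t H' W' (s - 1)) +
     2 * real (Suc s) * Zsum t H' W' (Suc s) +
     (if s = 0 then 0 else t * (4 * (real m - real (s - 1)) * Zsum t H' W' (s - 1))) +
     (if s < 2 then 0 else t * (2 * real (s - 1) * Zsum t H' W' (s - 1)))"
proof -
  have hz: "h1 \<in> H" "h2 \<in> H" "fst h1 = z" "fst h2 = z" using z(2) by auto
  have nz: "fst x \<noteq> z" if "x \<in> H'" for x using z(2) that H'(1) by auto
  have fH': "finite H'" using H' fin by auto
  have sup: "suppress W M T h1 h2 g1 g2 z"
    if "(M, T) \<in> flagged (H' - {g1, g2}) r" "g1 \<in> H'" "g2 \<in> H' - {g1}" for M T g1 g2 r
  proof -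
    note D = flaggedD[OF that(1) finite_Diff[OF fH']]
    show ?thesis
    proof (rule suppress.intro)
      fix e assume e: "e \<in> M"
      have x: "x \<in> H' \<and> x \<noteq> g1 \<and> x \<noteq> g2" if "x \<in> e" for x using D(7)[OF e that] by simp
      then have "z \<notin> fst ` e" using nz by blast
      then show "h1 \<notin> e \<and> h2 \<notin> e \<and> g1 \<notin> e \<and> g2 \<notin> e \<and> z \<notin> fst ` e"
        using x H'(1) by blast
    qed (use D(1,2,4) fin z(1,3) hz nz that(2,3) in auto)
  qed
  \<comment> \<open>Suppression is symmetric in the two edges; the mirrored instance serves the case
    in which only the edge at \<open>h2\<close> is flagged.\<close>
  have sup': "suppress W M T h2 h1 g2 g1 z"
    if "(M, T) \<in> flagged (H' - {g1, g2}) r" "g1 \<in> H'" "g2 \<in> H' - {g1}" for M T g1 g2 r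
  proof -
    note D = flaggedD[OF that(1) finite_Diff[OF fH']]
    show ?thesis
    proof (rule suppress.intro)
      fix e assume e: "e \<in> M"
      have x: "x \<in> H' \<and> x \<noteq> g1 \<and> x \<noteq> g2" if "x \<in> e" for x using D(7)[OF e that] by simp
      then have "z \<notin> fst ` e" using nz by blast
      then show "h2 \<notin> e \<and> h1 \<notin> e \<and> g2 \<notin> e \<and> g1 \<notin> e \<and> z \<notin> fst ` e"
        using x H'(1) by blast
    qed (use D(1,2,4) fin z(1,3) hz nz that(2,3) in auto)
  qed
  let ?f = "\<lambda>M T. t ^ alpha W M T" and ?f' = "\<lambda>M T. t ^ alpha W' M T"
  have dec: "t ^ b \<le> t * t ^ a" if "a + 1 \<le> b" for a b
    using power_decreasing[OF that, of t] t by simp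
  have dec0: "t ^ b \<le> t ^ a" if "a \<le> b" for a b
    using power_decreasing[OF that, of t] t by simp
  have cm: "fsum K r F \<le> t * fsum K r G" if "\<And>M T. (M, T) \<in> flagged K r \<Longrightarrow> F M T \<le> t * G M T" for K r F G
    unfolding fsum_cmult[symmetric] by (intro fsum_mono that)
  have loop: "{h1, h2} \<notin> T" if "(M, T) \<in> flagged H' r" for M T r
    using flaggedD(1,5)[OF that fH'] H' by blast
  have l0: "fsum H' s (\<lambda>M T. ?f (insert {h1, h2} M) T) \<le> Zsum t H' W' s"
    unfolding Zsum_def W'
    by (intro fsum_mono dec0 alpha_loop(1)) (use flaggedD[OF _ fH'] fin hz loop in auto)
  have l1: "fsum H' (s - 1) (\<lambda>M T. ?f (insert {h1, h2} M) (insert {h1, h2} T)) \<le> Zsum t H' W' (s - 1)"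
    unfolding Zsum_def W'
    by (intro fsum_mono dec0 alpha_loop(2)) (use flaggedD[OF _ fH'] fin hz loop in auto)
  have a00: "(\<Sum>g1\<in>H'. \<Sum>g2\<in>H' - {g1}. fsum (H' - {g1, g2}) s (\<lambda>M T. ?f (insert {h1, g1} (insert {h2, g2} M)) T))
     \<le> 2 * real (Suc s) * Zsum t H' W' (Suc s)"
    unfolding Zsum_def fsum_pick_flagged[OF fH', symmetric] W'
    by (intro sum_mono fsum_mono dec0 suppress.suppress_plain_plain[OF sup]) auto
  have a10: "(\<Sum>g1\<in>H'. \<Sum>g2\<in>H' - {g1}. fsum (H' - {g1, g2}) (s - 1) (\<lambda>M T. ?f (insert {h1, g1} (insert {h2, g2} M)) (insert {h1, g1} T)))
     \<le> t * (2 * (real m - real (s - 1)) * Zsum t H' W' (s - 1))"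
    unfolding Zsum_def fsum_pick_plain[OF fH' H'(2), symmetric] W' sum_distrib_left
    by (intro sum_mono cm dec suppress.suppress_flagged_plain[OF sup]) auto
  have a01: "(\<Sum>g1\<in>H'. \<Sum>g2\<in>H' - {g1}. fsum (H' - {g1, g2}) (s - 1) (\<lambda>M T. ?f (insert {h1, g1} (insert {h2, g2} M)) (insert {h2, g2} T)))
     \<le> t * (2 * (real m - real (s - 1)) * Zsum t H' W' (s - 1))"
    unfolding Zsum_def fsum_pick_plain[OF fH' H'(2), symmetric] W' sum_distrib_left
  proof (intro sum_mono cm dec)
    fix g1 g2 M T assume "g1 \<in> H'" "g2 \<in> H' - {g1}" "(M, T) \<in> flagged (H' - {g1, g2}) (s - 1)"
    from suppress.suppress_flagged_plain[OF sup'[OF this(3,1,2)]]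
    show "alpha (W - {z}) (insert {g1, g2} M) T + 1 \<le> alpha W (insert {h1, g1} (insert {h2, g2} M)) (insert {h2, g2} T)"
      by (simp add: insert_commute)
  qed
  have a11: "(\<Sum>g1\<in>H'. \<Sum>g2\<in>H' - {g1}. fsum (H' - {g1, g2}) (s - 2) (\<lambda>M T. ?f (insert {h1, g1} (insert {h2, g2} M)) (insert {h1, g1} (insert {h2, g2} T))))
     \<le> t * (2 * real (s - 1) * Zsum t H' W' (s - 1))" if "\<not> s < 2"
  proof -
    have s: "s - 1 = Suc (s - 2)" using that by simp
    show ?thesis
      unfolding Zsum_def s fsum_pick_flagged[OF fH', symmetric] W' sum_distrib_left
      by (intro sum_mono cm dec suppress.suppress_flagged_flagged[OF sup]) auto
  qed
  have split4: "t * (4 * (real m - real (s - 1)) * Zsum t H' W' (s - 1)) =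
    t * (2 * (real m - real (s - 1)) * Zsum t H' W' (s - 1)) + t * (2 * (real m - real (s - 1)) * Zsum t H' W' (s - 1))"
    by (simp add: algebra_simps)
  have im: "(if P then 0 else a) \<le> (if P then 0 else b)" if "\<not> P \<Longrightarrow> a \<le> b" for P and a b :: real
    using that by simp
  have main: "Zsum t H W s = fsum H s ?f" by (simp add: Zsum_def)
  show ?thesis
    unfolding main fsum_expose_two[OF hz(1,2) z(3) H'(1)] split4
    by (rule add_mono[OF add_mono[OF add_mono[OF add_mono[OF l0 im[OF l1]] a00] im[OF add_mono[OF a01 a10]]] im[OF a11]])
qed

end

subsection \<open>Counting flagged matchings\<close>

text \<open>The double factorial (2m - 1)!!, the number of perfect matchings of 2m points.\<close>

definition matching_count :: "nat \<Rightarrow> real" where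
  "matching_count m = (\<Prod>i<m. 2 * real i + 1)"

lemma matching_count_pos: "matching_count m > 0"
  unfolding matching_count_def by (intro prod_pos) auto

lemma flagged_empty_if: "finite H \<Longrightarrow> card H = 2 * m \<Longrightarrow> m < s \<Longrightarrow> flagged H s = {}"
proof (rule ccontr)
  assume a: "finite H" "card H = 2 * m" "m < s" "flagged H s \<noteq> {}"
  then obtain M T where MT: "(M, T) \<in> flagged H s" by auto
  note D = flaggedD[OF MT a(1)]
  have "card H = 2 * card M" using MT even_card_matchings[OF a(1), of M] by (auto simp: flagged_def)
  then show False using card_mono[OF D(3,1)] D(6) a by simp
qed

lemma matchings_empty: "matchings {} = {{}}"
proof (intro equalityI subsetI)
  fix M :: "'a set set" assume M: "M \<in> matchings {}"
  then have "e = {}" "card e = 2" if "e \<in> M" for e using that by (auto simp: matchings_def)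
  then show "M \<in> {{}}" by fastforce
qed (simp add: matchings_def)

text \<open>Exposing one half-edge gives an odd factor for its partner, and Pascal's rule collects
  the plain and the flagged case.\<close>

lemma fsum_one:
  fixes H :: "('a \<times> 'b) set"
  shows "finite H \<Longrightarrow> card H = 2 * m \<Longrightarrow> fsum H s (\<lambda>M T. 1) = matching_count m * real (m choose s)"
proof (induction m arbitrary: H s)
  case 0
  then have "H = {}" by simp
  have "flagged {} s = (if s = 0 then {({}, {})} else {} :: (('a \<times> 'b) set set \<times> ('a \<times> 'b) set set) set)"
    by (auto simp: flagged_def matchings_empty)
  then show ?case using \<open>H = {}\<close> by (cases s) (auto simp: fsum_def matching_count_def)
next
  case (Suc m)
  then obtain h where h: "h \<in> H" by (metis card.empty equals0I nat.distinct(1) mult_is_0 zero_neq_numeral)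
  have c: "card (H - {h, g}) = 2 * m" "finite (H - {h, g})" if "g \<in> H - {h}" for g
    using that h Suc.prems by (auto simp: card_Diff_subset)
  have ch: "real (card (H - {h})) = 2 * real m + 1" using h Suc.prems by simp
  have S: "(\<Sum>g\<in>H - {h}. fsum (H - {h, g}) r (\<lambda>M T. 1)) = (2 * real m + 1) * (matching_count m * real (m choose r))" for r
  proof -
    have "(\<Sum>g\<in>H - {h}. fsum (H - {h, g}) r (\<lambda>M T. 1)) = (\<Sum>g\<in>H - {h}. matching_count m * real (m choose r))"
      by (rule sum.cong[OF refl Suc.IH[OF c(2,1)]])
    then show ?thesis using ch by simp
  qed
  have "fsum H s (\<lambda>M T. 1) = (2 * real m + 1) * (matching_count m * real (m choose s)) +
     (if s = 0 then 0 else (2 * real m + 1) * (matching_count m * real (m choose (s - 1))))"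
    by (simp only: fsum_expose[OF Suc.prems(1) h, of s] S)
  also have "\<dots> = matching_count (Suc m) * real (Suc m choose s)"
    by (cases s) (auto simp: matching_count_def algebra_simps)
  finally show ?case .
qed

definition flagged_count :: "nat \<Rightarrow> nat \<Rightarrow> real" where
  "flagged_count m s = matching_count m * real (m choose s)"

lemma flagged_count_nonneg: "0 \<le> flagged_count m s"
  using matching_count_pos[of m] by (simp add: flagged_count_def)

text \<open>The ratio is the probability that a given half-edge lies on a plain edge and has a
  prescribed partner: (1 - s/m) / (2m - 1).\<close>

lemma flagged_count_drop:
  assumes "0 < m" "s \<le> m"
  shows "flagged_count (m - 1) s = flagged_count m s * ((real m - real s) / (real m * (2 * real m - 1)))"
proof -
  obtain k where k: "m = Suc k" using assms by (cases m) auto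
  have "(Suc k - s) * (Suc k choose s) = Suc k * (k choose s)"
    using binomial_absorb_comp[of "Suc k" s] by (simp only: diff_Suc_1)
  then have "real (Suc k - s) * real (Suc k choose s) = real (Suc k) * real (k choose s)"
    by (metis of_nat_mult)
  then have eq: "real (k choose s) = (real m - real s) * real (Suc k choose s) / real m"
    using assms k by (simp add: of_nat_diff field_simps del: binomial_Suc_Suc)
  have "matching_count m = matching_count k * (2 * real m - 1)" using k by (simp add: matching_count_def)
  moreover have "real m \<noteq> 0" "2 * real m - 1 \<noteq> 0" using k by auto
  ultimately have "flagged_count m s * ((real m - real s) / (real m * (2 * real m - 1))) = matching_count k * ((real m - real s) * real (m choose s) / real m)"
    unfolding flagged_count_def by simp
  with eq show ?thesis using k by (simp add: flagged_count_def del: binomial_Suc_Suc)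
qed

text \<open>The corresponding probability for a flagged edge: (s/m) / (2m - 1).\<close>

lemma flagged_count_take:
  assumes "0 < m" "0 < s"
  shows "flagged_count (m - 1) (s - 1) = flagged_count m s * (real s / (real m * (2 * real m - 1)))"
proof -
  obtain k r where k: "m = Suc k" "s = Suc r" using assms by (cases m; cases s) auto
  have "Suc r * (Suc k choose Suc r) = Suc k * (k choose r)"
    using binomial_absorption[of r "Suc k"] by (simp only: diff_Suc_1)
  then have "real (Suc r) * real (Suc k choose Suc r) = real (Suc k) * real (k choose r)"
    by (metis of_nat_mult)
  then have eq: "real (k choose r) = real s * real (Suc k choose Suc r) / real m"
    using k by (simp add: field_simps del: binomial_Suc_Suc)
  have "matching_count m = matching_count k * (2 * real m - 1)" using k by (simp add: matching_count_def)
  moreover have "real m \<noteq> 0" "2 * real m - 1 \<noteq> 0" using k by auto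
  ultimately have "flagged_count m s * (real s / (real m * (2 * real m - 1))) = matching_count k * (real s * real (m choose s) / real m)"
    unfolding flagged_count_def by simp
  with eq show ?thesis using k by (simp add: flagged_count_def del: binomial_Suc_Suc)
qed

lemma flagged_count_Suc:
  assumes "0 < m"
  shows "2 * real (Suc s) * flagged_count m (Suc s) = 2 * (real m - real s) * flagged_count m s"
proof (cases "s \<le> m")
  case True
  have "Suc s * (m choose Suc s) = (m choose s) * (m - s)"
    using binomial_absorption[of s m] binomial_absorb_comp[of m s] by (metis mult.commute)
  then have "real (Suc s) * real (m choose Suc s) = real (m choose s) * (real m - real s)"
    using True by (simp only: of_nat_mult[symmetric] of_nat_diff[symmetric])
  then have "2 * matching_count m * (real (Suc s) * real (m choose Suc s)) = 2 * matching_count m * (real (m choose s) * (real m - real s))"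
    by simp
  then show ?thesis unfolding flagged_count_def by (simp only: ac_simps)
qed (simp add: flagged_count_def binomial_eq_0)

subsection \<open>The drift of the potential\<close>

text \<open>With v, f, c the coefficients of \<open>u\<close>, \<open>s\<close>, \<open>y\<close>,
  two moves are critical. A start gains 1 - 2v - f + 4c = 0.0022. A stub exposed while stubs are
  rare gains 0.1204 - 0.2114 h + 0.1 h^3 on average, where h is the fraction of plain edges; its
  minimum, near h = 0.84, is about 0.002. So v is close to the largest value for which both stay
  positive with these f and c.\<close>

definition pot :: "real \<Rightarrow> real \<Rightarrow> real \<Rightarrow> real \<Rightarrow> real" where
  "pot m u s y = (4353 / 10000) * u + (55 / 100) * s + (1057 / 10000) * y - (1 / 10) * (y\<^sup>2 / m) + (5 / 100) * min (s + y) 3"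

text \<open>Turns a lower bound on the change of the potential into a bound that is linear in it;
  averaging then sees only the drift. The error is quadratic in \<open>l\<close>, so a fixed
  positive drift beats it for small \<open>l\<close>; 16 is the square of the bound 4 on the
  change.\<close>

lemma exp_neg_le:
  fixes l x x0 :: real
  assumes "x0 \<le> x" "\<bar>x0\<bar> \<le> 4" "0 < l" "l \<le> 1 / 4"
  shows "exp (- l * x) \<le> 1 + 16 * l\<^sup>2 - l * x0"
proof -
  have b: "\<bar>l * x0\<bar> \<le> 1"
  proof -
    have "\<bar>l * x0\<bar> = l * \<bar>x0\<bar>" using assms by (simp add: abs_mult)
    also have "\<dots> \<le> (1 / 4) * 4" using assms by (intro mult_mono) auto
    finally show ?thesis by simp
  qed
  have "exp (- l * x) \<le> exp (- (l * x0))" using assms by (simp add: mult_left_mono)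
  also have "\<dots> \<le> 1 + (- (l * x0)) + (l * x0)\<^sup>2"
  proof (cases "l * x0 \<le> 0")
    case True
    then show ?thesis using exp_bound[of "- (l * x0)"] b by simp
  next
    case False
    define z where "z = l * x0"
    have z: "0 < z" "z \<le> 1" using False b by (auto simp: z_def)
    have "exp z \<ge> 1 + z" by (rule exp_ge_add_one_self)
    then have "exp (- z) \<le> 1 / (1 + z)" using z by (simp add: exp_minus field_simps)
    also have "\<dots> \<le> 1 - z + z\<^sup>2"
    proof -
      have "1 \<le> (1 - z + z\<^sup>2) * (1 + z)" using z by (simp add: algebra_simps power2_eq_square)
      then show ?thesis using z by (simp add: field_simps)
    qed
    finally show ?thesis by (simp add: z_def)
  qed
  also have "(l * x0)\<^sup>2 \<le> 16 * l\<^sup>2"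
  proof -
    have "x0\<^sup>2 \<le> 4\<^sup>2" using assms(2) by (metis abs_ge_zero power2_abs power_mono)
    then have "l\<^sup>2 * x0\<^sup>2 \<le> l\<^sup>2 * 16" by (intro mult_left_mono) auto
    then show ?thesis by (simp add: power_mult_distrib)
  qed
  finally show ?thesis by simp
qed

text \<open>The three pairs (a, b) are the moves stub to stub, flagged stub to vertex, and
  suppression, with \<open>a\<close> the change of \<open>y\<close> and \<open>b\<close> the loss of
  edges. After multiplying out, the claim is (a + b r)^2 + 20 b / m <= 20, and (a + b r)^2 is at
  most 9 in all three cases.\<close>

lemma quad_diff:
  fixes m y a b r :: real
  assumes "m \<ge> 10" "0 \<le> r" "r \<le> 2" and y: "y = r * m"
    and ab: "a = -2 \<and> b = 1 \<or> a = 1 \<and> b = 1 \<or> a = -1 \<and> b = 2"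
  shows "(y + a)\<^sup>2 / (m - b) \<le> y\<^sup>2 / m + 2 * a * r + b * r\<^sup>2 + 20 / m"
proof -
  have m: "m > 0" "m - b > 0" using assms by auto
  have i: "0 \<le> 1 / m" "1 / m \<le> 1 / 10" using assms by (auto simp: field_simps)
  have r2: "r\<^sup>2 \<le> 2 * r" "0 \<le> r\<^sup>2" using assms by (auto simp: power2_eq_square mult_right_mono)
  have key: "a\<^sup>2 + 2 * a * b * r + b\<^sup>2 * r\<^sup>2 + 20 * b * (1 / m) \<le> 20" (is "?k \<le> 20")
    using ab
  proof (elim disjE conjE)
    assume "a = -2" "b = 1"
    then have "?k = 4 - 4 * r + r\<^sup>2 + 20 * (1 / m)" by simp
    then show ?thesis using r2 i assms(2,3) by linarith
  next
    assume "a = 1" "b = 1"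
    then have "?k = 1 + 2 * r + r\<^sup>2 + 20 * (1 / m)" by simp
    then show ?thesis using r2 i assms(2,3) by linarith
  next
    assume "a = -1" "b = 2"
    then have "?k = 1 - 4 * r + 4 * r\<^sup>2 + 40 * (1 / m)" by simp
    then show ?thesis using r2 i assms(2,3) by linarith
  qed
  have "(y\<^sup>2 / m + 2 * a * r + b * r\<^sup>2 + 20 / m) * (m - b) - (y + a)\<^sup>2
     = 20 - (a\<^sup>2 + 2 * a * b * r + b\<^sup>2 * r\<^sup>2 + 20 * b * (1 / m))"
    using m(1) unfolding y by (simp add: field_simps power2_eq_square)
  then have "(y + a)\<^sup>2 \<le> (y\<^sup>2 / m + 2 * a * r + b * r\<^sup>2 + 20 / m) * (m - b)" using key by linarith
  then show ?thesis using m(2) by (simp add: pos_divide_le_eq)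
qed

text \<open>The limiting drift when a stub is exposed: \<open>h\<close> is the fraction of unflagged edges, \<open>p\<close> the
  fraction of half-edges that are stubs. The linear part of the potential alone would have negative drift
  for stubs that meet stubs; the term \<open>- 0.1 y\<^sup>2 / m\<close> repairs this.\<close>

lemma drift_pos:
  fixes h p :: real
  assumes h: "0 \<le> h" "h \<le> 1" and p: "0 \<le> p" "p \<le> 1"
  shows "h * (p * (-(2114 / 10000) + (1 / 10) * (4 * (2*p) - (2*p)\<^sup>2)) + (1 - p) * (-(91 / 1000) + (1 / 10) * h\<^sup>2 + (1 / 10) * (2 * (2*p) - 2 * (2*p)\<^sup>2))) +
    (1 - h) * (p * ((2386 / 10000) + (1 / 10) * (4 * (2*p) - (2*p)\<^sup>2)) + (1 - p) * ((1204 / 10000) - (1 / 10) * (2 * (2*p) + (2*p)\<^sup>2))) \<ge> (15 / 10000)"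
    (is "?E \<ge> _")
proof -
  \<comment> \<open>\<open>e\<close> is the drift at p = 0; the remainder is divisible by p, with
    quotient \<open>b\<close> after (1 - p) e is split off.\<close>
  define e where "e = (1204 / 10000) - (2114 / 10000) * h + (1 / 10) * h^3"
  define b where "b = h * (-(2114 / 10000) + (4 / 10) * (1 - p + p\<^sup>2)) + (1 - h) * (-(1614 / 10000) + (8 / 10) * p)"
  have E: "?E = (1 - p) * e + p * b"
    unfolding e_def b_def by (simp add: field_simps power2_eq_square power3_eq_cube)
  have e1: "e \<ge> (19 / 10000)"
  proof (cases "h \<le> (5 / 10)")
    case True
    have "h^3 \<ge> 0" using h by simp
    then show ?thesis using True unfolding e_def by linarith
  next
    case False
    \<comment> \<open>0.84 is close to the minimiser of \<open>e\<close>. The product is h^3 minus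
      its tangent there: a double root at 0.84, and the third root -1.68 makes the roots sum to
      zero.\<close>
    have "(h - (84 / 100))\<^sup>2 * (h + (168 / 100)) \<ge> 0" using h by simp
    moreover have "(h - (84 / 100))\<^sup>2 * (h + (168 / 100)) = h^3 - (21168 / 10000) * h + (1185408 / 1000000)"
      by (simp add: power2_eq_square power3_eq_cube field_simps)
    ultimately have "h^3 \<ge> (21168 / 10000) * h - (1185408 / 1000000)" by linarith
    then show ?thesis using False unfolding e_def by linarith
  qed
  have p2: "1 - p + p\<^sup>2 \<ge> (75 / 100)"
  proof -
    have "(p - (5 / 10))\<^sup>2 \<ge> 0" by simp
    then show ?thesis by (simp add: power2_eq_square algebra_simps)
  qed
  have "h * (-(2114 / 10000) + (4 / 10) * (1 - p + p\<^sup>2)) \<ge> h * (886 / 10000)" using p2 h by (intro mult_left_mono) auto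
  then have b1: "b \<ge> h * (886 / 10000) + (1 - h) * (-(1614 / 10000) + (8 / 10) * p)" unfolding b_def by simp
  \<comment> \<open>From p = 0.21 on the flagged part of \<open>b\<close> is positive, and for h >=
    0.7 the plain part outweighs it. In the remaining corner \<open>b\<close> may be negative and is
    paid for by \<open>e\<close>, which is larger there.\<close>
  consider "p \<ge> (21 / 100)" | "p < (21 / 100)" "h \<ge> (7 / 10)" | "p < (21 / 100)" "h < (7 / 10)" by linarith
  then have "(1 - p) * e + p * b \<ge> (15 / 10000)"
  proof cases
    case 1
    have "(1 - h) * (-(1614 / 10000) + (8 / 10) * p) \<ge> (1 - h) * (2 / 1000)" using 1 h by (intro mult_left_mono) auto
    then have "b \<ge> h * (886 / 10000) + (1 - h) * (2 / 1000)" using b1 by linarith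
    then have "b \<ge> (2 / 1000)" using h by (simp add: field_simps)
    then have "(1 - p) * e + p * b \<ge> (1 - p) * (19 / 10000) + p * (19 / 10000)" using e1 p by (intro add_mono mult_left_mono) auto
    then show ?thesis by (simp add: field_simps)
  next
    case 2
    have "(1 - h) * (-(1614 / 10000) + (8 / 10) * p) \<ge> (1 - h) * (-(1614 / 10000))" using p h by (intro mult_left_mono) auto
    then have "b \<ge> (2 / 1000)" using b1 2 by (simp add: field_simps)
    then have "(1 - p) * e + p * b \<ge> (1 - p) * (19 / 10000) + p * (19 / 10000)" using e1 p by (intro add_mono mult_left_mono) auto
    then show ?thesis by (simp add: field_simps)
  next
    case 3
    have "(1 - h) * (-(1614 / 10000) + (8 / 10) * p) \<ge> (1 - h) * (-(1614 / 10000))" using p h by (intro mult_left_mono) auto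
    then have b2: "b \<ge> (25 / 100) * h - (1614 / 10000)" using b1 by (simp add: field_simps)
    \<comment> \<open>Again a tangent of h^3, now at the end h = 0.7 of this case.\<close>
    have "(h - (7 / 10))\<^sup>2 * (h + (14 / 10)) \<ge> 0" using h by simp
    moreover have "(h - (7 / 10))\<^sup>2 * (h + (14 / 10)) = h^3 - (147 / 100) * h + (686 / 1000)"
      by (simp add: power2_eq_square power3_eq_cube field_simps)
    ultimately have "h^3 \<ge> (147 / 100) * h - (686 / 1000)" by linarith
    then have e2: "e \<ge> (518 / 10000) - (644 / 10000) * h" unfolding e_def by linarith
    define z where "z = p * ((7 / 10) - h)"
    define w where "w = p * b"
    define x where "x = (1 - p) * e"
    have "(1 - p) * e \<ge> (79 / 100) * ((518 / 10000) - (644 / 10000) * h)" using e2 3 e1 p by (intro mult_mono) auto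
    then have x: "x \<ge> (79 / 100) * (518 / 10000) - (79 / 100) * (644 / 10000) * h" unfolding x_def by (simp add: algebra_simps)
    have "p * b \<ge> p * ((25 / 100) * h - (1614 / 10000))" using b2 p by (intro mult_left_mono) auto
    moreover have "p * ((25 / 100) * h - (1614 / 10000)) = (136 / 10000) * p - (25 / 100) * z" by (simp add: z_def field_simps)
    ultimately have w: "w \<ge> (136 / 10000) * p - (25 / 100) * z" unfolding w_def by simp
    have "p * ((7 / 10) - h) \<le> (21 / 100) * ((7 / 10) - h)" using 3 by (intro mult_right_mono) auto
    then have z: "z \<le> (147 / 1000) - (21 / 100) * h" unfolding z_def by (simp add: field_simps)
    have "x + w \<ge> (15 / 10000)" using x w z p 3 h by linarith
    then show ?thesis unfolding x_def w_def .
  qed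
  then show ?thesis unfolding E .
qed

text \<open>A loss of at most 3 from level 6 or more stays above the cap. Below level 6 the crude
  loss 6, times the coefficient 0.05, is the constant 3/10 called \<open>k\<close> in the drift
  estimates.\<close>

lemma min3_diff:
  fixes a b :: real
  assumes "b \<ge> a - 3" "a \<ge> 1"
  shows "min b 3 - min a 3 \<ge> - (if a < 6 then 6 else 0)"
  using assms by (auto simp: min_def)

text \<open>The five weights over \<open>Dn\<close> are the probabilities of the outcomes when the
  two free half-edges of \<open>z\<close> are exposed among m - 1 edges with s flags. The vertex and
  one stub cost 0.541; two plain edges bring a flag worth 0.55, and any other pair of edges brings 1
  - 0.55, which gives -0.091 + 0.1 h^2. The disjunctions on \<open>s\<close> record integrality and
  keep (m - 1 - s)(m - 2 - s) and (s - 1) s nonnegative.\<close>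

lemma drift_suppress:
  fixes m s u y r l h k :: real
  assumes m: "m \<ge> 100000" and r: "0 \<le> r" "r \<le> 2" "y = r * m" "y \<ge> 1" and s: "0 \<le> s" "s \<le> m - 1" "s = 0 \<or> s \<ge> 1"
    "s = m - 1 \<or> s \<le> m - 2"
    and l: "0 < l" "l \<le> 1 / 4" and h: "h = (m - s) / m" and k: "k = (if s + y < 6 then 3 / 10 else 0)"
  defines "Dn \<equiv> (m - 1) * (2 * m - 3)" and "V' \<equiv> \<lambda>s'. pot (m - 2) (u - 1) s' (y - 1)" and "V \<equiv> pot m u s y"
  shows "((m - 1 - s) * exp (- l * V' s) + s * exp (- l * V' (s - 1)) +
     2 * (m - 1 - s) * (m - 2 - s) * exp (- l * V' (s + 1)) +
     4 * (m - 1 - s) * s * exp (- l * (1 + V' (s - 1))) + 2 * (s - 1) * s * exp (- l * (1 + V' (s - 1)))) / Dn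
     \<le> exp (- l * V) * (1 + 16 * l\<^sup>2 - l * (- (91 / 1000) + (1 / 10) * h\<^sup>2 + (1 / 10) * (2 * r - 2 * r\<^sup>2) - 9 / m))"
proof -
  define e where "e = 1 + 16 * l\<^sup>2"
  define X where "X = - (541 / 1000) + (1 / 10) * (2 * r - 2 * r\<^sup>2) - 2 / m"
  have mi: "0 < 1 / m" "1 / m \<le> 1 / 100000" "2 / m = 2 * (1 / m)" "20 / m = 20 * (1 / m)" using m by (auto simp: field_simps)
  have r2: "0 \<le> r\<^sup>2" "r\<^sup>2 \<le> 2 * r" using r by (auto simp: power2_eq_square mult_right_mono)
  have X': "X = - (541 / 1000) + r / 5 - r\<^sup>2 / 5 - 2 * (1 / m)" unfolding X_def by (simp add: field_simps)
  have Xb: "X \<le> 1" unfolding X' using r2 r(1,2) mi by linarith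
  have Xb': "X \<ge> - (3 / 2)" unfolding X' using r2 r(1,2) mi by linarith
  note Xb = Xb Xb'
  have k01: "0 \<le> k" "k \<le> 3 / 10" using k by auto
  have q: "(y - 1)\<^sup>2 / (m - 2) \<le> y\<^sup>2 / m - 2 * r + 2 * r\<^sup>2 + 20 / m"
    using quad_diff[of m r y "-1" 2] m r by simp
  have d: "V' s' - V \<ge> X + (55 / 100) * (s' - s) + (5 / 100) * (min (s' + (y - 1)) 3 - min (s + y) 3)" for s'
  proof -
    define q' Q b' b where "q' = (y - 1)\<^sup>2 / (m - 2)" and "Q = y\<^sup>2 / m" and "b' = min (s' + (y - 1)) 3" and "b = min (s + y) 3"
    have "V' s' - V = - (541 / 1000) + (55 / 100) * s' - (55 / 100) * s - q' / 10 + Q / 10 + (5 / 100) * b' - (5 / 100) * b"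
      unfolding V'_def V_def pot_def q'_def[symmetric] Q_def[symmetric] b_def[symmetric] b'_def[symmetric] by (simp add: field_simps)
    then show ?thesis using q unfolding X' q'_def[symmetric] Q_def[symmetric] b_def[symmetric] b'_def[symmetric] right_diff_distrib using mi by linarith
  qed
  have mk: "(5 / 100) * (min (s' + (y - 1)) 3 - min (s + y) 3) \<ge> - k" if "s' \<ge> s - 1" for s'
    using min3_diff[of "s + y" "s' + (y - 1)"] that s r(4) unfolding k by (auto split: if_splits)
  have E: "exp (- l * (g + V' s')) \<le> exp (- l * V) * (e - l * x0)"
    if "g + (V' s' - V) \<ge> x0" "\<bar>x0\<bar> \<le> 4" for g s' x0
  proof -
    have "exp (- l * (g + V' s')) = exp (- l * V) * exp (- l * (g + (V' s' - V)))"
      by (simp add: exp_add[symmetric] algebra_simps)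
    also have "\<dots> \<le> exp (- l * V) * (e - l * x0)"
      unfolding e_def using exp_neg_le[OF that l] by (intro mult_left_mono) auto
    finally show ?thesis .
  qed
  have Ek: "exp (- l * (g + V' s')) \<le> exp (- l * V) * (e - l * x0)"
    if "s' \<ge> s - 1" "x0 = g + X + 55 / 100 * (s' - s) - k" "\<bar>x0\<bar> \<le> 4" for g s' x0
    using that(2) d[of s'] mk[OF that(1)] by (intro E that(3)) linarith
  have e0: "exp (- l * V' s) \<le> exp (- l * V) * (e - l * (X - k))"
    using Ek[of s "X - k" 0] Xb k01 by (simp add: abs_le_iff)
  have e1: "exp (- l * V' (s - 1)) \<le> exp (- l * V) * (e - l * (X - 55 / 100 - k))"
    using Ek[of "s - 1" "X - 55 / 100 - k" 0] Xb k01 by (simp add: abs_le_iff)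
  \<comment> \<open>There is no \<open>k\<close> here: a flag is gained and a stub lost, so s + y is
    unchanged.\<close>
  have e00: "exp (- l * V' (s + 1)) \<le> exp (- l * V) * (e - l * (X + 55 / 100))"
    using E[of "X + 55 / 100" 0 "s + 1"] d[of "s + 1"] Xb by (simp add: abs_le_iff)
  have e10: "exp (- l * (1 + V' (s - 1))) \<le> exp (- l * V) * (e - l * (X + 45 / 100 - k))"
    using Ek[of "s - 1" "X + 45 / 100 - k" 1] Xb k01 by (simp add: abs_le_iff)
  have Dn: "Dn > 0" unfolding Dn_def using m by simp
  define w where "w = 2 * (m - 1 - s) * (m - 2 - s)"
  have w0: "w \<ge> 0" unfolding w_def using s by (auto intro: mult_nonneg_nonneg)
  have s2: "2 * (s - 1) * s \<ge> 0" using s by auto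
  have L: "(m - 1 - s) * exp (- l * V' s) + s * exp (- l * V' (s - 1)) +
     2 * (m - 1 - s) * (m - 2 - s) * exp (- l * V' (s + 1)) +
     4 * (m - 1 - s) * s * exp (- l * (1 + V' (s - 1))) + 2 * (s - 1) * s * exp (- l * (1 + V' (s - 1)))
     \<le> (m - 1 - s) * (exp (- l * V) * (e - l * (X - k))) + s * (exp (- l * V) * (e - l * (X - 55 / 100 - k))) +
     w * (exp (- l * V) * (e - l * (X + 55 / 100))) +
     4 * (m - 1 - s) * s * (exp (- l * V) * (e - l * (X + 45 / 100 - k))) + 2 * (s - 1) * s * (exp (- l * V) * (e - l * (X + 45 / 100 - k)))"
    unfolding w_def[symmetric]
    by (intro add_mono mult_left_mono e0 e1 e00 e10 w0 s2) (use s in auto)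
  also have "\<dots> = exp (- l * V) * (e * Dn - l * (Dn * (X + 45 / 100 - k) + w * (1 / 10 + k) - (m - 1 - s) * (45 / 100) - s))"
    unfolding w_def Dn_def by (simp add: field_simps)
  finally have L2': "(m - 1 - s) * exp (- l * V' s) + s * exp (- l * V' (s - 1)) +
     2 * (m - 1 - s) * (m - 2 - s) * exp (- l * V' (s + 1)) +
     4 * (m - 1 - s) * s * exp (- l * (1 + V' (s - 1))) + 2 * (s - 1) * s * exp (- l * (1 + V' (s - 1)))
     \<le> exp (- l * V) * (e * Dn - l * (Dn * (X + 45 / 100 - k) + w * (1 / 10 + k) - (m - 1 - s) * (45 / 100) - s))" .
  have L2: "((m - 1 - s) * exp (- l * V' s) + s * exp (- l * V' (s - 1)) +
     2 * (m - 1 - s) * (m - 2 - s) * exp (- l * V' (s + 1)) +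
     4 * (m - 1 - s) * s * exp (- l * (1 + V' (s - 1))) + 2 * (s - 1) * s * exp (- l * (1 + V' (s - 1)))) / Dn
     \<le> exp (- l * V) * (e - l * (X + 45 / 100 - k + (w * (1 / 10 + k) - (m - 1 - s) * (45 / 100) - s) / Dn))"
  proof -
    define a where "a = w * (1 / 10 + k) - (m - 1 - s) * (45 / 100) - s"
    have "exp (- l * V) * (e - l * (X + 45 / 100 - k + a / Dn)) * Dn = exp (- l * V) * (e * Dn - l * (Dn * (X + 45 / 100 - k) + a))"
      using Dn by (simp add: field_simps)
    moreover have "Dn * (X + 45 / 100 - k) + a = Dn * (X + 45 / 100 - k) + w * (1 / 10 + k) - (m - 1 - s) * (45 / 100) - s"
      by (simp add: a_def)
    ultimately have eq: "exp (- l * V) * (e - l * (X + 45 / 100 - k + (w * (1 / 10 + k) - (m - 1 - s) * (45 / 100) - s) / Dn)) * Dn =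
      exp (- l * V) * (e * Dn - l * (Dn * (X + 45 / 100 - k) + w * (1 / 10 + k) - (m - 1 - s) * (45 / 100) - s))"
      unfolding a_def by (simp only:)
    show ?thesis unfolding pos_divide_le_eq[OF Dn] eq by (rule L2')
  qed
  \<comment> \<open>w / Dn is the probability that both edges at \<open>z\<close> are plain;
    sampling without replacement costs O(1/m) against h^2.\<close>
  have hw: "w / Dn \<ge> h\<^sup>2 - 3 / m"
  proof -
    have "h\<^sup>2 - 3 / m = ((m - s)\<^sup>2 - 3 * m) / m\<^sup>2" using m unfolding h by (simp add: field_simps power2_eq_square)
    also have "\<dots> \<le> (m - 1 - s) * (m - 2 - s) / m\<^sup>2"
    proof (rule divide_right_mono)
      have eq: "(m - 1 - s) * (m - 2 - s) = (m - s)\<^sup>2 - 3 * (m - s) + 2" by (simp add: power2_eq_square algebra_simps)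
      show "(m - s)\<^sup>2 - 3 * m \<le> (m - 1 - s) * (m - 2 - s)" unfolding eq using s by simp
    qed simp
    also have "\<dots> = w / (2 * m\<^sup>2)"
    proof -
      have w2: "w = 2 * ((m - 1 - s) * (m - 2 - s))" by (simp add: w_def)
      show ?thesis unfolding w2 by (rule mult_divide_mult_cancel_left[symmetric]) simp
    qed
    also have "\<dots> \<le> w / Dn"
    proof (rule divide_left_mono)
      show "Dn \<le> 2 * m\<^sup>2" unfolding Dn_def using m by (simp add: power2_eq_square algebra_simps)
      show "0 < 2 * m\<^sup>2 * Dn" using Dn m by simp
    qed (use w0 in auto)
    finally show ?thesis .
  qed
  have h1: "0 \<le> h" "h \<le> 1" using s m unfolding h by (auto simp: field_simps)
  \<comment> \<open>If s + y < 6, almost all edges are plain, and the truncated term drops only in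
    outcomes of total probability O(1/m).\<close>
  have wk: "k * (1 - w / Dn) \<le> 5 / m"
  proof (cases "s + y < 6")
    case True
    have "h \<ge> 1 - 6 / m" using True s r m unfolding h by (simp add: field_simps)
    moreover have "0 \<le> 1 - 6 / m" using m by (simp add: field_simps)
    ultimately have "(1 - 6 / m) * (1 - 6 / m) \<le> h\<^sup>2" unfolding power2_eq_square using h1(1) by (intro mult_mono)
    moreover have "(1 - 6 / m) * (1 - 6 / m) \<ge> 1 - 12 / m" by (simp add: algebra_simps)
    ultimately have "1 - w / Dn \<le> 15 / m" using hw by (simp add: field_simps)
    then have "k * (1 - w / Dn) \<le> k * (15 / m)" using k01 by (intro mult_left_mono) auto
    also have "\<dots> \<le> (3 / 10) * (15 / m)" using k01 m by (intro mult_right_mono) auto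
    also have "\<dots> \<le> 5 / m" using m by (simp add: field_simps)
    finally show ?thesis .
  next
    case False
    then show ?thesis using k mi m by simp
  qed
  \<comment> \<open>Loops have probability 1/(2m - 3) and fall short of the usual gain 0.45 by 0.45
    or 1.\<close>
  have lp: "((m - 1 - s) * (45 / 100) + s) / Dn \<le> 1 / m"
  proof -
    have "(m - 1 - s) * (45 / 100) \<le> (m - 1 - s) * 1" using s by (intro mult_left_mono) auto
    then have "(m - 1 - s) * (45 / 100) + s \<le> m - 1" by (simp add: field_simps)
    moreover have "m * (m - 1) \<le> Dn" unfolding Dn_def using m by (simp add: mult.commute mult_left_mono)
    ultimately have "((m - 1 - s) * (45 / 100) + s) * m \<le> (m - 1) * m" "(m - 1) * m \<le> Dn"
      using m by (auto intro!: mult_right_mono simp: mult.commute)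
    then have "((m - 1 - s) * (45 / 100) + s) * m \<le> Dn" by (rule order_trans)
    then have "(m - 1 - s) * (45 / 100) + s \<le> Dn / m" using m by (simp only: pos_le_divide_eq)
    then have "((m - 1 - s) * (45 / 100) + s) / Dn \<le> (Dn / m) / Dn" using Dn by (intro divide_right_mono) auto
    then show ?thesis using Dn by simp
  qed
  define a c n where "a = w / Dn" and "c = ((m - 1 - s) * (45 / 100) + s) / Dn" and "n = 1 / m"
  have Z: "(w * (1 / 10 + k) - (m - 1 - s) * (45 / 100) - s) / Dn = (1 / 10) * a + k * a - c"
    using Dn by (simp add: a_def c_def field_simps)
  have n: "3 / m = 3 * n" "5 / m = 5 * n" "9 / m = 9 * n" "1 / m = n" by (simp_all add: n_def)
  have ka: "k * (1 - a) = k - k * a" by (simp add: algebra_simps)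
  have r': "(1 / 10) * (2 * r - 2 * r\<^sup>2) = r / 5 - r\<^sup>2 / 5" by (simp add: field_simps)
  have "X + 45 / 100 - k + (w * (1 / 10 + k) - (m - 1 - s) * (45 / 100) - s) / Dn \<ge>
     - (91 / 1000) + (1 / 10) * h\<^sup>2 + (1 / 10) * (2 * r - 2 * r\<^sup>2) - 9 / m"
    using hw wk lp mi(1) unfolding X' Z r' a_def[symmetric] c_def[symmetric] ka n by linarith
  then have "exp (- l * V) * (e - l * (X + 45 / 100 - k + (w * (1 / 10 + k) - (m - 1 - s) * (45 / 100) - s) / Dn)) \<le>
     exp (- l * V) * (e - l * (- (91 / 1000) + (1 / 10) * h\<^sup>2 + (1 / 10) * (2 * r - 2 * r\<^sup>2) - 9 / m))"
    using l by (intro mult_left_mono diff_left_mono) auto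
  with L2 show ?thesis unfolding e_def by linarith
qed

text \<open>\<open>G\<close> stands for the mean after a plain edge from the stub to a vertex. It is
  bounded only for s < m, since at s = m no edge is plain and its coefficient vanishes.\<close>

lemma drift_stub:
  fixes m s u y l :: real
  assumes m: "m \<ge> 100000" and y: "y \<ge> 1" "u \<ge> 0" "2 * m = 3 * u + y" and s: "0 \<le> s" "s \<le> m"
    and l: "0 < l" "l \<le> 1 / 20000"
    and G: "s < m \<Longrightarrow> G \<le> exp (- l * pot m u s y) *
      (1 + 16 * l\<^sup>2 - l * (- (91 / 1000) + (1 / 10) * ((m - s) / m)\<^sup>2 + (1 / 10) * (2 * (y / m) - 2 * (y / m)\<^sup>2) - 9 / m))"
  shows "(1 - s / m) * ((y - 1) / (2 * m - 1) * exp (- l * pot (m - 1) u s (y - 2)) + 3 * u / (2 * m - 1) * G) +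
    s / m * ((y - 1) / (2 * m - 1) * exp (- l * (1 + pot (m - 1) u (s - 1) (y - 2))) +
      3 * u / (2 * m - 1) * exp (- l * (1 + pot (m - 1) (u - 1) (s - 1) (y + 1)))) \<le> exp (- l * pot m u s y)"
proof -
  define r where "r = y / m"
  define k :: real where "k = (if s + y < 6 then 3 / 10 else 0)"
  define h where "h = (m - s) / m"
  define e where "e = 1 + 16 * l\<^sup>2"
  define V where "V = pot m u s y"
  define P where "P = (y - 1) / (2 * m - 1)"
  have l4: "l \<le> 1 / 4" using l by simp
  have r: "0 \<le> r" "r \<le> 2" "y = r * m" using y m unfolding r_def by (auto simp: field_simps)
  have mi: "0 < 1 / m" "1 / m \<le> 1 / 100000" "2 / m = 2 * (1 / m)" "20 / m = 20 * (1 / m)" using m by (auto simp: field_simps)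
  have r2: "0 \<le> r\<^sup>2" "r\<^sup>2 \<le> 2 * r" using r by (auto simp: power2_eq_square mult_right_mono)
  have k01: "0 \<le> k" "k \<le> 3 / 10" by (auto simp: k_def)
  have h1: "0 \<le> h" "h \<le> 1" "s / m = 1 - h" "1 - s / m = h" using s m unfolding h_def by (auto simp: field_simps)
  have P: "0 \<le> P" "P \<le> 1" "3 * u / (2 * m - 1) = 1 - P" using y m unfolding P_def by (auto simp: field_simps)
  have q1: "(y - 2)\<^sup>2 / (m - 1) \<le> y\<^sup>2 / m - 4 * r + r\<^sup>2 + 20 / m"
    using quad_diff[of m r y "-2" 1] m r by simp
  have q2: "(y + 1)\<^sup>2 / (m - 1) \<le> y\<^sup>2 / m + 2 * r + r\<^sup>2 + 20 / m"
    using quad_diff[of m r y "1" 1] m r by simp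
  have mk: "(5 / 100) * (min (s' + y') 3 - min (s + y) 3) \<ge> - k" if "s' + y' \<ge> s + y - 3" for s' y'
    using min3_diff[of "s + y" "s' + y'"] that s y unfolding k_def by (auto split: if_splits)
  have E: "exp (- l * v) \<le> exp (- l * V) * (e - l * x0)"
    if "v - V \<ge> x0" "\<bar>x0\<bar> \<le> 4" for v x0
  proof -
    have "exp (- l * v) = exp (- l * V) * exp (- l * (v - V))"
      by (simp add: exp_add[symmetric] algebra_simps)
    also have "\<dots> \<le> exp (- l * V) * (e - l * x0)"
      unfolding e_def using exp_neg_le[OF that l(1) l4] by (intro mult_left_mono) auto
    finally show ?thesis .
  qed
  define x1 where "x1 = 2386 / 10000 + (1 / 10) * (4 * r - r\<^sup>2)"
  define x2 where "x2 = 1204 / 10000 - (1 / 10) * (2 * r + r\<^sup>2)"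
  define x3 where "x3 = - (2114 / 10000) + (1 / 10) * (4 * r - r\<^sup>2)"
  define x4 where "x4 = - (91 / 1000) + (1 / 10) * h\<^sup>2 + (1 / 10) * (2 * r - 2 * r\<^sup>2)"
  have xb: "\<bar>x1\<bar> \<le> 1" "\<bar>x2\<bar> \<le> 1" "\<bar>x3\<bar> \<le> 1" "\<bar>x4\<bar> \<le> 1"
  proof -
    have "h\<^sup>2 \<le> 1" "0 \<le> h\<^sup>2" using h1(1,2) power_le_one[of h 2] by auto
    moreover have "r\<^sup>2 \<ge> 4 * r - 4"
      using zero_le_power2[of "r - 2"] by (simp add: power2_eq_square algebra_simps)
    moreover have "x1 = 2386 / 10000 + 4 / 10 * r - r\<^sup>2 / 10" "x2 = 1204 / 10000 - 2 / 10 * r - r\<^sup>2 / 10"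
      "x3 = - (2114 / 10000) + 4 / 10 * r - r\<^sup>2 / 10" "x4 = - (91 / 1000) + h\<^sup>2 / 10 + 2 / 10 * r - 2 / 10 * r\<^sup>2"
      unfolding x1_def x2_def x3_def x4_def by (simp_all add: field_simps)
    ultimately show "\<bar>x1\<bar> \<le> 1" "\<bar>x2\<bar> \<le> 1" "\<bar>x3\<bar> \<le> 1" "\<bar>x4\<bar> \<le> 1"
      using r2 r(1,2) unfolding abs_le_iff by linarith+
  qed
  have d1: "1 + pot (m - 1) u (s - 1) (y - 2) - V \<ge> x1 - 2 / m - k"
  proof -
    define q' Q b' b where "q' = (y - 2)\<^sup>2 / (m - 1)" and "Q = y\<^sup>2 / m" and "b' = min (s - 1 + (y - 2)) 3" and "b = min (s + y) 3"
    have mk': "b' / 20 - b / 20 \<ge> - k" using mk[of "s - 1" "y - 2"] by (simp add: b_def b'_def field_simps)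
    have "1 + pot (m - 1) u (s - 1) (y - 2) - V = 2386 / 10000 - q' / 10 + Q / 10 + b' / 20 - b / 20"
      unfolding V_def pot_def q'_def[symmetric] Q_def[symmetric] b_def[symmetric] b'_def[symmetric] by (simp add: field_simps)
    then show ?thesis using q1 mk' unfolding q'_def[symmetric] Q_def[symmetric] x1_def right_diff_distrib distrib_left using mi by linarith
  qed
  have d2: "1 + pot (m - 1) (u - 1) (s - 1) (y + 1) - V \<ge> x2 - 2 / m - k"
  proof -
    define q' Q b' b where "q' = (y + 1)\<^sup>2 / (m - 1)" and "Q = y\<^sup>2 / m" and "b' = min (s - 1 + (y + 1)) 3" and "b = min (s + y) 3"
    have mk': "b' / 20 - b / 20 \<ge> - k" using mk[of "s - 1" "y + 1"] by (simp add: b_def b'_def field_simps)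
    have "1 + pot (m - 1) (u - 1) (s - 1) (y + 1) - V = 1204 / 10000 - q' / 10 + Q / 10 + b' / 20 - b / 20"
      unfolding V_def pot_def q'_def[symmetric] Q_def[symmetric] b_def[symmetric] b'_def[symmetric] by (simp add: field_simps)
    then show ?thesis using q2 mk' unfolding q'_def[symmetric] Q_def[symmetric] x2_def right_diff_distrib distrib_left using mi by linarith
  qed
  have d3: "pot (m - 1) u s (y - 2) - V \<ge> x3 - 2 / m - k"
  proof -
    define q' Q b' b where "q' = (y - 2)\<^sup>2 / (m - 1)" and "Q = y\<^sup>2 / m" and "b' = min (s + (y - 2)) 3" and "b = min (s + y) 3"
    have mk': "b' / 20 - b / 20 \<ge> - k" using mk[of "s" "y - 2"] by (simp add: b_def b'_def field_simps)
    have "pot (m - 1) u s (y - 2) - V = - (2114 / 10000) - q' / 10 + Q / 10 + b' / 20 - b / 20"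
      unfolding V_def pot_def q'_def[symmetric] Q_def[symmetric] b_def[symmetric] b'_def[symmetric] by (simp add: field_simps)
    then show ?thesis using q1 mk' unfolding q'_def[symmetric] Q_def[symmetric] x3_def right_diff_distrib distrib_left using mi by linarith
  qed
  have e1: "exp (- l * (1 + pot (m - 1) u (s - 1) (y - 2))) \<le> exp (- l * V) * (e - l * (x1 - 2 / m - k))"
    by (rule E[OF d1]) (use xb(1) k01 mi in linarith)
  have e2: "exp (- l * (1 + pot (m - 1) (u - 1) (s - 1) (y + 1))) \<le> exp (- l * V) * (e - l * (x2 - 2 / m - k))"
    by (rule E[OF d2]) (use xb(2) k01 mi in linarith)
  have e3: "exp (- l * pot (m - 1) u s (y - 2)) \<le> exp (- l * V) * (e - l * (x3 - 2 / m - k))"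
    by (rule E[OF d3]) (use xb(3) k01 mi in linarith)
  have e4: "h * ((1 - P) * G) \<le> h * ((1 - P) * (exp (- l * V) * (e - l * (x4 - 9 / m))))"
  proof (cases "s < m")
    case True
    then show ?thesis using G P h1 unfolding e_def V_def x4_def h_def r_def
      by (intro mult_left_mono) auto
  next
    case False
    then have "h = 0" using s unfolding h_def by simp
    then show ?thesis by simp
  qed
  have "h * (P * exp (- l * pot (m - 1) u s (y - 2)) + (1 - P) * G) +
    (1 - h) * (P * exp (- l * (1 + pot (m - 1) u (s - 1) (y - 2))) +
      (1 - P) * exp (- l * (1 + pot (m - 1) (u - 1) (s - 1) (y + 1)))) \<le>
    h * (P * (exp (- l * V) * (e - l * (x3 - 2 / m - k)))) + h * ((1 - P) * (exp (- l * V) * (e - l * (x4 - 9 / m)))) +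
    (1 - h) * (P * (exp (- l * V) * (e - l * (x1 - 2 / m - k))) + (1 - P) * (exp (- l * V) * (e - l * (x2 - 2 / m - k))))"
    unfolding distrib_left[of h]
    by (intro add_mono mult_left_mono e1 e2 e3 e4) (use P h1 in auto)
  also have "\<dots> = exp (- l * V) * (e - l * (h * (P * x3 + (1 - P) * x4) + (1 - h) * (P * x1 + (1 - P) * x2)
     - (2 / m) - h * (1 - P) * (7 / m) - k * (h * P + (1 - h))))"
  proof -
    define q2 q7 where "q2 = 2 / m" and "q7 = 7 / m"
    have "9 / m = q2 + q7" by (simp add: q2_def q7_def add_divide_distrib[symmetric])
    then show ?thesis unfolding q2_def[symmetric] q7_def[symmetric] by (simp add: algebra_simps)
  qed
  also have "\<dots> \<le> exp (- l * V) * 1"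
  proof (rule mult_left_mono)
    define p where "p = r / 2"
    have p: "0 \<le> p" "p \<le> 1" "r = 2 * p" using r by (auto simp: p_def)
    \<comment> \<open>The exposed stub cannot be its own partner, so \<open>P\<close> differs
      slightly from the proportion p of stubs to which \<open>drift_pos\<close> applies.\<close>
    have Pp: "\<bar>P - p\<bar> \<le> 1 / m"
    proof -
      have "p - P = (2 * m - y) / (2 * m * (2 * m - 1))" using m unfolding p_def r_def P_def by (simp add: field_simps)
      moreover have "0 \<le> \<dots>" using y m by simp
      moreover have "(2 * m - y) / (2 * m * (2 * m - 1)) \<le> 2 * m / (2 * m * (2 * m - 1))" using y m by (intro divide_right_mono) auto
      moreover have "2 * m / (2 * m * (2 * m - 1)) \<le> 1 / m" using m by (simp add: field_simps)
      ultimately show ?thesis by linarith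
    qed
    have dp: "h * (p * x3 + (1 - p) * x4) + (1 - h) * (p * x1 + (1 - p) * x2) \<ge> 15 / 10000"
      unfolding x1_def x2_def x3_def x4_def using drift_pos[OF h1(1,2) p(1,2)] p(3) by simp
    define z where "z = h * (x3 - x4) + (1 - h) * (x1 - x2)"
    have "\<bar>z\<bar> \<le> h * 2 + (1 - h) * 2"
    proof -
      have "\<bar>z\<bar> \<le> h * \<bar>x3 - x4\<bar> + (1 - h) * \<bar>x1 - x2\<bar>"
        unfolding z_def using abs_triangle_ineq[of "h * (x3 - x4)" "(1 - h) * (x1 - x2)"] h1 by (simp add: abs_mult)
      also have "\<dots> \<le> h * 2 + (1 - h) * 2" using h1 xb by (intro add_mono mult_left_mono) auto
      finally show ?thesis .
    qed
    then have z: "\<bar>z\<bar> \<le> 2" by simp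
    have "\<bar>(P - p) * z\<bar> \<le> (1 / m) * 2" unfolding abs_mult using Pp z mi(1) by (intro mult_mono) auto
    then have z2: "(P - p) * z \<ge> - (2 * (1 / m))" by linarith
    have id: "h * (P * x3 + (1 - P) * x4) + (1 - h) * (P * x1 + (1 - P) * x2) =
      h * (p * x3 + (1 - p) * x4) + (1 - h) * (p * x1 + (1 - p) * x2) + (P - p) * z"
      unfolding z_def by (simp add: algebra_simps)
    have hp: "h * (1 - P) * (7 / m) \<le> 7 * (1 / m)"
    proof -
      have "h * (1 - P) \<le> 1 * 1" using h1 P by (intro mult_mono) auto
      then show ?thesis using mult_right_mono[of "h * (1 - P)" 1 "7 / m"] m by simp
    qed
    \<comment> \<open>For s + y < 6 both a stub as partner and a flag on the edge have probability
      O(1/m); the remaining outcome already has its loss inside 9/m.\<close>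
    have kb: "k * (h * P + (1 - h)) \<le> 4 * (1 / m)"
    proof (cases "s + y < 6")
      case True
      have "P \<le> 5 / (2 * m - 1)" unfolding P_def using True s m by (intro divide_right_mono) auto
      also have "\<dots> \<le> 6 / m" using m by (simp add: field_simps)
      finally have "P \<le> 6 / m" .
      moreover have "h * P \<le> 1 * P" using h1 P by (intro mult_right_mono) auto
      moreover have "1 - h \<le> 6 / m" using True s y m h1(3) by (simp add: field_simps)
      ultimately have "k * (h * P + (1 - h)) \<le> (3 / 10) * (12 / m)"
        using k01 h1 P by (intro mult_mono) auto
      also have "\<dots> \<le> 4 * (1 / m)" using m by (simp add: field_simps)
      finally show ?thesis .
    next
      case False
      then show ?thesis using mi by (simp add: k_def)
    qed
    have "h * (P * x3 + (1 - P) * x4) + (1 - h) * (P * x1 + (1 - P) * x2)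
     - (2 / m) - h * (1 - P) * (7 / m) - k * (h * P + (1 - h)) \<ge> 1 / 1000"
      unfolding id using dp z2 hp kb mi by linarith
    then have "l * (h * (P * x3 + (1 - P) * x4) + (1 - h) * (P * x1 + (1 - P) * x2)
     - (2 / m) - h * (1 - P) * (7 / m) - k * (h * P + (1 - h))) \<ge> l * (1 / 1000)"
      using l by (intro mult_left_mono) auto
    \<comment> \<open>Here l <= 1/20000 is used: the quadratic error 16 l^2 must stay below l times
      the remaining drift 1/1000.\<close>
    moreover have "16 * l\<^sup>2 \<le> l * (1 / 1000)"
    proof -
      have "l * (16 * l) \<le> l * (1 / 1000)" using l by (intro mult_left_mono) auto
      then show ?thesis by (simp add: power2_eq_square)
    qed
    ultimately show "e - l * (h * (P * x3 + (1 - P) * x4) + (1 - h) * (P * x1 + (1 - P) * x2)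
     - (2 / m) - h * (1 - P) * (7 / m) - k * (h * P + (1 - h))) \<le> 1" unfolding e_def by linarith
  qed simp
  finally show ?thesis unfolding h1(3,4) P_def[symmetric] P(3) V_def by simp
qed

text \<open>Deleting both ends of the flagged edge creates four stubs, or one stub if the edge is a
  loop, which has probability 2/(2m - 1).\<close>

lemma drift_start:
  fixes m s u l :: real
  assumes m: "m \<ge> 100000" and "2 * m = 3 * u" and s: "1 \<le> s"
    and l: "0 < l" "l \<le> 1 / 20000"
  shows "2 / (2 * m - 1) * exp (- l * (1 + pot (m - 1) (u - 1) (s - 1) 1)) +
    (1 - 2 / (2 * m - 1)) * exp (- l * (1 + pot (m - 1) (u - 2) (s - 1) 4)) \<le> exp (- l * pot m u s 0)"
proof -
  define e where "e = 1 + 16 * l\<^sup>2"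
  define V where "V = pot m u s 0"
  define P where "P = 2 / (2 * m - 1)"
  have l4: "l \<le> 1 / 4" using l by simp
  have mi: "0 < 1 / m" "1 / m \<le> 1 / 100000" using m by (auto simp: field_simps)
  have P: "0 \<le> P" "P \<le> 2 * (1 / m)" "P \<le> 1" using m unfolding P_def by (auto simp: field_simps)
  have i: "1 / (m - 1) \<le> 2 * (1 / m)" "1 / (m - 1) > 0" using m by (auto simp: field_simps)
  have E: "exp (- l * v) \<le> exp (- l * V) * (e - l * x0)"
    if "v - V \<ge> x0" "\<bar>x0\<bar> \<le> 4" for v x0
  proof -
    have "exp (- l * v) = exp (- l * V) * exp (- l * (v - V))"
      by (simp add: exp_add[symmetric] algebra_simps)
    also have "\<dots> \<le> exp (- l * V) * (e - l * x0)"
      unfolding e_def using exp_neg_le[OF that l(1) l4] by (intro mult_left_mono) auto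
    finally show ?thesis .
  qed
  \<comment> \<open>A crude bound is enough for the loop, because it is multiplied by
    \<open>P\<close>, which is at most 2/m.\<close>
  have d1: "1 + pot (m - 1) (u - 1) (s - 1) 1 - V \<ge> - 1"
  proof -
    have "1 + pot (m - 1) (u - 1) (s - 1) 1 - V = 1 - 4353 / 10000 - 11 / 20 + 1057 / 10000 - (1 / 10) * (1 / (m - 1))"
      unfolding pot_def V_def by (simp add: field_simps)
    then show ?thesis using i mi by linarith
  qed
  have d2: "1 + pot (m - 1) (u - 2) (s - 1) 4 - V \<ge> 22 / 10000 - 4 * (1 / m)"
  proof -
    define b b' where "b = min (s + 0) 3" and "b' = min (s - 1 + 4) 3"
    have "b' \<ge> b" by (simp add: b_def b'_def)
    moreover have "1 + pot (m - 1) (u - 2) (s - 1) 4 - V = 1 - 8706 / 10000 - 11 / 20 + 4228 / 10000 - (16 / 10) * (1 / (m - 1)) + b' / 20 - b / 20"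
      unfolding pot_def V_def b_def[symmetric] b'_def[symmetric] by (simp add: field_simps)
    ultimately show ?thesis using i mi by linarith
  qed
  have "P * exp (- l * (1 + pot (m - 1) (u - 1) (s - 1) 1)) + (1 - P) * exp (- l * (1 + pot (m - 1) (u - 2) (s - 1) 4))
    \<le> P * (exp (- l * V) * (e - l * (- 1))) + (1 - P) * (exp (- l * V) * (e - l * (22 / 10000 - 4 * (1 / m))))"
  proof (intro add_mono mult_left_mono E d1 d2)
    show "0 \<le> P" "0 \<le> 1 - P" using P(1,3) by simp_all
    show "\<bar>22 / 10000 - 4 * (1 / m)\<bar> \<le> 4" using mi by linarith
  qed simp
  also have "\<dots> = exp (- l * V) * (e - l * ((22 / 10000 - 4 * (1 / m)) - P * (1 + 22 / 10000 - 4 * (1 / m))))"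
  proof -
    define c where "c = 22 / 10000 - 4 * (1 / m)"
    have c: "1 + 22 / 10000 - 4 * (1 / m) = 1 + c" by (simp add: c_def)
    show ?thesis unfolding c unfolding c_def[symmetric] by (simp add: algebra_simps)
  qed
  also have "\<dots> \<le> exp (- l * V) * 1"
  proof (rule mult_left_mono)
    have "P * (1 + 22 / 10000 - 4 * (1 / m)) \<le> P * 2" using P mi by (intro mult_left_mono) auto
    then have "(22 / 10000 - 4 * (1 / m)) - P * (1 + 22 / 10000 - 4 * (1 / m)) \<ge> 1 / 1000" using P mi by linarith
    then have "l * ((22 / 10000 - 4 * (1 / m)) - P * (1 + 22 / 10000 - 4 * (1 / m))) \<ge> l * (1 / 1000)"
      using l by (intro mult_left_mono) auto
    moreover have "l * (16 * l) \<le> l * (1 / 1000)" using l by (intro mult_left_mono) auto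
    then have "16 * l\<^sup>2 \<le> l * (1 / 1000)" by (simp add: power2_eq_square)
    ultimately show "e - l * ((22 / 10000 - 4 * (1 / m)) - P * (1 + 22 / 10000 - 4 * (1 / m))) \<le> 1" unfolding e_def by linarith
  qed simp
  finally show ?thesis by (simp add: P_def V_def)
qed

text \<open>Only here is the term \<open>0.05 min (s + y) 3\<close> needed: it pays for restarting from a state without
  stubs and flags, where a vertex has to be deleted for nothing.\<close>

lemma drift_seed:
  fixes m u :: real
  assumes "m \<ge> 100000"
  shows "pot m u 0 0 \<le> pot m (u - 1) 0 3"
proof -
  have "1 / m \<le> 1 / 100000" using assms by (auto simp: field_simps)
  moreover have "pot m (u - 1) 0 3 - pot m u 0 0 = - (4353 / 10000) + 3171 / 10000 - (9 / 10) * (1 / m) + 15 / 100"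
    by (simp add: pot_def field_simps)
  ultimately show ?thesis by linarith
qed

text \<open>A coarse bound for the range of m in which no drift is available.\<close>

lemma pot_le:
  fixes m u s y :: real
  assumes "0 \<le> m" "0 \<le> u" "0 \<le> y" "2 * m = 3 * u + y" "s \<le> m"
  shows "pot m u s y \<le> 2 * m + 1"
proof -
  define Q where "Q = y\<^sup>2 / m"
  define b where "b = min (s + y) 3"
  have "Q \<ge> 0" "b \<le> 3" using assms by (auto simp: Q_def b_def)
  moreover have "pot m u s y = 4353 / 10000 * u + 11 / 20 * s + 1057 / 10000 * y - Q / 10 + b / 20"
    by (simp add: pot_def Q_def b_def)
  ultimately show ?thesis using assms by linarith
qed

subsection \<open>The exponential moment of the independence number\<close>

text \<open>Undecided vertices keep all three half-edges, so the number of stubs is card H - 3 card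
  W, and m, card W and s describe the state.\<close>

definition valid :: "('v \<times> 'k) set \<Rightarrow> 'v set \<Rightarrow> bool" where
  "valid H W \<longleftrightarrow> finite H \<and> finite W \<and> (\<forall>v\<in>W. card {x\<in>H. fst x = v} = 3)"

lemma valid_card:
  assumes "valid H W"
  shows "card {x\<in>H. fst x \<in> W} = 3 * card W" "3 * card W \<le> card H"
proof -
  have fin: "finite H" "finite W" using assms by (auto simp: valid_def)
  have "{x\<in>H. fst x \<in> W} = (\<Union>v\<in>W. {x\<in>H. fst x = v})" by auto
  also have "card \<dots> = (\<Sum>v\<in>W. card {x\<in>H. fst x = v})"
    using fin by (intro card_UN_disjoint) auto
  also have "\<dots> = 3 * card W" using assms by (simp add: valid_def)
  finally show "card {x\<in>H. fst x \<in> W} = 3 * card W" .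
  then show "3 * card W \<le> card H" using card_mono[OF fin(1), of "{x\<in>H. fst x \<in> W}"] by auto
qed

lemma valid_delete:
  assumes "valid H W" "W' \<subseteq> W" "\<And>x. x \<in> D \<Longrightarrow> fst x \<notin> W'"
  shows "valid (H - D) W'"
proof -
  have "{x\<in>H - D. fst x = v} = {x\<in>H. fst x = v}" if "v \<in> W'" for v using that assms(3) by auto
  then show ?thesis using assms(1,2) finite_subset[of W' W] by (auto simp: valid_def)
qed

lemma card_Diff_pair:
  assumes "finite H" "card H = 2 * m" "h \<in> H" "g \<in> H - {h}"
  shows "card (H - {h, g}) = 2 * (m - 1)" "finite (H - {h, g})"
  using assms by (auto simp: card_Diff_subset)

lemma Zsum_zero: "finite H \<Longrightarrow> card H = 2 * m \<Longrightarrow> m < s \<Longrightarrow> Zsum t H W s = 0"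
  by (simp add: Zsum_def fsum_def flagged_empty_if)

lemma Zsum_le_count:
  assumes "finite H" "card H = 2 * m" "0 < t" "t \<le> 1"
  shows "Zsum t H W s \<le> flagged_count m s"
proof -
  have "Zsum t H W s \<le> fsum H s (\<lambda>M T. 1)"
    unfolding Zsum_def using assms by (intro fsum_mono power_le_one) auto
  then show ?thesis using fsum_one[OF assms(1,2)] by (simp add: flagged_count_def)
qed

context
  fixes l t :: real
  assumes l: "0 < l" "l \<le> 1 / 20000" and t: "t = exp (- l)"
begin

text \<open>The factor exp(300000 l) makes the bound at least 1 for m < 100000. Since
  \<open>s\<close> is real, s - 1 may be -1; such terms always carry the factor s = 0.\<close>

definition bound :: "nat \<Rightarrow> real \<Rightarrow> real \<Rightarrow> real" where
  "bound m u s = exp (l * 300000) * exp (- l * pot (real m) u s (2 * real m - 3 * u))"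

lemma t01: "0 < t" "t \<le> 1"
  using l t by auto

text \<open>After the plain edge hg is removed the state is not valid, because the vertex of
  \<open>g\<close> has two half-edges left. Suppressing it restores validity with m - 2 edges, where
  the induction hypothesis applies.\<close>

lemma Zsum_suppress_bound:
  fixes H :: "('v \<times> 'k) set"
  assumes H: "valid H W" "card H = 2 * m" and m: "m \<ge> 100000"
    and h: "h \<in> H" "fst h \<notin> W" and g: "g \<in> H" "fst g \<in> W" and s: "s \<le> m - 1"
    and IH: "\<And>(H' :: ('v \<times> 'k) set) s. valid H' (W - {fst g}) \<Longrightarrow> card H' = 2 * (m - 2) \<Longrightarrow>
      Zsum t H' (W - {fst g}) s \<le> flagged_count (m - 2) s * bound (m - 2) (real (card W) - 1) (real s)"
  shows "Zsum t (H - {h, g}) W s \<le> flagged_count (m - 1) s *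
     ((real m - 1 - s) * bound (m - 2) (real (card W) - 1) s + s * bound (m - 2) (real (card W) - 1) (real s - 1) +
     2 * (real m - 1 - s) * (real m - 2 - s) * bound (m - 2) (real (card W) - 1) (real s + 1) +
     4 * (real m - 1 - s) * s * (t * bound (m - 2) (real (card W) - 1) (real s - 1)) +
     2 * (real s - 1) * s * (t * bound (m - 2) (real (card W) - 1) (real s - 1))) / ((real m - 1) * (2 * real m - 3))"
proof -
  define z where "z = fst g"
  define H1 where "H1 = H - {h, g}"
  define u where "u = real (card W) - 1"
  define Dn where "Dn = (real m - 1) * (2 * real m - 3)"
  have fin: "finite H" "finite W" using H by (auto simp: valid_def)
  have gh: "g \<in> H - {h}" using g h by auto
  have c1: "card H1 = 2 * (m - 1)" "finite H1" unfolding H1_def using card_Diff_pair[OF fin(1) H(2) h(1) gh] by auto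
  have "{x\<in>H1. fst x = z} = {x\<in>H. fst x = z} - {g}" using h g unfolding H1_def z_def by auto
  moreover have "card {x\<in>H. fst x = z} = 3" using H g by (auto simp: valid_def z_def)
  ultimately have "card {x\<in>H1. fst x = z} = 2" using g by (simp add: z_def)
  then obtain h1 h2 where hh: "{x\<in>H1. fst x = z} = {h1, h2}" "h1 \<noteq> h2" by (meson card_2_iff)
  have h12: "h1 \<in> H1" "h2 \<in> H1 - {h1}" "fst h1 = z" "fst h2 = z" using hh by auto
  define H' where "H' = H1 - {h1, h2}"
  define W' where "W' = W - {z}"
  have c2: "card H' = 2 * (m - 2)" unfolding H'_def
    using card_Diff_pair[OF c1(2,1) h12(1,2)] by (simp add: numeral_2_eq_2)
  have v: "valid H' W'"
  proof -
    have "H' = H - {h, g, h1, h2}" unfolding H'_def H1_def by auto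
    then show ?thesis using h g h12 unfolding W'_def
      by (auto intro!: valid_delete[OF H(1)] simp: z_def)
  qed
  let ?F = "\<lambda>s. flagged_count (m - 2) s" and ?b = "\<lambda>s. bound (m - 2) u s"
  have I: "Zsum t H' W' s \<le> ?F s * ?b s" for s using IH[OF _ c2] v unfolding W'_def u_def z_def by simp
  have m1: "0 < m - 1" "real (m - 1) = real m - 1" "real (m - 2) = real m - 2" "m - 1 - 1 = m - 2" using m by auto
  have sm: "real s \<le> real m - 1" using s m by linarith
  have Dn: "Dn > 0" unfolding Dn_def using m by simp
  define F where "F = flagged_count (m - 1) s"
  have F0: "?F s = F * ((real m - 1 - s) / Dn)"
    using flagged_count_drop[OF m1(1) s] unfolding m1 F_def Dn_def by (simp add: algebra_simps)
  have F1: "?F (s - 1) = F * (s / Dn)" if "s > 0"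
    using flagged_count_take[OF m1(1) that] unfolding m1 F_def Dn_def by (simp add: algebra_simps)
  have m2: "0 < m - 2" using m by simp
  have F2: "2 * real (Suc s) * ?F (Suc s) = 2 * (real m - 2 - s) * (F * ((real m - 1 - s) / Dn))"
    using flagged_count_Suc[OF m2, of s] unfolding F0 m1 .
  have "Zsum t H1 W s \<le> Zsum t H' W' s + (if s = 0 then 0 else Zsum t H' W' (s - 1)) +
     2 * real (Suc s) * Zsum t H' W' (Suc s) +
     (if s = 0 then 0 else t * (4 * (real (m - 2) - real (s - 1)) * Zsum t H' W' (s - 1))) +
     (if s < 2 then 0 else t * (2 * real (s - 1) * Zsum t H' W' (s - 1)))"
    using g by (intro Zsum_suppress[OF t01 c1(2) fin(2) _ hh H'_def c2 W'_def]) (simp add: z_def)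
  also have "\<dots> \<le> ?F s * ?b s + (if s = 0 then 0 else ?F (s - 1) * ?b (s - 1)) +
     2 * real (Suc s) * (?F (Suc s) * ?b (Suc s)) +
     (if s = 0 then 0 else t * (4 * (real (m - 2) - real (s - 1)) * (?F (s - 1) * ?b (s - 1)))) +
     (if s < 2 then 0 else t * (2 * real (s - 1) * (?F (s - 1) * ?b (s - 1))))"
  proof -
    have im: "(if P then 0 else a) \<le> (if P then 0 else b)" if "\<not> P \<Longrightarrow> a \<le> b" for P and a b :: real
      using that by simp
    have "0 \<le> real (m - 2) - real (s - 1)" if "s \<noteq> 0" using that sm m1 by simp
    then show ?thesis using t01
      by (intro add_mono im mult_left_mono I) auto
  qed
  also have "\<dots> = F * ((real m - 1 - s) * ?b s + s * ?b (real s - 1) +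
     2 * (real m - 1 - s) * (real m - 2 - s) * ?b (real s + 1) +
     4 * (real m - 1 - s) * s * (t * ?b (real s - 1)) +
     2 * (real s - 1) * s * (t * ?b (real s - 1))) / Dn"
  proof -
    have A: "?F s * ?b s = F * ((real m - 1 - s) * ?b s) / Dn" unfolding F0 by simp
    have B: "(if s = 0 then 0 else ?F (s - 1) * ?b (s - 1)) = F * (s * ?b (real s - 1)) / Dn"
      using F1 by (cases s) auto
    have C: "2 * real (Suc s) * (?F (Suc s) * ?b (Suc s)) = F * (2 * (real m - 1 - s) * (real m - 2 - s) * ?b (real s + 1)) / Dn"
    proof -
      have "2 * real (Suc s) * (?F (Suc s) * ?b (Suc s)) = (2 * real (Suc s) * ?F (Suc s)) * ?b (Suc s)" by (simp only: mult.assoc)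
      also have "\<dots> = 2 * (real m - 2 - s) * (F * ((real m - 1 - s) / Dn)) * ?b (Suc s)" by (simp only: F2)
      finally have X: "2 * real (Suc s) * (?F (Suc s) * ?b (Suc s)) = 2 * (real m - 2 - s) * (F * ((real m - 1 - s) / Dn)) * ?b (Suc s)" .
      have bS: "?b (real s + 1) = ?b (Suc s)" by (simp add: add.commute)
      show ?thesis unfolding X bS by (simp only: times_divide_eq_right times_divide_eq_left ac_simps)
    qed
    have D: "(if s = 0 then 0 else t * (4 * (real (m - 2) - real (s - 1)) * (?F (s - 1) * ?b (s - 1)))) = F * (4 * (real m - 1 - s) * s * (t * ?b (real s - 1))) / Dn"
    proof (cases "s = 0")
      case False
      then have "real (m - 2) - real (s - 1) = real m - 1 - s" "real (s - 1) = real s - 1" using m1 by auto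
      with False show ?thesis using F1 by (simp add: ac_simps)
    qed simp
    \<comment> \<open>The guard disappears because (s - 1) s vanishes at s = 0 and s = 1.\<close>
    have E: "(if s < 2 then 0 else t * (2 * real (s - 1) * (?F (s - 1) * ?b (s - 1)))) = F * (2 * (real s - 1) * s * (t * ?b (real s - 1))) / Dn"
    proof (cases "s < 2")
      case True
      then have "s = 0 \<or> s = 1" by auto
      then show ?thesis by auto
    next
      case False
      then have "real (s - 1) = real s - 1" by auto
      with False show ?thesis using F1 by (simp add: ac_simps)
    qed
    show ?thesis unfolding A B C D E by (simp only: add_divide_distrib[symmetric] distrib_left[symmetric])
  qed
  finally show ?thesis unfolding H1_def F_def Dn_def u_def .
qed

lemma Zsum_stub_bound:
  fixes H :: "('v \<times> 'k) set"
  assumes H: "valid H W" "card H = 2 * m" and m: "m \<ge> 100000" and s: "s \<le> m"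
    and h: "h \<in> H" "fst h \<notin> W"
    and IH: "\<And>(H' :: ('v \<times> 'k) set) W' m' s. valid H' W' \<Longrightarrow> card H' = 2 * m' \<Longrightarrow> m' < m \<Longrightarrow> W' \<subseteq> W \<Longrightarrow>
      Zsum t H' W' s \<le> flagged_count m' s * bound m' (real (card W')) (real s)"
  shows "Zsum t H W s \<le> flagged_count m s * bound m (real (card W)) (real s)"
proof -
  define u where "u = real (card W)"
  define y where "y = 2 * real m - 3 * u"
  define N where "N = flagged_count m s"
  define K where "K = exp (l * 300000)"
  have fin: "finite H" "finite W" using H by (auto simp: valid_def)
  have cW: "card {x\<in>H. fst x \<in> W} = 3 * card W" using valid_card[OF H(1)] by simp
  define A where "A = {x\<in>H - {h}. fst x \<notin> W}"
  define B where "B = {x\<in>H - {h}. fst x \<in> W}"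
  have AB: "H - {h} = A \<union> B" "A \<inter> B = {}" "finite A" "finite B" unfolding A_def B_def using fin by auto
  have "B = {x\<in>H. fst x \<in> W}" unfolding B_def using h by auto
  then have cB: "real (card B) = 3 * u" using cW by (simp add: u_def)
  have "card (H - {h}) = 2 * m - 1" using h fin H(2) by simp
  then have "card A + card B = 2 * m - 1" using card_Un_disjoint[OF AB(3,4,2)] AB(1) by simp
  then have cA: "real (card A) = y - 1" using cB m unfolding y_def by linarith
  have y1: "y \<ge> 1" using cA by simp
  have u0: "u \<ge> 0" by (simp add: u_def)
  \<comment> \<open>The mean over the five outcomes of a suppression, without the constant
    \<open>K\<close>; this is the left side of \<open>drift_suppress\<close>.\<close>
  define G where "G = ((real m - 1 - s) * exp (- l * pot (real m - 2) (u - 1) s (y - 1)) + s * exp (- l * pot (real m - 2) (u - 1) (real s - 1) (y - 1)) +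
     2 * (real m - 1 - s) * (real m - 2 - s) * exp (- l * pot (real m - 2) (u - 1) (real s + 1) (y - 1)) +
     4 * (real m - 1 - s) * s * exp (- l * (1 + pot (real m - 2) (u - 1) (real s - 1) (y - 1))) +
     2 * (real s - 1) * s * exp (- l * (1 + pot (real m - 2) (u - 1) (real s - 1) (y - 1)))) / ((real m - 1) * (2 * real m - 3))"
  have mr: "real (m - 1) = real m - 1" "real (m - 2) = real m - 2" using m by auto
  have b1: "bound (m - 1) u x = K * exp (- l * pot (real m - 1) u x (y - 2))" for x
  proof -
    have e: "2 * (real m - 1) - 3 * u = y - 2" by (simp add: y_def)
    show ?thesis unfolding bound_def K_def mr e ..
  qed
  have b2: "bound (m - 1) (u - 1) x = K * exp (- l * pot (real m - 1) (u - 1) x (y + 1))" for x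
  proof -
    have e: "2 * (real m - 1) - 3 * (u - 1) = y + 1" by (simp add: y_def)
    show ?thesis unfolding bound_def K_def mr e ..
  qed
  have b3: "bound (m - 2) (u - 1) x = K * exp (- l * pot (real m - 2) (u - 1) x (y - 1))" for x
  proof -
    have e: "2 * (real m - 2) - 3 * (u - 1) = y - 1" by (simp add: y_def)
    show ?thesis unfolding bound_def K_def mr e ..
  qed
  have te: "t * exp (- l * x) = exp (- l * (1 + x))" for x unfolding t by (simp add: exp_add[symmetric] algebra_simps)
  have cd: "card (H - {h, g}) = 2 * (m - 1)" "finite (H - {h, g})" if "g \<in> H - {h}" for g
    using card_Diff_pair[OF fin(1) H(2) h(1) that] by auto
  have m0: "m - 1 < m" "m - 2 < m" using m by auto
  have uz: "real (card (W - {fst g})) = u - 1" if "g \<in> B" for g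
  proof -
    have "fst g \<in> W" using that by (simp add: B_def)
    then have "card W = Suc (card (W - {fst g}))" using fin card_Suc_Diff1[of W "fst g"] by simp
    then show ?thesis by (simp add: u_def)
  qed
  have pA: "Zsum t (H - {h, g}) W s \<le> flagged_count (m - 1) s * (K * exp (- l * pot (real m - 1) u s (y - 2)))"
    if "g \<in> A" for g
  proof -
    have g: "g \<in> H - {h}" "fst g \<notin> W" using that by (auto simp: A_def)
    have "valid (H - {h, g}) W" using g h by (intro valid_delete[OF H(1)]) auto
    from IH[OF this cd(1)[OF g(1)] m0(1), of s] show ?thesis unfolding u_def[symmetric] b1 by simp
  qed
  have pB: "Zsum t (H - {h, g}) W s \<le> flagged_count (m - 1) s * (K * G)" if "g \<in> B" for g
  proof (cases "s \<le> m - 1")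
    case True
    have g: "g \<in> H" "fst g \<in> W" using that by (auto simp: B_def)
    have "Zsum t (H - {h, g}) W s \<le> flagged_count (m - 1) s *
     ((real m - 1 - s) * bound (m - 2) (u - 1) s + s * bound (m - 2) (u - 1) (real s - 1) +
     2 * (real m - 1 - s) * (real m - 2 - s) * bound (m - 2) (u - 1) (real s + 1) +
     4 * (real m - 1 - s) * s * (t * bound (m - 2) (u - 1) (real s - 1)) +
     2 * (real s - 1) * s * (t * bound (m - 2) (u - 1) (real s - 1))) / ((real m - 1) * (2 * real m - 3))"
      unfolding u_def
    proof (rule Zsum_suppress_bound[OF H m h g True])
      fix H' :: "('v \<times> 'k) set" and s' assume "valid H' (W - {fst g})" "card H' = 2 * (m - 2)"
      from IH[OF this m0(2), of s'] show "Zsum t H' (W - {fst g}) s' \<le> flagged_count (m - 2) s' * bound (m - 2) (real (card W) - 1) (real s')"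
        using uz[OF that] by (auto simp: u_def)
    qed
    also have "\<dots> = flagged_count (m - 1) s * (K * G)"
      unfolding b3 G_def te[symmetric] by (simp add: field_simps)
    finally show ?thesis .
  next
    case False
    then have gH: "g \<in> H - {h}" and "m - 1 < s" using that by (auto simp: B_def)
    then show ?thesis using Zsum_zero[OF cd(2)[OF gH] cd(1)[OF gH]] by (simp add: flagged_count_def binomial_eq_0)
  qed
  have fA: "Zsum t (H - {h, g}) (W - {fst g}) (s - 1) \<le> flagged_count (m - 1) (s - 1) * (K * exp (- l * pot (real m - 1) u (real s - 1) (y - 2)))"
    if "g \<in> A" "s > 0" for g
  proof -
    have g: "g \<in> H - {h}" "fst g \<notin> W" using that by (auto simp: A_def)
    have v: "valid (H - {h, g}) W" using g h by (intro valid_delete[OF H(1)]) auto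
    have "W - {fst g} = W" using g by auto
    with IH[OF v cd(1)[OF g(1)] m0(1), of "s - 1"] show ?thesis using that unfolding u_def[symmetric] b1 by (simp add: of_nat_diff)
  qed
  have fB: "Zsum t (H - {h, g}) (W - {fst g}) (s - 1) \<le> flagged_count (m - 1) (s - 1) * (K * exp (- l * pot (real m - 1) (u - 1) (real s - 1) (y + 1)))"
    if "g \<in> B" "s > 0" for g
  proof -
    have g: "g \<in> H - {h}" "fst g \<in> W" using that by (auto simp: B_def)
    have v: "valid (H - {h, g}) (W - {fst g})" using g h by (intro valid_delete[OF H(1)]) auto
    from IH[OF v cd(1)[OF g(1)] m0(1), of "s - 1"] show ?thesis using that unfolding uz[OF that(1)] b2 by (auto simp: of_nat_diff)
  qed
  have F1: "flagged_count (m - 1) s = N * ((1 - s / m) / (2 * real m - 1))"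
  proof -
    have "(real m - real s) / (real m * (2 * real m - 1)) = (1 - s / m) / (2 * real m - 1)"
      using m by (simp add: field_simps)
    then show ?thesis using flagged_count_drop[of m s] m s unfolding N_def by simp
  qed
  have F2: "flagged_count (m - 1) (s - 1) = N * ((s / m) / (2 * real m - 1))" if "s > 0"
    using flagged_count_take[of m s] m that unfolding N_def by simp
  define X1 where "X1 = exp (- l * pot (real m - 1) u s (y - 2))"
  define X2 where "X2 = exp (- l * pot (real m - 1) u (real s - 1) (y - 2))"
  define X3 where "X3 = exp (- l * pot (real m - 1) (u - 1) (real s - 1) (y + 1))"
  have "Zsum t H W s \<le> (\<Sum>g\<in>H - {h}. Zsum t (H - {h, g}) W s) +
     (if s = 0 then 0 else \<Sum>g\<in>H - {h}. t * Zsum t (H - {h, g}) (W - {fst g}) (s - 1))"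
    by (rule Zsum_stub[OF t01 fin h])
  also have "\<dots> \<le> (card A * (flagged_count (m - 1) s * (K * X1)) + card B * (flagged_count (m - 1) s * (K * G))) +
     (if s = 0 then 0 else card A * (t * (flagged_count (m - 1) (s - 1) * (K * X2))) + card B * (t * (flagged_count (m - 1) (s - 1) * (K * X3))))"
  proof (rule add_mono)
    show "(\<Sum>g\<in>H - {h}. Zsum t (H - {h, g}) W s) \<le> card A * (flagged_count (m - 1) s * (K * X1)) + card B * (flagged_count (m - 1) s * (K * G))"
      unfolding AB(1) sum.union_disjoint[OF AB(3,4,2)] X1_def using pA pB by (intro add_mono sum_bounded_above)
    show "(if s = 0 then 0 else \<Sum>g\<in>H - {h}. t * Zsum t (H - {h, g}) (W - {fst g}) (s - 1)) \<le>
      (if s = 0 then 0 else card A * (t * (flagged_count (m - 1) (s - 1) * (K * X2))) + card B * (t * (flagged_count (m - 1) (s - 1) * (K * X3))))"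
    proof (cases "s = 0")
      case False
      have "(\<Sum>g\<in>H - {h}. t * Zsum t (H - {h, g}) (W - {fst g}) (s - 1)) \<le>
        card A * (t * (flagged_count (m - 1) (s - 1) * (K * X2))) + card B * (t * (flagged_count (m - 1) (s - 1) * (K * X3)))"
        unfolding AB(1) sum.union_disjoint[OF AB(3,4,2)] X2_def X3_def
        using fA fB t01 False by (intro add_mono sum_bounded_above mult_left_mono) auto
      with False show ?thesis by simp
    qed simp
  qed
  also have "\<dots> = N * K * ((1 - s / m) * ((y - 1) / (2 * real m - 1) * X1 + 3 * u / (2 * real m - 1) * G) +
    s / m * ((y - 1) / (2 * real m - 1) * (t * X2) + 3 * u / (2 * real m - 1) * (t * X3)))"
  proof -
    have e1: "(if s = 0 then 0 else card A * (t * (flagged_count (m - 1) (s - 1) * (K * X2))) + card B * (t * (flagged_count (m - 1) (s - 1) * (K * X3))))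
      = (y - 1) * (t * (N * ((s / m) / (2 * real m - 1)) * (K * X2))) + 3 * u * (t * (N * ((s / m) / (2 * real m - 1)) * (K * X3)))"
      using F2 cA cB by simp
    define a where "a = 1 - s / m"
    define b where "b = s / m"
    define d where "d = 1 / (2 * real m - 1)"
    have dd: "x / (2 * real m - 1) = x * d" for x by (simp add: d_def)
    show ?thesis unfolding e1 unfolding cA cB F1 a_def[symmetric] b_def[symmetric] dd by (simp only: algebra_simps)
  qed
  also have "\<dots> \<le> N * K * exp (- l * pot m u s y)"
  proof (rule mult_left_mono)
    show "(1 - s / m) * ((y - 1) / (2 * real m - 1) * X1 + 3 * u / (2 * real m - 1) * G) +
      s / m * ((y - 1) / (2 * real m - 1) * (t * X2) + 3 * u / (2 * real m - 1) * (t * X3)) \<le> exp (- l * pot m u s y)"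
      unfolding X1_def X2_def X3_def te
    proof (rule drift_stub)
      show "real m \<ge> 100000" "real s \<le> real m" using m s by auto
      show "2 * real m = 3 * u + y" by (simp add: y_def)
      show "G \<le> exp (- l * pot m u s y) * (1 + 16 * l\<^sup>2 - l * (- (91 / 1000) + (1 / 10) * ((real m - s) / m)\<^sup>2
        + (1 / 10) * (2 * (y / m) - 2 * (y / m)\<^sup>2) - 9 / m))" if "real s < real m"
        unfolding G_def
      proof (rule drift_suppress)
        show "real m \<ge> 100000" using m by simp
        show "0 \<le> y / m" "y / m \<le> 2" "y = y / m * m" using y1 u0 m unfolding y_def by (auto simp: field_simps)
        show "y \<ge> 1" by fact
        have "s \<le> m - 1" using that by linarith
        then show "real s \<le> real m - 1" using m by linarith
        show "real s = 0 \<or> 1 \<le> real s" by auto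
        have "s + 1 = m \<or> s + 2 \<le> m" using that by linarith
        then show "real s = real m - 1 \<or> real s \<le> real m - 2" by linarith
        show "l \<le> 1 / 4" using l by simp
      qed (use l in auto)
    qed (use l y1 u0 in auto)
    show "0 \<le> N * K" unfolding N_def K_def using flagged_count_nonneg by simp
  qed
  also have "\<dots> = flagged_count m s * bound m (real (card W)) (real s)"
    unfolding N_def K_def bound_def y_def u_def by simp
  finally show ?thesis .
qed

lemma Zsum_start_bound:
  fixes H :: "('v \<times> 'k) set"
  assumes H: "valid H W" "card H = 2 * m" and m: "m \<ge> 100000" and full: "\<And>x. x \<in> H \<Longrightarrow> fst x \<in> W"
    and IH: "\<And>(H' :: ('v \<times> 'k) set) W' m' s. valid H' W' \<Longrightarrow> card H' = 2 * m' \<Longrightarrow> m' < m \<Longrightarrow> W' \<subseteq> W \<Longrightarrow>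
      Zsum t H' W' s \<le> flagged_count m' s * bound m' (real (card W')) (real s)"
  shows "Zsum t H W (Suc s) \<le> flagged_count m (Suc s) * bound m (real (card W)) (real (Suc s))"
proof -
  define u where "u = real (card W)"
  define N where "N = flagged_count m (Suc s)"
  define K where "K = exp (l * 300000)"
  have fin: "finite H" "finite W" using H by (auto simp: valid_def)
  have "{x\<in>H. fst x \<in> W} = H" using full by auto
  then have "card H = 3 * card W" using valid_card(1)[OF H(1)] by simp
  then have u: "2 * real m = 3 * u" using H(2) by (simp add: u_def)
  have mr: "real (m - 1) = real m - 1" using m by auto
  define X1 where "X1 = exp (- l * (1 + pot (real m - 1) (u - 1) (real (Suc s) - 1) 1))"
  define X2 where "X2 = exp (- l * (1 + pot (real m - 1) (u - 2) (real (Suc s) - 1) 4))"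
  define F where "F = flagged_count (m - 1) s"
  have F: "F = N * (real (Suc s) / (real m * (2 * real m - 1)))"
    using flagged_count_take[of m "Suc s"] m unfolding N_def F_def by simp
  have te: "t * exp (- l * x) = exp (- l * (1 + x))" for x unfolding t by (simp add: exp_add[symmetric] algebra_simps)
  have each: "t * Zsum t (H - {h, g}) (W - {fst h, fst g}) s \<le> F * K * (if fst g = fst h then X1 else X2)"
    if h: "h \<in> H" and g: "g \<in> H - {h}" for h g
  proof -
    have v: "valid (H - {h, g}) (W - {fst h, fst g})" by (intro valid_delete[OF H(1)]) auto
    have cd: "card (H - {h, g}) = 2 * (m - 1)" using card_Diff_pair[OF fin(1) H(2) h g] by simp
    have hg: "fst h \<in> W" "fst g \<in> W" using full h g by auto
    have cw: "real (card (W - {fst h, fst g})) = (if fst g = fst h then u - 1 else u - 2)"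
    proof -
      have "card {fst h, fst g} \<le> card W" using hg fin by (intro card_mono) auto
      then show ?thesis using hg fin by (auto simp: card_Diff_subset u_def of_nat_diff)
    qed
    have "t * Zsum t (H - {h, g}) (W - {fst h, fst g}) s \<le> t * (F * bound (m - 1) (real (card (W - {fst h, fst g}))) s)"
      unfolding F_def using IH[OF v cd, of s] m t01 by (intro mult_left_mono) auto
    also have "\<dots> = F * K * (if fst g = fst h then X1 else X2)"
    proof -
      have y: "2 * (real m - 1) - 3 * (u - 1) = 1" "2 * (real m - 1) - 3 * (u - 2) = 4" using u by auto
      show ?thesis unfolding cw bound_def mr K_def[symmetric] X1_def X2_def te[symmetric] using y by (simp add: ac_simps)
    qed
    finally show ?thesis .
  qed
  have "2 * real (Suc s) * Zsum t H W (Suc s) \<le> (\<Sum>h\<in>H. \<Sum>g\<in>H - {h}. t * Zsum t (H - {h, g}) (W - {fst h, fst g}) s)"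
    by (rule Zsum_start[OF t01 fin])
  also have "\<dots> \<le> (\<Sum>h\<in>H. \<Sum>g\<in>H - {h}. F * K * (if fst g = fst h then X1 else X2))"
    using each by (intro sum_mono) auto
  also have "\<dots> = (\<Sum>h\<in>H. F * K * (2 * X1 + (2 * real m - 3) * X2))"
  proof (rule sum.cong[OF refl])
    fix h assume h: "h \<in> H"
    define A where "A = {g\<in>H - {h}. fst g = fst h}"
    define B where "B = {g\<in>H - {h}. fst g \<noteq> fst h}"
    have AB: "H - {h} = A \<union> B" "A \<inter> B = {}" "finite A" "finite B" unfolding A_def B_def using fin by auto
    have "A = {x\<in>H. fst x = fst h} - {h}" unfolding A_def by auto
    moreover have "card {x\<in>H. fst x = fst h} = 3" using H(1) full[OF h] by (auto simp: valid_def)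
    ultimately have cA: "card A = 2" using h by simp
    have "card (H - {h}) = 2 * m - 1" using h fin H(2) by simp
  then have "card A + card B = 2 * m - 1" using card_Un_disjoint[OF AB(3,4,2)] AB(1) by simp
    then have cB: "real (card B) = 2 * real m - 3" using cA m by linarith
    have "(\<Sum>g\<in>H - {h}. F * K * (if fst g = fst h then X1 else X2)) = (\<Sum>g\<in>A. F * K * X1) + (\<Sum>g\<in>B. F * K * X2)"
      unfolding AB(1) sum.union_disjoint[OF AB(3,4,2)] by (intro arg_cong2[of _ _ _ _ "(+)"] sum.cong) (auto simp: A_def B_def)
    then show "(\<Sum>g\<in>H - {h}. F * K * (if fst g = fst h then X1 else X2)) = F * K * (2 * X1 + (2 * real m - 3) * X2)"
      using cA cB by (simp add: algebra_simps)
  qed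
  also have "\<dots> = 2 * real m * (F * K * (2 * X1 + (2 * real m - 3) * X2))" using H(2) by simp
  also have "\<dots> = 2 * real (Suc s) * (N * K * (2 / (2 * real m - 1) * X1 + (1 - 2 / (2 * real m - 1)) * X2))"
  proof -
    have "2 * real m - 1 \<noteq> 0" "real m \<noteq> 0" using m by auto
    moreover have "1 - 2 / (2 * real m - 1) = (2 * real m - 3) / (2 * real m - 1)" using m by (simp add: field_simps)
    ultimately show ?thesis unfolding F by (simp add: add_divide_distrib[symmetric])
  qed
  also have "\<dots> \<le> 2 * real (Suc s) * (N * K * exp (- l * pot m u (Suc s) 0))"
    unfolding X1_def X2_def
    by (intro mult_left_mono drift_start) (use m u l flagged_count_nonneg in \<open>auto simp: N_def K_def\<close>)
  finally have "Zsum t H W (Suc s) \<le> N * K * exp (- l * pot m u (Suc s) 0)" by simp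
  moreover have "2 * real m - 3 * u = 0" using u by simp
  ultimately show ?thesis unfolding bound_def u_def[symmetric] N_def K_def by simp
qed

text \<open>Every move decreases m except the restart without stubs and flags, which only turns a
  vertex into three stubs; therefore the measure is m + card W.\<close>

theorem Zsum_bound:
  fixes H :: "('v \<times> 'k) set"
  shows "valid H W \<Longrightarrow> card H = 2 * m \<Longrightarrow> Zsum t H W s \<le> flagged_count m s * bound m (real (card W)) (real s)"
proof (induction "m + card W" arbitrary: H W m s rule: less_induct)
  case less
  note H = less.prems
  have fin: "finite H" "finite W" using H by (auto simp: valid_def)
  have c3: "3 * card W \<le> 2 * m" using valid_card(2)[OF H(1)] H(2) by simp
  have IH: "Zsum t H' W' s \<le> flagged_count m' s * bound m' (real (card W')) (real s)"
    if "valid H' W'" "card H' = 2 * m'" "m' < m" "W' \<subseteq> W" for H' :: "('v \<times> 'k) set" and W' m' s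
    using that card_mono[OF fin(2) that(4)] by (intro less.hyps) auto
  consider "s > m" | "s \<le> m" "m < 100000" | h where "s \<le> m" "m \<ge> 100000" "h \<in> H" "fst h \<notin> W"
    | "s \<le> m" "m \<ge> 100000" "\<And>x. x \<in> H \<Longrightarrow> fst x \<in> W" "s = 0"
    | k where "s \<le> m" "m \<ge> 100000" "\<And>x. x \<in> H \<Longrightarrow> fst x \<in> W" "s = Suc k"
    by (metis not_less not0_implies_Suc)
  then show ?case
  proof cases
    case 1
    then show ?thesis using Zsum_zero[OF fin(1) H(2), of s t W] by (simp add: flagged_count_def binomial_eq_0)
  next
    case 2
    \<comment> \<open>The drift estimates need large m. For small m the potential is at most 300000,
      so the constant in \<open>bound\<close> pays for the trivial estimate
      \<open>t ^ alpha W M T \<le> 1\<close>.\<close>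
    have "pot (real m) (real (card W)) (real s) (2 * real m - 3 * real (card W)) \<le> 2 * real m + 1"
      using c3 2 by (intro pot_le) auto
    also have "\<dots> \<le> 300000" using 2 by simp
    finally have "0 \<le> l * 300000 + - l * pot (real m) (real (card W)) (real s) (2 * real m - 3 * real (card W))" using l by simp
    then have "1 \<le> bound m (real (card W)) (real s)" unfolding bound_def exp_add[symmetric] by simp
    then have "flagged_count m s * 1 \<le> flagged_count m s * bound m (real (card W)) (real s)"
      using flagged_count_nonneg by (intro mult_left_mono) auto
    then show ?thesis using Zsum_le_count[OF fin(1) H(2) t01, of W s] by simp
  next
    case 3
    then show ?thesis using IH by (intro Zsum_stub_bound[OF H]) auto
  next
    case 4
    have "H \<noteq> {}" using 4 H by auto
    then obtain v where v: "v \<in> W" using 4 by auto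
    define W' where "W' = W - {v}"
    have cw: "card W = Suc (card W')" unfolding W'_def using v fin card_Suc_Diff1[of W v] by simp
    have "valid H W'" using valid_delete[OF H(1), of W' "{}"] by (auto simp: W'_def)
    then have Z: "Zsum t H W' s \<le> flagged_count m s * bound m (real (card W')) (real s)"
      using cw H by (intro less.hyps) auto
    have "{x\<in>H. fst x \<in> W} = H" using 4 by auto
    then have "2 * m = 3 * card W" using valid_card(1)[OF H(1)] H(2) by simp
    then have y: "2 * real m - 3 * real (card W) = 0" "2 * real m - 3 * real (card W') = 3" using cw by auto
    have "pot m (real (card W)) 0 0 \<le> pot m (real (card W) - 1) 0 3" using 4 by (intro drift_seed) auto
    then have "bound m (real (card W')) 0 \<le> bound m (real (card W)) 0"
      unfolding bound_def y using cw l by simp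
    then have "flagged_count m s * bound m (real (card W')) (real s) \<le> flagged_count m s * bound m (real (card W)) (real s)"
      using 4 flagged_count_nonneg by (intro mult_left_mono) auto
    moreover have "Zsum t H W s \<le> Zsum t H W' s" by (rule Zsum_mono[OF t01 fin]) (auto simp: W'_def)
    ultimately show ?thesis using Z by simp
  next
    case 5
    show ?thesis unfolding 5(4)
    proof (rule Zsum_start_bound[OF H 5(2)])
      fix H' :: "('v \<times> 'k) set" and W' m' s'
      assume "valid H' W'" "card H' = 2 * m'" "m' < m" "W' \<subseteq> W"
      then show "Zsum t H' W' s' \<le> flagged_count m' s' * bound m' (real (card W')) (real s')" by (rule IH)
    qed (rule 5(3))
  qed
qed

end

subsection \<open>Simple configurations\<close>

text \<open>The first condition excludes loops, the second parallel edges.\<close>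

definition simple_matching :: "('v \<times> 'k) set set \<Rightarrow> bool" where
  "simple_matching P \<longleftrightarrow> (\<forall>e\<in>P. card (fst ` e) = 2) \<and> inj_on (image fst) P"

definition partial_simple :: "('v \<times> 'k) set \<Rightarrow> nat \<Rightarrow> ('v \<times> 'k) set set set" where
  "partial_simple H k = {P. P \<in> matchings (\<Union>P) \<and> \<Union>P \<subseteq> H \<and> card P = k \<and> simple_matching P}"

locale half_edges =
  fixes H :: "('v \<times> 'k) set" and M :: nat
  assumes fin: "finite H" and cardH: "card H = 2 * M" and deg: "\<And>v. card {x\<in>H. fst x = v} \<le> 3"
begin

lemma partial_simpleD:
  assumes "P \<in> partial_simple H k"
  shows "\<Union>P \<subseteq> H" "card P = k" "finite P" "card (\<Union>P) = 2 * k" "card (H - \<Union>P) = 2 * (M - k)" "k \<le> M"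
    "\<And>e. e \<in> P \<Longrightarrow> card e = 2" "\<And>e e' x. e \<in> P \<Longrightarrow> e' \<in> P \<Longrightarrow> x \<in> e \<Longrightarrow> x \<in> e' \<Longrightarrow> e = e'"
    "\<And>e. e \<in> P \<Longrightarrow> card (fst ` e) = 2" "\<And>e e'. e \<in> P \<Longrightarrow> e' \<in> P \<Longrightarrow> fst ` e = fst ` e' \<Longrightarrow> e = e'"
proof -
  have P: "P \<in> matchings (\<Union>P)" "\<Union>P \<subseteq> H" "card P = k" "simple_matching P" using assms by (auto simp: partial_simple_def)
  show "\<Union>P \<subseteq> H" "card P = k" by fact+
  have fU: "finite (\<Union>P)" by (rule finite_subset[OF P(2) fin])
  show "finite P" using finite_matching[OF fU P(1)] .
  show c: "card (\<Union>P) = 2 * k" using card_Union_matching[OF fU P(1) subset_refl] P(3) by simp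
  show "card (H - \<Union>P) = 2 * (M - k)" using c cardH card_Diff_subset[OF fU P(2)] by simp
  show "k \<le> M" using card_mono[OF fin P(2)] c cardH by simp
  show "\<And>e. e \<in> P \<Longrightarrow> card e = 2" "\<And>e e' x. e \<in> P \<Longrightarrow> e' \<in> P \<Longrightarrow> x \<in> e \<Longrightarrow> x \<in> e' \<Longrightarrow> e = e'"
    using matchingsD[OF P(1)] by auto
  show "\<And>e. e \<in> P \<Longrightarrow> card (fst ` e) = 2" "\<And>e e'. e \<in> P \<Longrightarrow> e' \<in> P \<Longrightarrow> fst ` e = fst ` e' \<Longrightarrow> e = e'"
    using P(4) by (auto simp: simple_matching_def inj_on_def)
qed

lemma finite_partial_simple: "finite (partial_simple H k)"
  by (rule finite_subset[of _ "Pow (Pow H)"]) (use fin in \<open>auto simp: partial_simple_def\<close>)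

lemma card_at_le:
  assumes "finite A" shows "card {x\<in>H. fst x \<in> A} \<le> 3 * card A"
proof -
  have "{x\<in>H. fst x \<in> A} = (\<Union>v\<in>A. {x\<in>H. fst x = v})" by auto
  then have "card {x\<in>H. fst x \<in> A} \<le> (\<Sum>v\<in>A. card {x\<in>H. fst x = v})"
    using card_UN_le[OF assms, of "\<lambda>v. {x\<in>H. fst x = v}"] by simp
  also have "\<dots> \<le> (\<Sum>v\<in>A. 3)" by (intro sum_mono deg)
  finally show ?thesis by simp
qed

lemma partial_simple_insert:
  assumes P: "P \<in> partial_simple H k" and ab: "a \<in> H - \<Union>P" "b \<in> H - \<Union>P" "fst a \<noteq> fst b"
    and new: "{fst a, fst b} \<notin> image fst ` P"
  shows "insert {a, b} P \<in> partial_simple H (Suc k)"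
proof -
  note D = partial_simpleD[OF P]
  have P': "P \<in> matchings (\<Union>P)" "simple_matching P" using P by (auto simp: partial_simple_def)
  have U: "\<Union>(insert {a, b} P) - {a, b} = \<Union>P" using ab by auto
  have "insert {a, b} P \<in> matchings (\<Union>(insert {a, b} P))"
  proof (rule matchings_insert(1))
    show "P \<in> matchings (\<Union>(insert {a, b} P) - {a, b})" unfolding U by (rule P')
    show "b \<noteq> a" using ab by auto
  qed auto
  moreover have "{a, b} \<notin> P" using ab by auto
  moreover have "simple_matching (insert {a, b} P)"
    using P'(2) ab new unfolding simple_matching_def by (auto simp: inj_on_insert)
  ultimately show ?thesis using ab D unfolding partial_simple_def by auto
qed

text \<open>The half-edges that may not be joined to \<open>a\<close> sit at the vertex of \<open>a\<close> or at one of its at most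
  two neighbours, and each of these neighbours has at most two free half-edges.\<close>

lemma card_blocked:
  assumes P: "P \<in> partial_simple H k" and a: "a \<in> H - \<Union>P"
  shows "card {b\<in>H - \<Union>P. fst b = fst a \<or> {fst a, fst b} \<in> image fst ` P} \<le> 7"
proof -
  note D = partial_simpleD[OF P]
  define Q where "Q = {e\<in>P. fst a \<in> fst ` e}"
  have fQ: "finite Q" using D by (simp add: Q_def)
  have pick: "\<exists>x. x \<in> e \<and> fst x = fst a" if "e \<in> Q" for e using that by (auto simp: Q_def)
  define p where "p e = (SOME x. x \<in> e \<and> fst x = fst a)" for e :: "('v \<times> 'k) set"
  have p: "p e \<in> e" "fst (p e) = fst a" if "e \<in> Q" for e
    using someI_ex[OF pick[OF that]] by (auto simp: p_def)
  have "inj_on p Q"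
  proof (rule inj_onI)
    fix e e' assume "e \<in> Q" "e' \<in> Q" "p e = p e'"
    then show "e = e'" using D(8)[of e e' "p e"] p(1)[of e] p(1)[of e'] by (simp add: Q_def)
  qed
  moreover have "p ` Q \<subseteq> {x\<in>H. fst x = fst a} - {a}"
  proof
    fix y assume "y \<in> p ` Q"
    then obtain e where e: "e \<in> Q" "y = p e" by blast
    then have "y \<in> \<Union>P" using p(1)[OF e(1)] by (auto simp: Q_def)
    then show "y \<in> {x\<in>H. fst x = fst a} - {a}" using a D(1) p(2)[OF e(1)] e(2) by auto
  qed
  ultimately have "card Q \<le> card ({x\<in>H. fst x = fst a} - {a})" using fin by (intro card_inj_on_le) auto
  also have "\<dots> \<le> 2" using deg[of "fst a"] a fin by simp
  finally have cQ: "card Q \<le> 2" .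
  define nb where "nb e = {b\<in>H - \<Union>P. fst b \<in> fst ` e - {fst a}}" for e :: "('v \<times> 'k) set"
  have cnb: "card (nb e) \<le> 2" if e: "e \<in> Q" for e
  proof -
    have "card (fst ` e) = 2" "fst a \<in> fst ` e" "e \<in> P" using e D by (auto simp: Q_def)
    obtain u v where uv: "fst ` e = {u, v}" "u \<noteq> v" using \<open>card (fst ` e) = 2\<close> by (meson card_2_iff)
    define w where "w = (if u = fst a then v else u)"
    have w: "fst ` e - {fst a} = {w}" using uv \<open>fst a \<in> fst ` e\<close> by (auto simp: w_def)
    then have "w \<in> fst ` e" by blast
    then obtain x where x: "x \<in> e" "fst x = w" by blast
    then have xH: "x \<in> H" "x \<in> \<Union>P" using \<open>e \<in> P\<close> D(1) by auto
    have "nb e \<subseteq> {b\<in>H. fst b = w} - {x}" unfolding nb_def w using xH by auto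
    then have "card (nb e) \<le> card ({b\<in>H. fst b = w} - {x})" using fin by (intro card_mono) auto
    also have "\<dots> \<le> 2" using deg[of w] xH x fin by simp
    finally show ?thesis .
  qed
  have "{b\<in>H - \<Union>P. fst b = fst a \<or> {fst a, fst b} \<in> image fst ` P} \<subseteq> {x\<in>H. fst x = fst a} \<union> (\<Union>e\<in>Q. nb e)"
  proof
    fix b assume b: "b \<in> {b\<in>H - \<Union>P. fst b = fst a \<or> {fst a, fst b} \<in> image fst ` P}"
    show "b \<in> {x\<in>H. fst x = fst a} \<union> (\<Union>e\<in>Q. nb e)"
    proof (cases "fst b = fst a")
      case False
      then obtain e where "e \<in> P" "fst ` e = {fst a, fst b}" using b by auto
      then have "e \<in> Q" "b \<in> nb e" using b False by (auto simp: Q_def nb_def)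
      then show ?thesis by blast
    qed (use b in auto)
  qed
  then have "card {b\<in>H - \<Union>P. fst b = fst a \<or> {fst a, fst b} \<in> image fst ` P} \<le> card ({x\<in>H. fst x = fst a} \<union> (\<Union>e\<in>Q. nb e))"
    using fin fQ by (intro card_mono) (auto simp: nb_def)
  also have "\<dots> \<le> card {x\<in>H. fst x = fst a} + card (\<Union>e\<in>Q. nb e)" by (rule card_Un_le)
  also have "\<dots> \<le> 3 + (\<Sum>e\<in>Q. card (nb e))" using deg card_UN_le[OF fQ] by (intro add_mono) auto
  also have "(\<Sum>e\<in>Q. card (nb e)) \<le> (\<Sum>e\<in>Q. 2)" using cnb by (intro sum_mono) auto
  also have "\<dots> \<le> 4" using cQ by simp
  finally show ?thesis by simp
qed

text \<open>Double counting of partial matchings with an ordered new edge. Of the r = 2(M - k) free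
  half-edges at most seven are blocked for a given end, and k + 4 <= M makes r - 7 positive.\<close>

lemma extend_count:
  assumes "k + 4 \<le> M"
  shows "card (partial_simple H k) * (2 * (M - k) * (2 * (M - k) - 7)) \<le> card (partial_simple H (Suc k)) * (2 * Suc k)"
proof -
  define r where "r = 2 * (M - k)"
  define ok where "ok P = {(a, b). a \<in> H - \<Union>P \<and> b \<in> H - \<Union>P \<and> fst a \<noteq> fst b \<and> {fst a, fst b} \<notin> image fst ` P}" for P :: "('v \<times> 'k) set set"
  define ends where "ends P' = {(a, b). a \<noteq> b \<and> {a, b} \<in> P'}" for P' :: "('v \<times> 'k) set set"
  have fok: "finite (ok P)" for P
    by (rule finite_subset[of _ "H \<times> H"]) (use fin in \<open>auto simp: ok_def\<close>)
  have okc: "r * (r - 7) \<le> card (ok P)" if P: "P \<in> partial_simple H k" for P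
  proof -
    note D = partial_simpleD[OF P]
    define F where "F = H - \<Union>P"
    define g where "g a = {b\<in>F. \<not> (fst b = fst a \<or> {fst a, fst b} \<in> image fst ` P)}" for a :: "'v \<times> 'k"
    have cF: "card F = r" "finite F" using D(5) fin by (auto simp: F_def r_def)
    have "r - 7 \<le> card (g a)" if a: "a \<in> F" for a
    proof -
      have "g a = F - {b\<in>F. fst b = fst a \<or> {fst a, fst b} \<in> image fst ` P}" by (auto simp: g_def)
      then have "card (g a) = r - card {b\<in>F. fst b = fst a \<or> {fst a, fst b} \<in> image fst ` P}"
        using cF by (simp add: card_Diff_subset)
      moreover have "card {b\<in>F. fst b = fst a \<or> {fst a, fst b} \<in> image fst ` P} \<le> 7"
        using card_blocked[OF P] a unfolding F_def by blast
      ultimately show ?thesis by linarith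
    qed
    then have "(\<Sum>a\<in>F. r - 7) \<le> (\<Sum>a\<in>F. card (g a))" by (intro sum_mono)
    also have "\<dots> = card (Sigma F g)" using cF by (subst card_SigmaI) (auto simp: g_def)
    also have "Sigma F g = ok P" unfolding ok_def g_def F_def by auto
    finally show ?thesis using cF by simp
  qed
  have ce: "card (ends P') \<le> 2 * Suc k" if P: "P' \<in> partial_simple H (Suc k)" for P'
  proof -
    note D = partial_simpleD[OF P]
    have "inj_on fst (ends P')"
    proof (rule inj_onI)
      fix x y assume x: "x \<in> ends P'" "y \<in> ends P'" "fst x = fst y"
      obtain a b where xe: "x = (a, b)" "{a, b} \<in> P'" using x(1) by (auto simp: ends_def)
      obtain b' where ye: "y = (a, b')" "{a, b'} \<in> P'" using x(2,3) xe(1) by (cases y) (auto simp: ends_def)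
      have "{a, b} = {a, b'}" using D(8)[OF xe(2) ye(2), of a] by simp
      then show "x = y" using xe ye by (auto simp: doubleton_eq_iff)
    qed
    moreover have "fst ` ends P' \<subseteq> \<Union>P'" by (auto simp: ends_def)
    moreover have "finite (\<Union>P')" by (rule finite_subset[OF D(1) fin])
    ultimately show ?thesis using card_inj_on_le[of fst "ends P'" "\<Union>P'"] D(4) by simp
  qed
  have fe: "finite (ends P')" if P: "P' \<in> partial_simple H (Suc k)" for P'
    by (rule finite_subset[of _ "H \<times> H"]) (use fin partial_simpleD(1)[OF P] in \<open>auto simp: ends_def\<close>)
  let ?f = "\<lambda>(P, a, b). (insert {a, b} P, a, b)"
  have "inj_on ?f (Sigma (partial_simple H k) ok)"
  proof (rule inj_onI)
    fix x y assume x: "x \<in> Sigma (partial_simple H k) ok" "y \<in> Sigma (partial_simple H k) ok" "?f x = ?f y"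
    obtain P a b where xe: "x = (P, a, b)" by (cases x)
    obtain P' where ye: "y = (P', a, b)" using x(3) xe by (cases y) auto
    have "{a, b} \<notin> P" "{a, b} \<notin> P'" using x xe ye by (auto simp: ok_def)
    moreover have "insert {a, b} P = insert {a, b} P'" using x(3) xe ye by simp
    ultimately show "x = y" using xe ye by (simp add: insert_ident)
  qed
  moreover have "?f ` Sigma (partial_simple H k) ok \<subseteq> Sigma (partial_simple H (Suc k)) ends"
  proof
    fix z assume "z \<in> ?f ` Sigma (partial_simple H k) ok"
    then obtain P a b where z: "z = (insert {a, b} P, a, b)" "P \<in> partial_simple H k" "(a, b) \<in> ok P" by auto
    then have "insert {a, b} P \<in> partial_simple H (Suc k)" by (intro partial_simple_insert) (auto simp: ok_def)
    moreover have "a \<noteq> b" using z(3) by (auto simp: ok_def)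
    ultimately show "z \<in> Sigma (partial_simple H (Suc k)) ends" using z by (auto simp: ends_def)
  qed
  ultimately have "card (Sigma (partial_simple H k) ok) \<le> card (Sigma (partial_simple H (Suc k)) ends)"
    using fe finite_partial_simple by (intro card_inj_on_le) auto
  also have "\<dots> = (\<Sum>P'\<in>partial_simple H (Suc k). card (ends P'))"
    using fe finite_partial_simple by (intro card_SigmaI) auto
  also have "\<dots> \<le> (\<Sum>P'\<in>partial_simple H (Suc k). 2 * Suc k)" using ce by (intro sum_mono)
  also have "\<dots> = card (partial_simple H (Suc k)) * (2 * Suc k)" by simp
  finally have "card (Sigma (partial_simple H k) ok) \<le> card (partial_simple H (Suc k)) * (2 * Suc k)" .
  moreover have "card (Sigma (partial_simple H k) ok) = (\<Sum>P\<in>partial_simple H k. card (ok P))"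
    using fok finite_partial_simple by (intro card_SigmaI) auto
  moreover have "(\<Sum>P\<in>partial_simple H k. r * (r - 7)) \<le> (\<Sum>P\<in>partial_simple H k. card (ok P))" using okc by (intro sum_mono)
  ultimately show ?thesis unfolding r_def by simp
qed

lemma partial_simple_remove:
  assumes P: "P \<in> partial_simple H (Suc k)" and e: "{c, d} \<in> P"
  shows "P - {{c, d}} \<in> partial_simple H k" "\<Union>(P - {{c, d}}) = \<Union>P - {c, d}"
proof -
  note D = partial_simpleD[OF P]
  have m: "P - {{c, d}} \<in> matchings (\<Union>P - {c, d})"
    using P e matchings_remove[of P "\<Union>P" c d] by (auto simp: partial_simple_def)
  then show U: "\<Union>(P - {{c, d}}) = \<Union>P - {c, d}" by (simp add: matchings_def)
  have "simple_matching (P - {{c, d}})" using P unfolding partial_simple_def simple_matching_def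
    by (auto intro: inj_on_subset)
  then show "P - {{c, d}} \<in> partial_simple H k" unfolding partial_simple_def using m U D e by auto
qed

text \<open>A partial matching is completed by switching: an edge \<open>cd\<close> far away from two free half-edges
  \<open>a\<close>, \<open>b\<close> is replaced by \<open>ac\<close> and \<open>bd\<close>.\<close>

lemma switch_count:
  assumes k: "k < M" "25 \<le> k"
  shows "card (partial_simple H k) \<le> card (partial_simple H (Suc k)) * (2 * M) ^ 4"
proof -
  have ex: "\<exists>a b c d. a \<noteq> b \<and> a \<in> H - \<Union>P \<and> b \<in> H - \<Union>P \<and> {c, d} \<in> P \<and> c \<noteq> d \<and> insert {b, d} (insert {a, c} (P - {{c, d}})) \<in> partial_simple H (Suc k)"
    if P: "P \<in> partial_simple H k" for P
  proof -
    note D = partial_simpleD[OF P]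
    have "2 \<le> card (H - \<Union>P)" using D(5) k by simp
    then obtain A where A: "A \<subseteq> H - \<Union>P" "card A = 2" by (meson obtain_subset_with_card_n)
    then obtain a b where ab: "a \<noteq> b" "a \<in> H - \<Union>P" "b \<in> H - \<Union>P" by (metis card_2_iff insert_subset)
    define nbr where "nbr x = {w. {fst x, w} \<in> image fst ` P}" for x :: "'v \<times> 'k"
    have nbr: "finite (nbr x)" "card (nbr x) \<le> 3" for x
    proof -
      define Q where "Q = {e\<in>P. fst x \<in> fst ` e}"
      have fQ: "finite Q" using D by (simp add: Q_def)
      have "\<exists>e. e \<in> Q \<and> fst ` e = {fst x, w}" if "w \<in> nbr x" for w
      proof -
        have "{fst x, w} \<in> image fst ` P" using that by (simp add: nbr_def)
        then obtain e where "e \<in> P" "fst ` e = {fst x, w}" by (metis imageE)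
        then show ?thesis by (auto simp: Q_def)
      qed
      then obtain t where t: "\<And>w. w \<in> nbr x \<Longrightarrow> t w \<in> Q \<and> fst ` t w = {fst x, w}" by metis
      have "inj_on t (nbr x)"
      proof (rule inj_onI)
        fix w w' assume w: "w \<in> nbr x" "w' \<in> nbr x" "t w = t w'"
        have "{fst x, w} = {fst x, w'}" using t[OF w(1)] t[OF w(2)] w(3) by simp
        then show "w = w'" by (rule pair_eq_cancel)
      qed
      moreover have "t ` nbr x \<subseteq> Q" using t by blast
      ultimately have "card (nbr x) \<le> card Q" "finite (nbr x)" using fQ by (auto intro: card_inj_on_le inj_on_finite)
      have "\<exists>y. y \<in> e \<and> fst y = fst x" if "e \<in> Q" for e using that by (auto simp: Q_def)
      then obtain p where p: "\<And>e. e \<in> Q \<Longrightarrow> p e \<in> e \<and> fst (p e) = fst x" by metis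
      have "inj_on p Q"
      proof (rule inj_onI)
        fix e e' assume "e \<in> Q" "e' \<in> Q" "p e = p e'"
        then show "e = e'" using D(8)[of e e' "p e"] p[of e] p[of e'] by (auto simp: Q_def)
      qed
      moreover have "p ` Q \<subseteq> {y\<in>H. fst y = fst x}"
      proof
        fix y assume "y \<in> p ` Q"
        then obtain e where e: "e \<in> Q" "y = p e" by blast
        then have "y \<in> \<Union>P" using p[OF e(1)] by (auto simp: Q_def)
        then show "y \<in> {y\<in>H. fst y = fst x}" using D(1) p[OF e(1)] e(2) by auto
      qed
      ultimately have "card Q \<le> card {y\<in>H. fst y = fst x}" using fin by (intro card_inj_on_le) auto
      then show "card (nbr x) \<le> 3" "finite (nbr x)" using deg[of "fst x"] \<open>card (nbr x) \<le> card Q\<close> \<open>finite (nbr x)\<close> by auto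
    qed
    \<comment> \<open>Keeping \<open>c\<close> and \<open>d\<close> away from these vertices makes
      the new edges neither loops nor parallel to old ones. The at most 8 vertices carry at most 24
      half-edges, and an edge meeting \<open>S\<close> uses one of its own, so 25 edges are
      enough.\<close>
    define S where "S = {fst a, fst b} \<union> (nbr a \<union> nbr b)"
    have fS: "finite S" using nbr by (simp add: S_def)
    have "card S \<le> card {fst a, fst b} + card (nbr a \<union> nbr b)" unfolding S_def by (rule card_Un_le)
    also have "\<dots> \<le> 2 + (3 + 3)"
      using card_Un_le[of "nbr a" "nbr b"] nbr(2)[of a] nbr(2)[of b] card_insert_le_m1[of 2 "{fst b}" "fst a"] by simp
    finally have cS: "card S \<le> 8" by simp
    have "\<exists>e\<in>P. fst ` e \<inter> S = {}"
    proof (rule ccontr)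
      assume "\<not> ?thesis"
      then have "\<exists>y. y \<in> e \<and> fst y \<in> S" if "e \<in> P" for e using that by blast
      then obtain p where p: "\<And>e. e \<in> P \<Longrightarrow> p e \<in> e \<and> fst (p e) \<in> S" by metis
      have "inj_on p P"
      proof (rule inj_onI)
        fix e e' assume "e \<in> P" "e' \<in> P" "p e = p e'"
        then show "e = e'" using D(8)[of e e' "p e"] p[of e] p[of e'] by auto
      qed
      moreover have "p ` P \<subseteq> {x\<in>H. fst x \<in> S}"
      proof
        fix y assume "y \<in> p ` P"
        then obtain e where e: "e \<in> P" "y = p e" by blast
        then have "y \<in> \<Union>P" using p[OF e(1)] by auto
        then show "y \<in> {x\<in>H. fst x \<in> S}" using D(1) p[OF e(1)] e(2) by auto
      qed
      ultimately have "card P \<le> card {x\<in>H. fst x \<in> S}" using fin by (intro card_inj_on_le) auto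
      then show False using card_at_le[OF fS] cS D(2) k by simp
    qed
    then obtain e where e: "e \<in> P" "fst ` e \<inter> S = {}" by blast
    obtain c d where cd: "e = {c, d}" "c \<noteq> d" using D(7)[OF e(1)] by (meson card_2_iff)
    have fcd: "fst c \<noteq> fst d" using D(9)[OF e(1)] cd by auto
    have nS: "fst c \<notin> S" "fst d \<notin> S" using e cd by auto
    obtain k' where k': "k = Suc k'" using k by (cases k) auto
    have R: "P - {{c, d}} \<in> partial_simple H k'" "\<Union>(P - {{c, d}}) = \<Union>P - {c, d}"
      using partial_simple_remove[of P k' c d] P e cd k' by auto
    have cdH: "c \<in> \<Union>P" "d \<in> \<Union>P" using e cd by auto
    have ne: "fst a \<noteq> fst c" "fst b \<noteq> fst d" "fst a \<noteq> fst d" using nS by (auto simp: S_def)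
    have na: "{fst a, fst c} \<notin> image fst ` P" "{fst b, fst d} \<notin> image fst ` P" using nS by (auto simp: S_def nbr_def)
    have I1: "insert {a, c} (P - {{c, d}}) \<in> partial_simple H k"
      unfolding k'
    proof (rule partial_simple_insert[OF R(1)])
      show "a \<in> H - \<Union>(P - {{c, d}})" "c \<in> H - \<Union>(P - {{c, d}})" unfolding R(2) using ab cdH D(1) by auto
    qed (use ne na in auto)
    have "insert {b, d} (insert {a, c} (P - {{c, d}})) \<in> partial_simple H (Suc k)"
    proof (rule partial_simple_insert[OF I1])
      have U: "\<Union>(insert {a, c} (P - {{c, d}})) = {a, c} \<union> (\<Union>P - {c, d})" using R(2) by auto
      show "b \<in> H - \<Union>(insert {a, c} (P - {{c, d}}))" "d \<in> H - \<Union>(insert {a, c} (P - {{c, d}}))"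
        unfolding U using ab cdH D(1) cd by auto
      \<comment> \<open>\<open>a\<close> and \<open>b\<close> may share a vertex; the two new edges
        still differ as vertex pairs, since the vertex of \<open>d\<close> is neither that of
        \<open>a\<close> nor that of \<open>c\<close>.\<close>
      show "{fst b, fst d} \<notin> image fst ` insert {a, c} (P - {{c, d}})"
        using na ne fcd by (auto simp: doubleton_eq_iff)
    qed (use ne in auto)
    then show ?thesis using ab cd e by blast
  qed
  then obtain a b c d where abcd: "\<And>P. P \<in> partial_simple H k \<Longrightarrow> a P \<noteq> b P \<and> a P \<in> H - \<Union>P \<and> b P \<in> H - \<Union>P \<and> {c P, d P} \<in> P \<and> c P \<noteq> d P \<and>
    insert {b P, d P} (insert {a P, c P} (P - {{c P, d P}})) \<in> partial_simple H (Suc k)" by metis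
  \<comment> \<open>Remembering the four half-edges makes the switching reversible, at the cost of
    the factor (2M)^4.\<close>
  let ?f = "\<lambda>P. (insert {b P, d P} (insert {a P, c P} (P - {{c P, d P}})), a P, b P, c P, d P)"
  have "inj_on ?f (partial_simple H k)"
  proof (rule inj_onI)
    fix P P' assume P: "P \<in> partial_simple H k" "P' \<in> partial_simple H k" "?f P = ?f P'"
    let ?g = "\<lambda>(S, a, b, c, d). insert {c, d} (S - {{b, d}, {a, c}})"
    have undo_switch: "P = ?g (?f P)"
      if "P \<in> partial_simple H k" for P
    proof -
      have "{a P, c P} \<notin> P" "{b P, d P} \<notin> P" "{c P, d P} \<in> P" using abcd[OF that] by auto
      then show ?thesis by auto
    qed
    have "?g (?f P) = ?g (?f P')" by (rule arg_cong[OF P(3)])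
    with undo_switch[OF P(1)] undo_switch[OF P(2)] show "P = P'" by (simp only:)
  qed
  moreover have "?f ` partial_simple H k \<subseteq> partial_simple H (Suc k) \<times> H \<times> H \<times> H \<times> H"
  proof
    fix z assume "z \<in> ?f ` partial_simple H k"
    then obtain P where P: "P \<in> partial_simple H k" "z = ?f P" by auto
    have "{c P, d P} \<subseteq> H" using abcd[OF P(1)] partial_simpleD(1)[OF P(1)] by blast
    then show "z \<in> partial_simple H (Suc k) \<times> H \<times> H \<times> H \<times> H" using P(2) abcd[OF P(1)] by simp
  qed
  ultimately have "card (partial_simple H k) \<le> card (partial_simple H (Suc k) \<times> H \<times> H \<times> H \<times> H)"
    using fin finite_partial_simple by (intro card_inj_on_le) auto
  also have "\<dots> = card (partial_simple H (Suc k)) * (2 * M) ^ 4" by (simp add: card_cartesian_product cardH power4_eq_xxxx)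
  finally show ?thesis .
qed

text \<open>With M - k = j + 4 the factor 2(M - k) - 7 is 2j + 1, again odd. So the greedy counts
  telescope into double factorials with index shifted by 3.\<close>

lemma extend_bound:
  assumes "k + 3 \<le> M"
  shows "matching_count (M - 3) * real (M choose k) \<le> real (card (partial_simple H k)) * matching_count (M - 3 - k)"
  using assms
proof (induction k)
  case 0
  have "{} \<in> partial_simple H 0" by (auto simp: partial_simple_def matchings_def simple_matching_def)
  then have "card (partial_simple H 0) \<noteq> 0" using finite_partial_simple by auto
  then have "1 \<le> real (card (partial_simple H 0))" by simp
  then show ?case using matching_count_pos[of "M - 3"] by simp
next
  case (Suc k)
  define N where "N = real (card (partial_simple H k))"
  define N' where "N' = real (card (partial_simple H (Suc k)))"
  define j where "j = M - 3 - Suc k"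
  have j: "M - 3 - k = Suc j" "M - k = j + 4" using Suc.prems by (auto simp: j_def)
  have "real (card (partial_simple H k) * (2 * (M - k) * (2 * (M - k) - 7))) \<le> real (card (partial_simple H (Suc k)) * (2 * Suc k))"
    using extend_count[of k] Suc.prems by (simp only: of_nat_le_iff)
  then have e: "N * ((real j + 4) * (2 * real j + 1)) \<le> N' * (real k + 1)"
    unfolding j N_def N'_def by (simp add: algebra_simps)
  have IH: "matching_count (M - 3) * real (M choose k) \<le> N * (matching_count j * (2 * real j + 1))"
    using Suc unfolding j N_def by (simp add: matching_count_def)
  have "Suc k * (M choose Suc k) = (M choose k) * (M - k)"
    using binomial_absorption[of k M] binomial_absorb_comp[of M k] by (metis mult.commute)
  then have b: "(real k + 1) * real (M choose Suc k) = real (M choose k) * (real j + 4)"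
    unfolding j by (metis of_nat_mult of_nat_Suc of_nat_add of_nat_numeral add.commute)
  have "(real k + 1) * (matching_count (M - 3) * real (M choose Suc k)) = (matching_count (M - 3) * real (M choose k)) * (real j + 4)"
    using arg_cong[OF b, of "\<lambda>x. matching_count (M - 3) * x"] by (simp only: ac_simps)
  also have "\<dots> \<le> (N * (matching_count j * (2 * real j + 1))) * (real j + 4)"
    using IH by (intro mult_right_mono) auto
  also have "\<dots> = matching_count j * (N * ((real j + 4) * (2 * real j + 1)))" by (simp add: algebra_simps)
  also have "\<dots> \<le> matching_count j * (N' * (real k + 1))" using e matching_count_pos[of j] by (intro mult_left_mono) auto
  finally have "(real k + 1) * (matching_count (M - 3) * real (M choose Suc k)) \<le> (real k + 1) * (N' * matching_count j)"
    by (simp add: algebra_simps)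
  then have "matching_count (M - 3) * real (M choose Suc k) \<le> N' * matching_count j"
    by (rule mult_left_le_imp_le) simp
  then show ?case unfolding N'_def j_def .
qed

text \<open>The greedy count ends at M - 3 edges, where all six free half-edges might be blocked.
  Three switchings cost (2M)^12, and the quotient of the double factorials at M and M - 3 costs
  (2M)^3.\<close>

theorem simple_matchings_bound:
  assumes "28 \<le> M"
  shows "matching_count M \<le> real (card (partial_simple H M)) * (2 * real M) ^ 15"
proof -
  define N where "N i = real (card (partial_simple H i))" for i
  define q where "q = 2 * real M"
  obtain j where j: "M = Suc (Suc (Suc j))" "25 \<le> j"
  proof
    show "M = Suc (Suc (Suc (M - 3)))" "25 \<le> M - 3" using assms by auto
  qed
  have "matching_count j * real (M choose j) \<le> N j * matching_count 0"
    using extend_bound[of j] unfolding N_def by (simp add: j(1))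
  moreover have "1 \<le> real (M choose j)" using j by (simp add: Suc_leI)
  then have "matching_count j * 1 \<le> matching_count j * real (M choose j)" using matching_count_pos[of j] by (intro mult_left_mono) auto
  ultimately have a: "matching_count j \<le> N j" by (simp add: matching_count_def)
  have st: "N i \<le> N (Suc i) * q ^ 4" if "25 \<le> i" "i < M" for i
  proof -
    have "real (card (partial_simple H i)) \<le> real (card (partial_simple H (Suc i)) * (2 * M) ^ 4)"
      using switch_count[OF that(2,1)] by (simp only: of_nat_le_iff)
    then show ?thesis by (simp add: N_def q_def)
  qed
  have q: "q \<ge> 0" by (simp add: q_def)
  have "N j \<le> N (Suc j) * q ^ 4" using st j by simp
  also have "\<dots> \<le> (N (Suc (Suc j)) * q ^ 4) * q ^ 4" using st[of "Suc j"] j q by (intro mult_right_mono) auto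
  also have "\<dots> \<le> ((N M * q ^ 4) * q ^ 4) * q ^ 4" using st[of "Suc (Suc j)"] j q by (intro mult_right_mono) auto
  also have "\<dots> = N M * q ^ 12" by (simp add: mult.assoc flip: power_add)
  finally have b: "N j \<le> N M * q ^ 12" .
  have "matching_count M = matching_count j * ((2 * real j + 1) * (2 * real (Suc j) + 1) * (2 * real (Suc (Suc j)) + 1))"
    unfolding j(1) matching_count_def by simp
  also have "\<dots> \<le> matching_count j * (q * q * q)"
    using matching_count_pos[of j] q by (intro mult_left_mono mult_mono) (auto simp: q_def j(1))
  also have "\<dots> \<le> (N M * q ^ 12) * (q * q * q)" using a b q by (intro mult_right_mono) auto
  also have "\<dots> = N M * q ^ 15" by (simp add: eval_nat_numeral)
  finally show ?thesis unfolding N_def q_def .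
qed

lemma partial_simple_full: "P \<in> partial_simple H M \<longleftrightarrow> P \<in> matchings H \<and> simple_matching P"
proof
  assume P: "P \<in> partial_simple H M"
  note D = partial_simpleD[OF P]
  have "\<Union>P = H" using D(1,4) cardH card_subset_eq[OF fin] by auto
  then show "P \<in> matchings H \<and> simple_matching P" using P by (auto simp: partial_simple_def)
next
  assume P: "P \<in> matchings H \<and> simple_matching P"
  have "\<Union>P = H" using P by (simp add: matchings_def)
  moreover have "card P = M" using even_card_matchings[OF fin, of P] P cardH by simp
  ultimately show "P \<in> partial_simple H M" using P by (simp add: partial_simple_def)
qed

end

subsection \<open>Random cubic graphs\<close>

definition cubic_half_edges :: "nat \<Rightarrow> (nat \<times> nat) set" where
  "cubic_half_edges n = {1..n} \<times> {..<3}"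

lemma half_edges_at: "{x\<in>cubic_half_edges n. fst x = v} = (if v \<in> {1..n} then {v} \<times> {..<3} else {})"
  by (auto simp: cubic_half_edges_def)

lemma finite_cubic_half_edges: "finite (cubic_half_edges n)"
  by (simp add: cubic_half_edges_def)

lemma half_edges_cubic:
  assumes "3 * n = 2 * m" shows "half_edges (cubic_half_edges n) m"
proof
  show "card (cubic_half_edges n) = 2 * m" using assms by (simp add: cubic_half_edges_def card_cartesian_product)
  show "card {x\<in>cubic_half_edges n. fst x = v} \<le> 3" for v unfolding half_edges_at by (simp add: card_cartesian_product)
qed (rule finite_cubic_half_edges)

lemma valid_cubic: "valid (cubic_half_edges n) {1..n}"
  unfolding valid_def half_edges_at by (simp add: finite_cubic_half_edges card_cartesian_product)

text \<open>At every vertex the three edges are numbered by 0, 1, 2, which assigns half-edges to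
  them. Extensionality makes distinct labelings differ at an actual incidence, as the count
  requires.\<close>

definition labelings :: "nat \<Rightarrow> nat set set \<Rightarrow> (nat \<Rightarrow> nat set \<Rightarrow> nat) set" where
  "labelings n E = (\<Pi>\<^sub>E v\<in>{1..n}. {f \<in> {e\<in>E. v \<in> e} \<rightarrow>\<^sub>E {..<3}. inj_on f {e\<in>E. v \<in> e}})"

definition lift_edge :: "(nat \<Rightarrow> nat set \<Rightarrow> nat) \<Rightarrow> nat set \<Rightarrow> (nat \<times> nat) set" where
  "lift_edge \<sigma> e = (\<lambda>v. (v, \<sigma> v e)) ` e"

definition fibre :: "nat \<Rightarrow> nat set set \<Rightarrow> (nat \<times> nat) set set set" where
  "fibre n E = {M \<in> matchings (cubic_half_edges n). simple_matching M \<and> image fst ` M = E}"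

lemma fst_lift_edge: "fst ` lift_edge \<sigma> e = e"
  by (force simp: lift_edge_def)

lemma card_labelings:
  assumes "cubic_graph {1..n} E"
  shows "card (labelings n E) = 6 ^ n"
proof -
  have "card {f \<in> {e\<in>E. v \<in> e} \<rightarrow>\<^sub>E {..<3::nat}. inj_on f {e\<in>E. v \<in> e}} = 6" if "v \<in> {1..n}" for v
  proof -
    have c: "card {e\<in>E. v \<in> e} = 3" using assms that by (simp add: cubic_graph_def vertex_degree_def)
    then have "finite {e\<in>E. v \<in> e}" by (intro card_ge_0_finite) simp
    from card_inj_on_subset_funcset[OF this _ subset_refl, of "{..<3::nat}"] show ?thesis
      unfolding c by (simp add: numeral_3_eq_3)
  qed
  then show ?thesis unfolding labelings_def by (subst card_PiE) auto
qed

text \<open>In both directions \<open>fst\<close> names the edge: it lets \<sigma> be read off the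
  lifted edges, and in a simple configuration it singles out the one matching edge over
  \<open>e\<close>, whose second components are the labels.\<close>

lemma labelings_bij:
  assumes E: "cubic_graph {1..n} E"
  shows "bij_betw (\<lambda>\<sigma>. lift_edge \<sigma> ` E) (labelings n E) (fibre n E)"
proof -
  have sub: "e \<subseteq> {1..n}" "card e = 2" if "e \<in> E" for e using E that by (auto simp: cubic_graph_def simple_graph_def)
  have deg: "card {e\<in>E. v \<in> e} = 3" if "v \<in> {1..n}" for v using E that by (simp add: cubic_graph_def vertex_degree_def)
  have into: "lift_edge \<sigma> ` E \<in> fibre n E" if s: "\<sigma> \<in> labelings n E" for \<sigma>
  proof -
    have s1: "\<sigma> v e < 3" if "v \<in> {1..n}" "e \<in> E" "v \<in> e" for v e using s that by (fastforce simp: labelings_def PiE_def Pi_def)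
    have s2: "inj_on (\<sigma> v) {e\<in>E. v \<in> e}" if "v \<in> {1..n}" for v using s that by (auto simp: labelings_def PiE_def Pi_def)
    have "\<Union>(lift_edge \<sigma> ` E) = cubic_half_edges n"
    proof (intro equalityI subsetI)
      fix x assume "x \<in> \<Union>(lift_edge \<sigma> ` E)"
      then obtain e v where ev: "e \<in> E" "v \<in> e" "x = (v, \<sigma> v e)" by (auto simp: lift_edge_def)
      then have "v \<in> {1..n}" using sub(1) by blast
      then show "x \<in> cubic_half_edges n" using s1[of v e] ev by (simp add: cubic_half_edges_def)
    next
      fix x assume x: "x \<in> cubic_half_edges n"
      obtain v k where vk: "x = (v, k)" "v \<in> {1..n}" "k < 3" using x by (auto simp: cubic_half_edges_def)
      have "card (\<sigma> v ` {e\<in>E. v \<in> e}) = 3" using card_image[OF s2[OF vk(2)]] deg[OF vk(2)] by simp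
      moreover have "\<sigma> v ` {e\<in>E. v \<in> e} \<subseteq> {..<3}" using s1[OF vk(2)] by auto
      ultimately have "\<sigma> v ` {e\<in>E. v \<in> e} = {..<3}" by (intro card_subset_eq) auto
      then have "k \<in> \<sigma> v ` {e\<in>E. v \<in> e}" using vk(3) by blast
      then obtain e where "e \<in> E" "v \<in> e" "\<sigma> v e = k" by blast
      then show "x \<in> \<Union>(lift_edge \<sigma> ` E)" using vk(1) by (auto simp: lift_edge_def)
    qed
    moreover have "card (lift_edge \<sigma> e) = 2" if "e \<in> E" for e
      unfolding lift_edge_def using sub(2)[OF that] by (subst card_image) (auto simp: inj_on_def)
    moreover have "lift_edge \<sigma> e \<inter> lift_edge \<sigma> e' = {}" if e: "e \<in> E" "e' \<in> E" "lift_edge \<sigma> e \<noteq> lift_edge \<sigma> e'" for e e'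
    proof (rule ccontr)
      assume "lift_edge \<sigma> e \<inter> lift_edge \<sigma> e' \<noteq> {}"
      then obtain v where v: "v \<in> e" "v \<in> e'" "\<sigma> v e = \<sigma> v e'" by (auto simp: lift_edge_def)
      then have "v \<in> {1..n}" using sub(1)[OF e(1)] by blast
      from inj_onD[OF s2[OF this] v(3)] v e show False by auto
    qed
    ultimately have "lift_edge \<sigma> ` E \<in> matchings (cubic_half_edges n)" unfolding matchings_def by blast
    moreover have "simple_matching (lift_edge \<sigma> ` E)" unfolding simple_matching_def
    proof
      show "\<forall>e\<in>lift_edge \<sigma> ` E. card (fst ` e) = 2" using sub(2) by (auto simp: fst_lift_edge)
      show "inj_on (image fst) (lift_edge \<sigma> ` E)" by (rule inj_onI) (auto simp: fst_lift_edge)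
    qed
    moreover have "image fst ` lift_edge \<sigma> ` E = E" by (simp add: image_image fst_lift_edge)
    ultimately show ?thesis by (simp add: fibre_def)
  qed
  have inj: "inj_on (\<lambda>\<sigma>. lift_edge \<sigma> ` E) (labelings n E)"
  proof (rule inj_onI)
    fix \<sigma> \<tau> assume st: "\<sigma> \<in> labelings n E" "\<tau> \<in> labelings n E" "lift_edge \<sigma> ` E = lift_edge \<tau> ` E"
    have eq: "\<sigma> v e = \<tau> v e" if "e \<in> E" "v \<in> e" for v e
    proof -
      have "lift_edge \<sigma> e \<in> lift_edge \<tau> ` E" using st(3) that by blast
      then obtain e' where e': "e' \<in> E" "lift_edge \<sigma> e = lift_edge \<tau> e'" by blast
      then have "e = e'" using fst_lift_edge by metis
      have "(v, \<sigma> v e) \<in> lift_edge \<sigma> e" using that by (simp add: lift_edge_def)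
      then have "(v, \<sigma> v e) \<in> lift_edge \<tau> e" using e' \<open>e = e'\<close> by simp
      then show ?thesis by (auto simp: lift_edge_def)
    qed
    show "\<sigma> = \<tau>"
    proof (rule PiE_ext[OF st(1,2)[unfolded labelings_def]])
      fix v assume v: "v \<in> {1..n}"
      have "\<sigma> v \<in> {e\<in>E. v \<in> e} \<rightarrow>\<^sub>E {..<3}" "\<tau> v \<in> {e\<in>E. v \<in> e} \<rightarrow>\<^sub>E {..<3}"
        using PiE_mem[OF st(1)[unfolded labelings_def] v] PiE_mem[OF st(2)[unfolded labelings_def] v] by auto
      then show "\<sigma> v = \<tau> v" by (rule PiE_ext) (use eq in auto)
    qed
  qed
  have surj: "M \<in> (\<lambda>\<sigma>. lift_edge \<sigma> ` E) ` labelings n E" if "M \<in> fibre n E" for M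
  proof -
    have M: "M \<in> matchings (cubic_half_edges n)" "simple_matching M" "image fst ` M = E" using that by (auto simp: fibre_def)
    note D = matchingsD[OF M(1)]
    have "\<exists>x. x \<in> M \<and> fst ` x = e" if "e \<in> E" for e using M(3) that by blast
    then obtain q where q: "\<And>e. e \<in> E \<Longrightarrow> q e \<in> M \<and> fst ` q e = e" by metis
    have "\<exists>k. (v, k) \<in> q e" if "e \<in> E" "v \<in> e" for v e
    proof -
      have "v \<in> fst ` q e" using q[OF that(1)] that(2) by simp
      then show ?thesis by auto
    qed
    then have "\<forall>v e. \<exists>k. e \<in> E \<and> v \<in> e \<longrightarrow> (v, k) \<in> q e" by blast
    then obtain s where s: "\<And>v e. e \<in> E \<Longrightarrow> v \<in> e \<Longrightarrow> (v, s v e) \<in> q e" by metis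
    define \<sigma> where "\<sigma> = (\<lambda>v\<in>{1..n}. \<lambda>e\<in>{e\<in>E. v \<in> e}. s v e)"
    have sg: "\<sigma> v e = s v e" if "e \<in> E" "v \<in> e" for v e
      using that sub(1)[OF that(1)] by (auto simp: \<sigma>_def)
    have lt: "s v e < 3" if "e \<in> E" "v \<in> e" for v e
    proof -
      have "(v, s v e) \<in> cubic_half_edges n" using s[OF that] q[OF that(1)] D(3) by blast
      then show ?thesis by (simp add: cubic_half_edges_def)
    qed
    have ij: "inj_on (s v) {e\<in>E. v \<in> e}" for v
    proof (rule inj_onI)
      fix e e' assume e: "e \<in> {e\<in>E. v \<in> e}" "e' \<in> {e\<in>E. v \<in> e}" "s v e = s v e'"
      have 1: "e \<in> E" "v \<in> e" "e' \<in> E" "v \<in> e'" using e by simp_all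
      have "q e = q e'"
      proof (rule D(2))
        show "(v, s v e) \<in> q e" by (rule s[OF 1(1,2)])
        show "(v, s v e) \<in> q e'" unfolding e(3) by (rule s[OF 1(3,4)])
      qed (use q[OF 1(1)] q[OF 1(3)] in simp_all)
      then show "e = e'" using q[OF 1(1)] q[OF 1(3)] by metis
    qed
    have "\<sigma> \<in> labelings n E" unfolding labelings_def
    proof (rule PiE_I)
      fix v assume v: "v \<in> {1..n}"
      have "\<sigma> v = restrict (s v) {e\<in>E. v \<in> e}" using v by (simp add: \<sigma>_def)
      then show "\<sigma> v \<in> {f \<in> {e\<in>E. v \<in> e} \<rightarrow>\<^sub>E {..<3}. inj_on f {e\<in>E. v \<in> e}}"
        using lt ij[of v] by (auto simp: inj_on_restrict_eq)
    qed (auto simp: \<sigma>_def)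
    moreover have le: "lift_edge \<sigma> e = q e" if e: "e \<in> E" for e
    proof (rule card_subset_eq)
      have c: "card (q e) = 2" using D(1) q[OF e] by blast
      then show "finite (q e)" by (intro card_ge_0_finite) simp
      show "lift_edge \<sigma> e \<subseteq> q e" using s[OF e] sg[OF e] by (auto simp: lift_edge_def)
      show "card (lift_edge \<sigma> e) = card (q e)"
        unfolding c lift_edge_def using sub(2)[OF e] by (subst card_image) (auto simp: inj_on_def)
    qed
    have "lift_edge \<sigma> ` E = M"
    proof (intro equalityI subsetI)
      fix x assume "x \<in> lift_edge \<sigma> ` E"
      then show "x \<in> M" using le q by auto
    next
      fix x assume x: "x \<in> M"
      then have "fst ` x \<in> E" using M(3) by blast
      moreover have "q (fst ` x) = x"
        using q[OF \<open>fst ` x \<in> E\<close>] M(2) x unfolding simple_matching_def by (meson inj_onD)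
      ultimately show "x \<in> lift_edge \<sigma> ` E" using le by (metis image_eqI)
    qed
    ultimately show ?thesis by blast
  qed
  show ?thesis unfolding bij_betw_def using inj into surj by blast
qed

lemma card_fibre: "cubic_graph {1..n} E \<Longrightarrow> card (fibre n E) = 6 ^ n"
  using bij_betw_same_card[OF labelings_bij] card_labelings by simp

text \<open>Simplicity makes the degrees right: distinct matching edges give distinct graph edges,
  and each has at most one half-edge at \<open>v\<close>, so the edges at \<open>v\<close>
  correspond to its three half-edges.\<close>

lemma cubic_graph_of_matching:
  assumes M: "M \<in> matchings (cubic_half_edges n)" "simple_matching M"
  shows "cubic_graph {1..n} (image fst ` M)"
proof -
  note D = matchingsD[OF M(1)]
  have c2: "card (fst ` e) = 2" if "e \<in> M" for e using M(2) that by (simp add: simple_matching_def)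
  have "simple_graph {1..n} (image fst ` M)"
  proof -
    have "fst ` e \<subseteq> {1..n}" if "e \<in> M" for e
    proof -
      have "e \<subseteq> cubic_half_edges n" using D(3) that by blast
      then show ?thesis by (auto simp: cubic_half_edges_def)
    qed
    then show ?thesis using c2 by (auto simp: simple_graph_def)
  qed
  moreover have "vertex_degree (image fst ` M) v = 3" if v: "v \<in> {1..n}" for v
  proof -
    have "{e \<in> image fst ` M. v \<in> e} = image fst ` {e\<in>M. v \<in> fst ` e}" by auto
    then have "vertex_degree (image fst ` M) v = card (image fst ` {e\<in>M. v \<in> fst ` e})" by (simp add: vertex_degree_def)
    also have "\<dots> = card {e\<in>M. v \<in> fst ` e}"
      using M(2) by (intro card_image) (auto simp: simple_matching_def intro: inj_on_subset)
    also have "\<dots> = card {x\<in>cubic_half_edges n. fst x = v}"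
    proof -
      have "\<exists>x. x \<in> e \<and> fst x = v" if "e \<in> {e\<in>M. v \<in> fst ` e}" for e using that by auto
      then obtain p where p: "\<And>e. e \<in> {e\<in>M. v \<in> fst ` e} \<Longrightarrow> p e \<in> e \<and> fst (p e) = v" by metis
      have "bij_betw p {e\<in>M. v \<in> fst ` e} {x\<in>cubic_half_edges n. fst x = v}"
        unfolding bij_betw_def
      proof (intro conjI equalityI subsetI)
        show "inj_on p {e\<in>M. v \<in> fst ` e}"
        proof (rule inj_onI)
          fix e e' assume e: "e \<in> {e\<in>M. v \<in> fst ` e}" "e' \<in> {e\<in>M. v \<in> fst ` e}" "p e = p e'"
          then show "e = e'" using D(2)[of e e' "p e"] p[OF e(1)] p[OF e(2)] by simp
        qed
      next
        fix x assume "x \<in> p ` {e\<in>M. v \<in> fst ` e}"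
        then obtain e where e: "e \<in> {e\<in>M. v \<in> fst ` e}" "x = p e" by blast
        have "x \<in> \<Union>M" using e p[OF e(1)] by auto
        then show "x \<in> {x\<in>cubic_half_edges n. fst x = v}" using D(3) p[OF e(1)] e(2) by simp
      next
        fix x assume x: "x \<in> {x\<in>cubic_half_edges n. fst x = v}"
        then obtain e where e: "e \<in> M" "x \<in> e" using D(3) by blast
        then have e': "e \<in> {e\<in>M. v \<in> fst ` e}" using x by auto
        have "finite e" using D(1)[OF e(1)] by (intro card_ge_0_finite) simp
        then have "inj_on fst e" using D(1)[OF e(1)] c2[OF e(1)] by (intro eq_card_imp_inj_on) auto
        then have "p e = x" using p[OF e'] e x by (auto simp: inj_on_def)
        then show "x \<in> p ` {e\<in>M. v \<in> fst ` e}" using e' by blast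
      qed
      then show ?thesis by (rule bij_betw_same_card)
    qed
    also have "\<dots> = 3" unfolding half_edges_at using v by (simp add: card_cartesian_product)
    finally show ?thesis .
  qed
  ultimately show ?thesis by (simp add: cubic_graph_def)
qed

section \<open>From configurations back to uniform cubic graphs\<close>

lemma finite_cubic_graphs: "finite (cubic_graphs n)"
  by (rule finite_subset[of _ "Pow (Pow {1..n})"]) (auto simp: cubic_graphs_def cubic_graph_def simple_graph_def)

lemma card_union_fibres:
  assumes "C \<subseteq> cubic_graphs n"
  shows "card (\<Union>E\<in>C. fibre n E) = card C * 6 ^ n"
proof -
  have "finite C" by (rule finite_subset[OF assms finite_cubic_graphs])
  moreover have "finite (fibre n E)" for E
    using finite_matchings[OF finite_cubic_half_edges] by (rule finite_subset[rotated]) (auto simp: fibre_def)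
  ultimately have "card (\<Union>E\<in>C. fibre n E) = (\<Sum>E\<in>C. card (fibre n E))"
    by (intro card_UN_disjoint) (auto simp: fibre_def)
  also have "\<dots> = (\<Sum>E\<in>C. 6 ^ n)" using assms by (intro sum.cong card_fibre) (auto simp: cubic_graphs_def)
  finally show ?thesis by simp
qed

lemma card_cubic_graphs_bound:
  assumes "3 * n = 2 * m" "28 \<le> m"
  shows "matching_count m \<le> real (card (cubic_graphs n)) * 6 ^ n * (3 * real n) ^ 15"
proof -
  interpret half_edges "cubic_half_edges n" m by (rule half_edges_cubic[OF assms(1)])
  have "partial_simple (cubic_half_edges n) m = (\<Union>E\<in>cubic_graphs n. fibre n E)"
    using cubic_graph_of_matching[of _ n] by (auto simp: partial_simple_full fibre_def cubic_graphs_def)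
  then have "card (partial_simple (cubic_half_edges n) m) = card (cubic_graphs n) * 6 ^ n"
    using card_union_fibres[OF subset_refl] by simp
  moreover have "2 * real m = 3 * real n" using assms(1) by linarith
  ultimately show ?thesis using simple_matchings_bound[OF assms(2)] by simp
qed

lemma independent_set_of_alpha:
  assumes M: "M \<in> fibre n E"
  obtains S where "independent_set {1..n} E S" "card S = alpha {1..n} M {}"
proof -
  have ne: "{} \<notin> M"
  proof
    assume "{} \<in> M"
    then show False using M matchingsD(1)[of M "cubic_half_edges n" "{}"] by (simp add: fibre_def)
  qed
  obtain S where S: "feasible {1..n} M {} S" "weight ({} :: (nat \<times> nat) set set) S = alpha {1..n} M {}"
    using alpha_attained[OF finite_atLeastAtMost[of 1 n] ne, where T = "{}"] .
  have "independent_set {1..n} E S"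
    unfolding independent_set_def pairwise_def
  proof (intro conjI ballI impI notI)
    show "S \<subseteq> {1..n}" using S(1) by (simp add: feasible_def)
    fix u v assume uv: "u \<in> S" "v \<in> S" "{u, v} \<in> E"
    then have "{u, v} \<in> image fst ` M" using M by (simp add: fibre_def)
    then obtain e where e: "e \<in> M" "fst ` e = {u, v}" by (metis imageE)
    have "\<forall>e\<in>M. \<not> fst ` e \<subseteq> S" using S(1) unfolding feasible_def Diff_empty by (rule conjunct2)
    then have "\<not> fst ` e \<subseteq> S" using e(1) by (rule bspec)
    then show False unfolding e(2) using uv(1,2) by simp
  qed
  then show ?thesis using that S(2) by (simp add: weight_def)
qed

definition large_independent :: "nat \<Rightarrow> nat set set \<Rightarrow> bool" where
  "large_independent n E \<longleftrightarrow> (\<exists>S. independent_set {1..n} E S \<and> real (card S) \<ge> 0.4352 * real n)"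

text \<open>Markov's inequality: each configuration over a bad graph contributes at least
  exp(-0.4352 l n) to the exponential moment. With l = 1/20000 the constant exp(300000 l) is exp 15,
  and the margin 0.4353 - 0.4352 leaves the rate 0.0001 l.\<close>

lemma card_bad_bound:
  assumes n: "3 * n = 2 * m"
  shows "real (card {E\<in>cubic_graphs n. \<not> large_independent n E}) * 6 ^ n \<le> matching_count m * (exp 15 * exp (- real n / 200000000))"
proof -
  define l :: real where "l = 1 / 20000"
  define t where "t = exp (- l)"
  define B where "B = (\<Union>E\<in>{E\<in>cubic_graphs n. \<not> large_independent n E}. fibre n E)"
  let ?H = "cubic_half_edges n" and ?W = "{1..n}"
  have l: "0 < l" "l \<le> 1 / 20000" by (auto simp: l_def)
  have cH: "card ?H = 2 * m" using n by (simp add: cubic_half_edges_def card_cartesian_product)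
  have small: "exp (- l * (0.4352 * real n)) \<le> t ^ alpha ?W M {}" if MB: "M \<in> B" for M
  proof -
    obtain E where E: "M \<in> fibre n E" "\<not> large_independent n E" using MB unfolding B_def by blast
    obtain S where S: "independent_set {1..n} E S" "card S = alpha {1..n} M {}" using independent_set_of_alpha[OF E(1)] .
    then have "real (alpha ?W M {}) < 0.4352 * real n" using E(2) by (auto simp: large_independent_def not_le)
    then have "l * real (alpha ?W M {}) \<le> l * (0.4352 * real n)" using l by (intro mult_left_mono) auto
    then show ?thesis unfolding t_def exp_of_nat_mult[symmetric] by (simp add: mult.commute)
  qed
  have sub: "B \<subseteq> matchings ?H" by (auto simp: B_def fibre_def)
  have fm: "finite (matchings ?H)" by (intro finite_matchings finite_cubic_half_edges)
  have "real (card B) * exp (- l * (0.4352 * real n)) = (\<Sum>M\<in>B. exp (- l * (0.4352 * real n)))" by simp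
  also have "\<dots> \<le> (\<Sum>M\<in>B. t ^ alpha ?W M {})" using small by (intro sum_mono) auto
  also have "\<dots> \<le> (\<Sum>M\<in>matchings ?H. t ^ alpha ?W M {})"
    using fm sub by (intro sum_mono2) (auto simp: t_def)
  also have "\<dots> = Zsum t ?H ?W 0"
  proof -
    have fl: "flagged ?H 0 = (\<lambda>M. (M, {})) ` matchings ?H"
    proof (intro equalityI subsetI)
      fix p assume p: "p \<in> flagged ?H 0"
      obtain M T where MT: "p = (M, T)" by (cases p)
      then have "(M, T) \<in> flagged ?H 0" using p by simp
      from flaggedD[OF this finite_cubic_half_edges] this MT show "p \<in> (\<lambda>M. (M, {})) ` matchings ?H"
        by (auto simp: flagged_def)
    qed (auto simp: flagged_def)
    show ?thesis unfolding Zsum_def fsum_def fl by (subst sum.reindex) (auto simp: inj_on_def)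
  qed
  also have "\<dots> \<le> flagged_count m 0 * bound l m (real (card ?W)) (real 0)"
    by (rule Zsum_bound[OF l t_def valid_cubic cH])
  also have "\<dots> = matching_count m * (exp 15 * exp (- l * (0.4353 * real n)))"
  proof -
    have "2 * real m - 3 * real n = 0" using n by linarith
    then show ?thesis unfolding bound_def[OF l t_def] by (simp add: flagged_count_def pot_def l_def)
  qed
  finally have "real (card B) * exp (- l * (0.4352 * real n)) \<le> matching_count m * (exp 15 * exp (- l * (0.4353 * real n)))" .
  then have "real (card B) * exp (- l * (0.4352 * real n)) * exp (l * (0.4352 * real n)) \<le>
     matching_count m * (exp 15 * exp (- l * (0.4353 * real n))) * exp (l * (0.4352 * real n))"
    by (rule mult_right_mono) simp
  then have "real (card B) \<le> matching_count m * (exp 15 * (exp (- l * (0.4353 * real n)) * exp (l * (0.4352 * real n))))"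
    by (simp add: mult.assoc flip: exp_add)
  also have "exp (- l * (0.4353 * real n)) * exp (l * (0.4352 * real n)) = exp (- real n / 200000000)"
    unfolding exp_add[symmetric] l_def by (simp add: field_simps)
  also have "real (card B) = real (card {E\<in>cubic_graphs n. \<not> large_independent n E}) * 6 ^ n"
    unfolding B_def by (subst card_union_fibres) auto
  finally show ?thesis .
qed

lemma prob_large_independent:
  assumes "even n" "n \<ge> 20"
  shows "1 - (3 * real n) ^ 15 * (exp 15 * exp (- real n / 200000000)) \<le>
    measure_pmf.prob (random_cubic_graph n) {E. large_independent n E}"
proof -
  \<comment> \<open>n >= 20 gives m >= 30, enough for the bound 28 of the switching
    argument.\<close>
  obtain m where m: "3 * n = 2 * m" "28 \<le> m" using assms by (auto elim!: evenE)
  define C where "C = real (card (cubic_graphs n))"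
  define D where "D = real (card {E\<in>cubic_graphs n. \<not> large_independent n E})"
  define q where "q = (3 * real n) ^ 15"
  define z where "z = exp 15 * exp (- real n / 200000000)"
  have z: "z \<ge> 0" by (simp add: z_def)
  have q: "q \<ge> 0" by (simp add: q_def)
  have a: "matching_count m \<le> C * 6 ^ n * q" using card_cubic_graphs_bound[OF m] by (simp add: C_def q_def)
  have b: "D * 6 ^ n \<le> matching_count m * z" using card_bad_bound[OF m(1)] by (simp add: D_def z_def)
  have "D * 6 ^ n \<le> (C * 6 ^ n * q) * z" using order_trans[OF b mult_right_mono[OF a z]] .
  then have "6 ^ n * D \<le> 6 ^ n * (C * (q * z))" by (simp add: ac_simps)
  then have D: "D \<le> C * (q * z)" by (rule mult_left_le_imp_le) simp
  \<comment> \<open>The positive lower bound on their number already shows that cubic graphs exist,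
    as \<open>pmf_of_set\<close> requires.\<close>
  have "C \<noteq> 0"
  proof
    assume "C = 0"
    then show False using a matching_count_pos[of m] by simp
  qed
  then have C: "C > 0" "cubic_graphs n \<noteq> {}" by (auto simp: C_def)
  have fin: "finite (cubic_graphs n)" by (rule finite_cubic_graphs)
  have "measure_pmf.prob (random_cubic_graph n) {E. large_independent n E} = real (card (cubic_graphs n \<inter> {E. large_independent n E})) / C"
    unfolding random_cubic_graph_def C_def using measure_pmf_of_set[OF C(2) fin] by simp
  also have "real (card (cubic_graphs n \<inter> {E. large_independent n E})) = C - D"
  proof -
    have "card (cubic_graphs n) = card ((cubic_graphs n \<inter> {E. large_independent n E}) \<union> {E\<in>cubic_graphs n. \<not> large_independent n E})"
      by (rule arg_cong[of _ _ card]) auto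
    also have "\<dots> = card (cubic_graphs n \<inter> {E. large_independent n E}) + card {E\<in>cubic_graphs n. \<not> large_independent n E}"
      using fin by (intro card_Un_disjoint) auto
    finally show ?thesis by (simp add: C_def D_def)
  qed
  also have "(C - D) / C \<ge> 1 - q * z"
  proof -
    have "D / C \<le> q * z" using D C by (simp add: pos_divide_le_eq mult.commute)
    then show ?thesis using C by (simp add: diff_divide_distrib)
  qed
  finally show ?thesis unfolding q_def z_def .
qed

theorem mainTheorem5:
  shows "((\<lambda>n. measure_pmf.prob (random_cubic_graph n)
             {E. \<exists>S. independent_set {1..n} E S \<and> real (card S) \<ge> 0.4352 * real n})
          \<longlongrightarrow> 1) (inf sequentially (principal {n. even n}))"
proof (rule tendsto_sandwich)
  show "\<forall>\<^sub>F n in inf sequentially (principal {n. even n}).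
      1 - (3 * real n) ^ 15 * (exp 15 * exp (- real n / 200000000)) \<le> measure_pmf.prob (random_cubic_graph n)
             {E. \<exists>S. independent_set {1..n} E S \<and> real (card S) \<ge> 0.4352 * real n}"
    unfolding eventually_inf_principal
    using eventually_ge_at_top[of "20 :: nat"]
    by eventually_elim (use prob_large_independent in \<open>auto simp: large_independent_def\<close>)
  have "((\<lambda>n. 1 - (3 * real n) ^ 15 * (exp 15 * exp (- real n / 200000000))) \<longlongrightarrow> 1) sequentially"
    by real_asymp
  then show "((\<lambda>n. 1 - (3 * real n) ^ 15 * (exp 15 * exp (- real n / 200000000))) \<longlongrightarrow> 1) (inf sequentially (principal {n. even n}))"
    by (rule tendsto_mono[rotated]) simp
  show "((\<lambda>n. 1) \<longlongrightarrow> (1 :: real)) (inf sequentially (principal {n. even n}))" by simp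
qed (simp add: measure_pmf.prob_le_1)

end
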